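(* Let $M$ be a compact connected oriented $n$-dimensional Riemannian manifold without boundary whose volume form $\mu$ is normalized by $\mu(M)=1$. The map $$\Psi:\mathfrak{D}(M)\to L^2(M,d\mu),\qquad \xi\mapsto\Psi(\xi)=\sqrt{\mathrm{Jac}_\mu\xi}$$ defines an isometry from the space of densities $\mathfrak{Dens}(M)=\mathfrak{D}_\mu(M)\backslash\mathfrak{D}(M)$ with the $\dot H^1$ metric $$\langle V,W\rangle_{\dot H^1}=\frac14\int_M\mathrm{div}\,v\cdot\mathrm{div}\,w\,d\mu,\qquad V=v\circ\eta,\ W=w\circ\eta\in T_\eta\mathfrak{D}(M),$$ to a subset of the unit sphere $S^\infty_{L^2}\subset\mathcal{C}^\infty(M)\cap L^2(M,d\mu)$ with the standard $L^2$ metric.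
   Context: $\mathfrak{D}(M)$ is the Fréchet Lie group of smooth orientation-preserving diffeomorphisms of $M$, and $T_e\mathfrak{D}(M)$ is the space of smooth vector fields; $\mathfrak{D}_\mu(M)=\{\eta\in\mathfrak{D}(M):\eta^*\mu=\mu\}$. $\mathrm{Jac}_\mu\xi$ is defined by $\xi^*\mu=(\mathrm{Jac}_\mu\xi)\,\mu$, and $\mathrm{div}$ is the divergence with respect to $\mu$. $\mathfrak{Dens}(M)$ is the Fréchet manifold of smooth positive $n$-forms on $M$ with total integral $1$, identified with the space of right cosets $\{\mathfrak{D}_\mu(M)\circ\xi\}$ via $\xi\mapsto\xi^*\mu$. The right-invariant bilinear form $\langle\cdot,\cdot\rangle_{\dot H^1}$ is degenerate on $\mathfrak{D}(M)$ (it vanishes on $v\circ\eta$ with $\mathrm{div}\,v=0$) and descends to a non-degenerate (weak) Riemannian metric on the quotient $\mathfrak{Dens}(M)$; this is the metric meant in the statement. "Isometry" is meant in the Riemannian sense: the induced map on the quotient is well defined, injective, and pulls the $L^2$ metric back to the $\dot H^1$ metric. $S^\infty_{L^2}=\{u: \int_M|u|^2d\mu=1\}$, with the metric induced by the $L^2(M,d\mu)$ inner product. *)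

theory Defs
  imports "HOL-Analysis.Analysis"
begin

primrec times_differentiable_on ::
  "nat \<Rightarrow> 'a::euclidean_space set \<Rightarrow> ('a \<Rightarrow> 'b::real_normed_vector) \<Rightarrow> bool" where
  "times_differentiable_on 0 S f \<longleftrightarrow> continuous_on S f"
| "times_differentiable_on (Suc k) S f \<longleftrightarrow>
     (\<forall>x\<in>S. f differentiable (at x)) \<and>
     (\<forall>h. times_differentiable_on k S (\<lambda>x. frechet_derivative f (at x) h))"

text \<open>Only used for open sets S.\<close>

definition smooth_on :: "'a::euclidean_space set \<Rightarrow> ('a \<Rightarrow> 'b::real_normed_vector) \<Rightarrow> bool" where
  "smooth_on S f \<longleftrightarrow> (\<forall>k. times_differentiable_on k S f)"


section \<open>Oriented manifolds\<close>

text \<open>The manifold is a whole type \<open>'m\<close>; its dimension is the cardinality of the type \<open>'n\<close>.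
  The smooth structure and the orientation are given by an atlas whose transition maps are
  smooth with positive Jacobian determinant. A chart is its domain together with the
  coordinate function, whose values off the domain are irrelevant.\<close>

type_synonym ('m, 'n) chart = "'m set \<times> ('m \<Rightarrow> real ^ 'n)"

abbreviation chart_dom :: "('m, 'n) chart \<Rightarrow> 'm set" where
  "chart_dom \<kappa> \<equiv> fst \<kappa>"

abbreviation chart_fun :: "('m, 'n) chart \<Rightarrow> 'm \<Rightarrow> real ^ 'n" where
  "chart_fun \<kappa> \<equiv> snd \<kappa>"

definition chart_inv :: "('m, 'n) chart \<Rightarrow> real ^ 'n \<Rightarrow> 'm" where
  "chart_inv \<kappa> = the_inv_into (chart_dom \<kappa>) (chart_fun \<kappa>)"

definition chart_img :: "('m, 'n) chart \<Rightarrow> (real ^ 'n) set" where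
  "chart_img \<kappa> = chart_fun \<kappa> ` chart_dom \<kappa>"

definition local_rep ::
  "('m, 'n::finite) chart \<Rightarrow> ('m, 'n) chart \<Rightarrow> ('m \<Rightarrow> 'm) \<Rightarrow> real ^ 'n \<Rightarrow> real ^ 'n" where
  "local_rep \<kappa> \<theta> f = (\<lambda>y. chart_fun \<theta> (f (chart_inv \<kappa> y)))"

definition local_deriv ::
  "('m, 'n::finite) chart \<Rightarrow> ('m, 'n) chart \<Rightarrow> ('m \<Rightarrow> 'm) \<Rightarrow> 'm \<Rightarrow> real ^ 'n \<Rightarrow> real ^ 'n" where
  "local_deriv \<kappa> \<theta> f p = frechet_derivative (local_rep \<kappa> \<theta> f) (at (chart_fun \<kappa> p))"

definition oriented_atlas :: "('m::topological_space, 'n::finite) chart set \<Rightarrow> bool" where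
  "oriented_atlas A \<longleftrightarrow>
     (\<Union>\<kappa>\<in>A. chart_dom \<kappa>) = UNIV \<and>
     (\<forall>\<kappa>\<in>A. open (chart_dom \<kappa>) \<and> open (chart_img \<kappa>) \<and>
        homeomorphism (chart_dom \<kappa>) (chart_img \<kappa>) (chart_fun \<kappa>) (chart_inv \<kappa>)) \<and>
     (\<forall>\<kappa>\<in>A. \<forall>\<theta>\<in>A.
        smooth_on (chart_fun \<kappa> ` (chart_dom \<kappa> \<inter> chart_dom \<theta>)) (local_rep \<kappa> \<theta> id) \<and>
        (\<forall>p \<in> chart_dom \<kappa> \<inter> chart_dom \<theta>. det (matrix (local_deriv \<kappa> \<theta> id p)) > 0))"

definition chart_at :: "('m, 'n) chart set \<Rightarrow> 'm \<Rightarrow> ('m, 'n) chart" where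
  "chart_at A p = (SOME \<kappa>. \<kappa> \<in> A \<and> p \<in> chart_dom \<kappa>)"


section \<open>Tangent vectors, vector fields and smooth maps\<close>

text \<open>A tangent vector at p is the family of its coordinate vectors in the charts around p,
  related by the derivatives of the transition maps (and set to 0 for all other charts, so
  that equality of families is equality of tangent vectors).\<close>

type_synonym ('m, 'n) tvec = "('m, 'n) chart \<Rightarrow> real ^ 'n"

definition tangent_space :: "('m, 'n::finite) chart set \<Rightarrow> 'm \<Rightarrow> ('m, 'n) tvec set" where
  "tangent_space A p =
     {X. (\<forall>\<kappa>\<in>A. \<forall>\<theta>\<in>A. p \<in> chart_dom \<kappa> \<inter> chart_dom \<theta> \<longrightarrow> X \<theta> = local_deriv \<kappa> \<theta> id p (X \<kappa>)) \<and>
         (\<forall>\<kappa>. \<kappa> \<notin> A \<or> p \<notin> chart_dom \<kappa> \<longrightarrow> X \<kappa> = 0)}"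

definition coord_vec ::
  "('m, 'n::finite) chart set \<Rightarrow> ('m, 'n) chart \<Rightarrow> 'm \<Rightarrow> 'n \<Rightarrow> ('m, 'n) tvec" where
  "coord_vec A \<kappa> p i =
     (\<lambda>\<theta>. if \<theta> \<in> A \<and> p \<in> chart_dom \<theta> then local_deriv \<kappa> \<theta> id p (axis i 1) else 0)"

definition tangent_map ::
  "('m, 'n::finite) chart set \<Rightarrow> ('m \<Rightarrow> 'm) \<Rightarrow> 'm \<Rightarrow> ('m, 'n) tvec \<Rightarrow> ('m, 'n) tvec" where
  "tangent_map A f p X =
     (\<lambda>\<theta>. if \<theta> \<in> A \<and> f p \<in> chart_dom \<theta>
          then local_deriv (chart_at A p) \<theta> f p (X (chart_at A p)) else 0)"

definition vector_field :: "('m, 'n::finite) chart set \<Rightarrow> ('m \<Rightarrow> ('m, 'n) tvec) \<Rightarrow> bool" where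
  "vector_field A v \<longleftrightarrow>
     (\<forall>p. v p \<in> tangent_space A p) \<and>
     (\<forall>\<kappa>\<in>A. smooth_on (chart_img \<kappa>) (\<lambda>y. v (chart_inv \<kappa> y) \<kappa>))"

definition smooth_fun :: "('m, 'n::finite) chart set \<Rightarrow> ('m \<Rightarrow> real) \<Rightarrow> bool" where
  "smooth_fun A u \<longleftrightarrow> (\<forall>\<kappa>\<in>A. smooth_on (chart_img \<kappa>) (\<lambda>y. u (chart_inv \<kappa> y)))"

definition smooth_map ::
  "('m::topological_space, 'n::finite) chart set \<Rightarrow> ('m \<Rightarrow> 'm) \<Rightarrow> bool" where
  "smooth_map A f \<longleftrightarrow>
     continuous_on UNIV f \<and>
     (\<forall>\<kappa>\<in>A. \<forall>\<theta>\<in>A. smooth_on (chart_fun \<kappa> ` (chart_dom \<kappa> \<inter> f -` chart_dom \<theta>)) (local_rep \<kappa> \<theta> f))"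


section \<open>Riemannian metric, volume form and volume measure\<close>

definition riemannian_metric ::
  "('m, 'n::finite) chart set \<Rightarrow> ('m \<Rightarrow> ('m, 'n) tvec \<Rightarrow> ('m, 'n) tvec \<Rightarrow> real) \<Rightarrow> bool" where
  "riemannian_metric A g \<longleftrightarrow>
     (\<forall>p. \<forall>X\<in>tangent_space A p. \<forall>Y\<in>tangent_space A p.
        g p X Y = g p Y X \<and>
        (\<forall>Z\<in>tangent_space A p. \<forall>a b.
           g p (\<lambda>\<kappa>. a *\<^sub>R X \<kappa> + b *\<^sub>R Y \<kappa>) Z = a * g p X Z + b * g p Y Z) \<and>
        (X \<noteq> (\<lambda>\<kappa>. 0) \<longrightarrow> g p X X > 0)) \<and>
     (\<forall>\<kappa>\<in>A. \<forall>i j. smooth_on (chart_img \<kappa>)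
        (\<lambda>y. let p = chart_inv \<kappa> y in g p (coord_vec A \<kappa> p i) (coord_vec A \<kappa> p j)))"

text \<open>An n-form takes a point and a family of tangent vectors indexed by \<open>'n\<close>. No order on
  \<open>'n\<close> is needed: the determinant fixes the orientation of the model space.\<close>

type_synonym ('m, 'n) nform = "'m \<Rightarrow> ('n \<Rightarrow> ('m, 'n) tvec) \<Rightarrow> real"

definition volume_form ::
  "('m, 'n::finite) chart set \<Rightarrow> ('m \<Rightarrow> ('m, 'n) tvec \<Rightarrow> ('m, 'n) tvec \<Rightarrow> real) \<Rightarrow> ('m, 'n) nform"
where
  "volume_form A g p X =
     (let \<kappa> = chart_at A p in
        sqrt (det (\<chi> i j. g p (coord_vec A \<kappa> p i) (coord_vec A \<kappa> p j)))
        * det (\<chi> i j. X j \<kappa> $ i))"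

text \<open>The coefficient \<open>\<rho>\<close> in \<open>\<omega> = \<rho> dx\<^sub>1 \<and> \<dots> \<and> dx\<^sub>n\<close>.\<close>

definition form_coeff ::
  "('m, 'n::finite) chart set \<Rightarrow> ('m, 'n) nform \<Rightarrow> ('m, 'n) chart \<Rightarrow> real ^ 'n \<Rightarrow> real" where
  "form_coeff A \<omega> \<kappa> y = \<omega> (chart_inv \<kappa> y) (coord_vec A \<kappa> (chart_inv \<kappa> y))"

text \<open>\<open>M\<close> is the Borel measure of the positive form \<open>\<omega>\<close>: the values on sets lying in a
  chart domain determine it.\<close>

definition measure_of_form ::
  "('m::topological_space, 'n::finite) chart set \<Rightarrow> ('m, 'n) nform \<Rightarrow> 'm measure \<Rightarrow> bool" where
  "measure_of_form A \<omega> M \<longleftrightarrow>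
     sets M = sets borel \<and>
     (\<forall>\<kappa>\<in>A. \<forall>B\<in>sets borel. B \<subseteq> chart_dom \<kappa> \<longrightarrow>
        emeasure M B = (\<integral>\<^sup>+ y \<in> chart_fun \<kappa> ` B. ennreal (form_coeff A \<omega> \<kappa> y) \<partial>lborel))"

definition pullback ::
  "('m, 'n::finite) chart set \<Rightarrow> ('m \<Rightarrow> 'm) \<Rightarrow> ('m, 'n) nform \<Rightarrow> ('m, 'n) nform" where
  "pullback A f \<omega> p X = \<omega> (f p) (\<lambda>i. tangent_map A f p (X i))"

definition Jac :: "('m, 'n::finite) chart set \<Rightarrow> ('m, 'n) nform \<Rightarrow> ('m \<Rightarrow> 'm) \<Rightarrow> 'm \<Rightarrow> real" where
  "Jac A \<omega> \<xi> p =
     (THE r. \<forall>X. (\<forall>i. X i \<in> tangent_space A p) \<longrightarrow> pullback A \<xi> \<omega> p X = r * \<omega> p X)"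

text \<open>The Lie derivative \<open>d(\<iota>\<^sub>v \<omega>)\<close> of \<open>\<omega> = \<rho> dx\<^sub>1 \<and> \<dots> \<and> dx\<^sub>n\<close> along \<open>v\<close> is
  \<open>(\<Sum>i. \<partial>\<^sub>i (\<rho> v\<^sub>i)) dx\<^sub>1 \<and> \<dots> \<and> dx\<^sub>n\<close>; the divergence is its quotient by \<open>\<omega>\<close>.\<close>

definition divergence ::
  "('m, 'n::finite) chart set \<Rightarrow> ('m, 'n) nform \<Rightarrow> ('m \<Rightarrow> ('m, 'n) tvec) \<Rightarrow> 'm \<Rightarrow> real" where
  "divergence A \<omega> v p =
     (let \<kappa> = chart_at A p; y = chart_fun \<kappa> p in
        (\<Sum>i\<in>UNIV. frechet_derivative
           (\<lambda>z. form_coeff A \<omega> \<kappa> z * (v (chart_inv \<kappa> z) \<kappa> $ i)) (at y) (axis i 1))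
        / form_coeff A \<omega> \<kappa> y)"


section \<open>Diffeomorphisms and densities\<close>

definition Diff :: "('m::topological_space, 'n::finite) chart set \<Rightarrow> ('m \<Rightarrow> 'm) set" where
  "Diff A = {\<xi>. bij \<xi> \<and> smooth_map A \<xi> \<and> smooth_map A (inv \<xi>) \<and>
     (\<forall>\<kappa>\<in>A. \<forall>\<theta>\<in>A. \<forall>p \<in> chart_dom \<kappa> \<inter> \<xi> -` chart_dom \<theta>. det (matrix (local_deriv \<kappa> \<theta> \<xi> p)) > 0)}"

definition Diff_vol ::
  "('m::topological_space, 'n::finite) chart set \<Rightarrow> ('m, 'n) nform \<Rightarrow> ('m \<Rightarrow> 'm) set" where
  "Diff_vol A \<omega> = {\<eta> \<in> Diff A.
     \<forall>p X. (\<forall>i. X i \<in> tangent_space A p) \<longrightarrow> pullback A \<eta> \<omega> p X = \<omega> p X}"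

definition right_coset ::
  "('m::topological_space, 'n::finite) chart set \<Rightarrow> ('m, 'n) nform \<Rightarrow> ('m \<Rightarrow> 'm) \<Rightarrow> ('m \<Rightarrow> 'm) set"
where
  "right_coset A \<omega> \<xi> = {\<eta> \<circ> \<xi> | \<eta>. \<eta> \<in> Diff_vol A \<omega>}"

text \<open>The space of densities as a quotient of the diffeomorphism group; \<open>\<xi> \<mapsto> pullback A \<xi> \<omega>\<close>
  identifies it with the positive n-forms of total integral 1.\<close>

definition Dens ::
  "('m::topological_space, 'n::finite) chart set \<Rightarrow> ('m, 'n) nform \<Rightarrow> ('m \<Rightarrow> 'm) set set" where
  "Dens A \<omega> = right_coset A \<omega> ` Diff A"

definition tangent_Diff ::
  "('m, 'n::finite) chart set \<Rightarrow> ('m \<Rightarrow> 'm) \<Rightarrow> ('m \<Rightarrow> ('m, 'n) tvec) set" where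
  "tangent_Diff A \<eta> = {v \<circ> \<eta> | v. vector_field A v}"

text \<open>Germs at 0 of smooth curves in the diffeomorphism group: smoothness is joint smoothness
  in time and space.\<close>

definition smooth_curve ::
  "('m::topological_space, 'n::finite) chart set \<Rightarrow> (real \<Rightarrow> 'm \<Rightarrow> 'm) \<Rightarrow> bool" where
  "smooth_curve A c \<longleftrightarrow> (\<exists>\<epsilon>>0.
     (\<forall>t\<in>{-\<epsilon><..<\<epsilon>}. c t \<in> Diff A) \<and>
     continuous_on ({-\<epsilon><..<\<epsilon>} \<times> UNIV) (\<lambda>(t, p). c t p) \<and>
     (\<forall>\<kappa>\<in>A. \<forall>\<theta>\<in>A. smooth_on
        {(t, y). t \<in> {-\<epsilon><..<\<epsilon>} \<and> y \<in> chart_img \<kappa> \<and> c t (chart_inv \<kappa> y) \<in> chart_dom \<theta>}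
        (\<lambda>(t, y). local_rep \<kappa> \<theta> (c t) y)))"

definition has_velocity ::
  "('m, 'n::finite) chart set \<Rightarrow> (real \<Rightarrow> 'm \<Rightarrow> 'm) \<Rightarrow> ('m \<Rightarrow> ('m, 'n) tvec) \<Rightarrow> bool" where
  "has_velocity A c V \<longleftrightarrow> (\<forall>p. \<forall>\<theta>\<in>A. c 0 p \<in> chart_dom \<theta> \<longrightarrow>
     ((\<lambda>t. chart_fun \<theta> (c t p)) has_vector_derivative V p \<theta>) (at 0))"

text \<open>A degenerate right-invariant form on the diffeomorphism group. On the quotient \<open>Dens\<close> a
  tangent vector at a coset is represented by any tangent vector \<open>V\<close> at any \<open>\<eta>\<close> in that
  coset, and its metric is the value of this form on representatives at a common \<open>\<eta>\<close>.\<close>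

definition H1_metric ::
  "('m, 'n::finite) chart set \<Rightarrow> ('m, 'n) nform \<Rightarrow> 'm measure \<Rightarrow> ('m \<Rightarrow> 'm) \<Rightarrow>
     ('m \<Rightarrow> ('m, 'n) tvec) \<Rightarrow> ('m \<Rightarrow> ('m, 'n) tvec) \<Rightarrow> real" where
  "H1_metric A \<omega> M \<eta> V W =
     1 / 4 * (\<integral>x. divergence A \<omega> (V \<circ> inv \<eta>) x * divergence A \<omega> (W \<circ> inv \<eta>) x \<partial>M)"


section \<open>The map into the sphere\<close>

definition Psi ::
  "('m, 'n::finite) chart set \<Rightarrow> ('m, 'n) nform \<Rightarrow> ('m \<Rightarrow> 'm) \<Rightarrow> 'm \<Rightarrow> real" where
  "Psi A \<omega> \<xi> = (\<lambda>x. sqrt (Jac A \<omega> \<xi> x))"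

definition L2_sphere :: "('m, 'n::finite) chart set \<Rightarrow> 'm measure \<Rightarrow> ('m \<Rightarrow> real) set" where
  "L2_sphere A M =
     {u. smooth_fun A u \<and> integrable M (\<lambda>x. (u x)\<^sup>2) \<and> (\<integral>x. (u x)\<^sup>2 \<partial>M) = 1}"

text \<open>\<open>D\<close> is the tangent map at \<open>\<eta>\<close> of an \<open>L\<^sup>2\<close>-valued map on the diffeomorphism group: a
  linear map that sends the velocity at 0 of each smooth curve through \<open>\<eta>\<close> to the \<open>L\<^sup>2\<close>
  derivative of the image curve. Each \<open>V\<close> in \<open>tangent_Diff A \<eta>\<close> is such a velocity (compose
  \<open>\<eta>\<close> with the flow of \<open>V \<circ> inv \<eta>\<close>), so \<open>D V\<close> is determined. Its smoothness is part of the
  definition since the sphere is taken inside the smooth functions; this also makes the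
  integrals converge.\<close>

definition L2_differential ::
  "('m::topological_space, 'n::finite) chart set \<Rightarrow> 'm measure \<Rightarrow> (('m \<Rightarrow> 'm) \<Rightarrow> 'm \<Rightarrow> real) \<Rightarrow>
     ('m \<Rightarrow> 'm) \<Rightarrow> (('m \<Rightarrow> ('m, 'n) tvec) \<Rightarrow> 'm \<Rightarrow> real) \<Rightarrow> bool" where
  "L2_differential A M F \<eta> D \<longleftrightarrow>
     (\<forall>V\<in>tangent_Diff A \<eta>.
        smooth_fun A (D V) \<and>
        (\<forall>W\<in>tangent_Diff A \<eta>. \<forall>a b.
           D (\<lambda>p \<kappa>. a *\<^sub>R V p \<kappa> + b *\<^sub>R W p \<kappa>) = (\<lambda>x. a * D V x + b * D W x)) \<and>
        (\<forall>c. smooth_curve A c \<and> c 0 = \<eta> \<and> has_velocity A c V \<longrightarrow>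
           ((\<lambda>h. \<integral>x. ((F (c h) x - F \<eta> x) / h - D V x)\<^sup>2 \<partial>M) \<longlongrightarrow> 0) (at 0)))"

end

theory Submission
  imports Defs
begin

text \<open>In local charts the Jacobian of a diffeomorphism is a quotient of densities times a determinant,
  so it is smooth and positive. It determines the coset: if \<open>Jac \<xi> = Jac \<eta>\<close>, then \<open>\<xi> \<circ> inv \<eta>\<close> preserves
  the volume form. Change of variables gives \<open>\<integral> (u \<circ> \<xi>) Jac \<xi> d\<mu> = \<integral> u d\<mu>\<close>; for \<open>u = 1\<close> this puts
  \<open>\<Psi> \<xi> = sqrt (Jac \<xi>)\<close> on the unit sphere. By the Jacobi formula for the derivative of a determinant, along
  a curve through \<open>\<eta>\<close> with velocity \<open>v \<circ> \<eta>\<close> the Jacobian changes at the rate \<open>(div v \<circ> \<eta>) Jac \<eta>\<close>, hence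
  \<open>\<Psi>\<close> at the rate \<open>1/2 (div v \<circ> \<eta>) \<Psi> \<eta>\<close>; joint smoothness and compactness make the convergence of the
  difference quotients uniform, so it holds in \<open>L\<^sup>2\<close>. The product of two such rates is
  \<open>1/4 ((div v div w) \<circ> \<eta>) Jac \<eta>\<close>, and change of variables turns its integral into the \<open>H\<^sup>1\<close> metric.\<close>

section \<open>Calculus of smooth functions\<close>

text \<open>Several objects are defined through an arbitrary chart picked at each point by
  \<open>chart_at\<close>, and the pick may jump between neighbouring points. Anything that is to be
  differentiated first needs a formula in one fixed chart. For the volume form this rests on the
  positive transition determinants, for the divergence on the invariance of the Lie derivative. That
  invariance and the derivative of \<open>Psi\<close> along a curve come from one computation: the
  time derivative of a density pulled back by a family that is smooth jointly in time and space. The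
  Jacobi formula alone does not finish it, since the rate of change of the spatial derivative matrix
  becomes the spatial derivative of the velocity only by the symmetry of second derivatives. A
  diffeomorphism may spread one chart domain over several others, so the change of variables is
  proved for pairs of charts and glued over a finite cover. The factor 1/2 from differentiating the
  square root is what produces the 1/4 in the metric.\<close>

lemma differentiable_cong_open:
  fixes f g :: "'a::euclidean_space \<Rightarrow> 'b::real_normed_vector"
  assumes "open S" "x \<in> S" "\<And>y. y \<in> S \<Longrightarrow> f y = g y" "f differentiable (at x)"
  shows "g differentiable (at x)"
  using assms by (meson differentiable_def has_derivative_transform_within_open)

lemma frechet_derivative_cong_open:
  fixes f g :: "'a::euclidean_space \<Rightarrow> 'b::real_normed_vector"
  assumes "open S" "x \<in> S" "\<And>y. y \<in> S \<Longrightarrow> f y = g y"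
  shows "frechet_derivative f (at x) = frechet_derivative g (at x)"
proof -
  have "(f has_derivative D) (at x) \<longleftrightarrow> (g has_derivative D) (at x)" for D
    using assms by (metis has_derivative_transform_within_open)
  then show ?thesis
    by (simp add: frechet_derivative_def)
qed

lemma frechet_derivative_eqI:
  "(f has_derivative D) (at x) \<Longrightarrow> frechet_derivative f (at x) h = D h"
  by (metis frechet_derivative_at)

lemma times_differentiable_on_cong:
  assumes "open S" "\<And>y. y \<in> S \<Longrightarrow> f y = g y" "times_differentiable_on k S f"
  shows "times_differentiable_on k S g"
  using assms
proof (induction k arbitrary: f g)
  case 0
  then show ?case by (simp cong: continuous_on_cong)
next
  case (Suc k)
  have "times_differentiable_on k S (\<lambda>x. frechet_derivative g (at x) h)" for h
  proof (rule Suc.IH[OF Suc.prems(1)])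
    show "times_differentiable_on k S (\<lambda>x. frechet_derivative f (at x) h)"
      using Suc.prems by simp
  qed (use frechet_derivative_cong_open[OF Suc.prems(1) _ Suc.prems(2)] in auto)
  moreover have "g differentiable (at x)" if "x \<in> S" for x
    using differentiable_cong_open[OF Suc.prems(1) that Suc.prems(2)] Suc.prems(3) that by simp
  ultimately show ?case by simp
qed

lemma times_differentiable_on_subset:
  "times_differentiable_on k S f \<Longrightarrow> T \<subseteq> S \<Longrightarrow> times_differentiable_on k T f"
  by (induction k arbitrary: f) (auto intro: continuous_on_subset)

lemma times_differentiable_on_SucD:
  "times_differentiable_on (Suc k) S f \<Longrightarrow> times_differentiable_on k S f"
proof (induction k arbitrary: f)
  case 0
  then show ?case
    by (auto intro!: continuous_at_imp_continuous_on differentiable_imp_continuous_within)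
next
  case (Suc k)
  then show ?case by simp
qed

text \<open>Composites, Jacobians and functions on the manifold have a coordinate formula only near
  each point, in charts chosen for that point; this glues such local statements.\<close>

lemma times_differentiable_on_local:
  assumes "\<And>x. x \<in> S \<Longrightarrow> \<exists>U. open U \<and> x \<in> U \<and> times_differentiable_on k (S \<inter> U) f"
  shows "times_differentiable_on k S f"
  using assms
proof (induction k arbitrary: f)
  case 0
  show ?case
    unfolding times_differentiable_on.simps continuous_on_eq_continuous_within
  proof
    fix x assume x: "x \<in> S"
    then obtain U where U: "open U" "x \<in> U" "continuous_on (S \<inter> U) f"
      using 0 by auto
    then have "continuous (at x within S \<inter> U) f"
      using x by (simp add: continuous_on_eq_continuous_within)
    moreover have "at x within S \<inter> U = at x within S"
      using U by (intro at_within_nhd[of x U]) auto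
    ultimately show "continuous (at x within S) f"
      by simp
  qed
next
  case (Suc k)
  have "times_differentiable_on k S (\<lambda>x. frechet_derivative f (at x) h)" for h
    using Suc.prems by (intro Suc.IH) fastforce
  moreover have "f differentiable (at x)" if "x \<in> S" for x
    using Suc.prems[OF that] that by auto
  ultimately show ?case by simp
qed

section \<open>Closure of differentiability of order \<open>k\<close> under algebraic operations and
  composition\<close>

lemma times_differentiable_on_const: "times_differentiable_on k S (\<lambda>x. c)"
  by (induction k arbitrary: c) (auto simp: frechet_derivative_const)

lemma times_differentiable_on_add:
  assumes "open S" "times_differentiable_on k S f" "times_differentiable_on k S g"
  shows "times_differentiable_on k S (\<lambda>x. f x + g x)"
  using assms
proof (induction k arbitrary: f g)
  case 0
  then show ?case by (simp add: continuous_on_add)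
next
  case (Suc k)
  have "times_differentiable_on k S (\<lambda>x. frechet_derivative (\<lambda>x. f x + g x) (at x) h)" for h
  proof (rule times_differentiable_on_cong[OF Suc.prems(1)])
    show "times_differentiable_on k S
        (\<lambda>x. frechet_derivative f (at x) h + frechet_derivative g (at x) h)"
      using Suc by simp
    show "frechet_derivative f (at x) h + frechet_derivative g (at x) h
        = frechet_derivative (\<lambda>x. f x + g x) (at x) h" if "x \<in> S" for x
      using Suc.prems that
      by (intro frechet_derivative_eqI[symmetric] has_derivative_add)
        (simp_all add: frechet_derivative_works)
  qed
  then show ?case using Suc.prems by simp
qed

lemma times_differentiable_on_sum:
  assumes "open S" "finite I" "\<And>i. i \<in> I \<Longrightarrow> times_differentiable_on k S (f i)"
  shows "times_differentiable_on k S (\<lambda>x. \<Sum>i\<in>I. f i x)"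
  using assms(2,3)
  by (induction I rule: finite_induct)
    (auto intro: times_differentiable_on_const times_differentiable_on_add assms(1))

lemma times_differentiable_on_bounded_linear:
  assumes L: "bounded_linear L" and "open S" "times_differentiable_on k S f"
  shows "times_differentiable_on k S (\<lambda>x. L (f x))"
  using assms(2,3)
proof (induction k arbitrary: f)
  case 0
  then show ?case by (simp add: bounded_linear.continuous_on[OF L])
next
  case (Suc k)
  have D: "((\<lambda>x. L (f x)) has_derivative (\<lambda>h. L (frechet_derivative f (at x) h))) (at x)"
    if "x \<in> S" for x
    using Suc.prems that by (intro bounded_linear.has_derivative[OF L]) (simp add: frechet_derivative_works)
  have "times_differentiable_on k S (\<lambda>x. frechet_derivative (\<lambda>x. L (f x)) (at x) h)" for h
    by (rule times_differentiable_on_cong[OF Suc.prems(1) _ Suc.IH[OF Suc.prems(1)],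
          of "\<lambda>x. frechet_derivative f (at x) h"])
      (use frechet_derivative_eqI[OF D] Suc.prems in auto)
  then show ?case
    using D by (auto simp: differentiable_def)
qed

lemma times_differentiable_on_bounded_bilinear:
  assumes B: "bounded_bilinear B" and "open S"
    and "times_differentiable_on k S f" "times_differentiable_on k S g"
  shows "times_differentiable_on k S (\<lambda>x. B (f x) (g x))"
  using assms(2-)
proof (induction k arbitrary: f g)
  case 0
  then show ?case by (simp add: bounded_bilinear.continuous_on[OF B])
next
  case (Suc k)
  let ?D = "\<lambda>f x. frechet_derivative f (at x)"
  have D: "((\<lambda>x. B (f x) (g x)) has_derivative (\<lambda>h. B (f x) (?D g x h) + B (?D f x h) (g x))) (at x)"
    if "x \<in> S" for x
    using Suc.prems that
    by (intro bounded_bilinear.FDERIV[OF B]) (simp_all add: frechet_derivative_works)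
  have fg: "times_differentiable_on k S f" "times_differentiable_on k S g"
    using Suc.prems times_differentiable_on_SucD by blast+
  have "times_differentiable_on k S (\<lambda>x. ?D (\<lambda>x. B (f x) (g x)) x h)" for h
  proof (rule times_differentiable_on_cong[OF Suc.prems(1)])
    show "times_differentiable_on k S (\<lambda>x. B (f x) (?D g x h) + B (?D f x h) (g x))"
      using Suc.prems fg by (intro times_differentiable_on_add Suc.IH) auto
  qed (use frechet_derivative_eqI[OF D] in auto)
  then show ?case
    using D by (auto simp: differentiable_def)
qed

text \<open>The direction \<open>?D g x h\<close> varies with \<open>x\<close>, while the induction
  hypothesis speaks of derivatives of \<open>f\<close> in a fixed direction. Expanding that
  direction over the basis leaves products of its coordinates with \<open>?D f (g x) b\<close>;
  hence \<open>f\<close> varies in the induction and \<open>g\<close> stays fixed.\<close>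

lemma times_differentiable_on_compose:
  fixes g :: "'a::euclidean_space \<Rightarrow> 'b::euclidean_space"
    and f :: "'b \<Rightarrow> 'c::real_normed_vector"
  assumes "open S" "times_differentiable_on k T f" "times_differentiable_on k S g" "g ` S \<subseteq> T"
  shows "times_differentiable_on k S (\<lambda>x. f (g x))"
  using assms(2-)
proof (induction k arbitrary: f)
  case 0
  then show ?case by (auto intro: continuous_on_compose2)
next
  case (Suc k)
  let ?D = "\<lambda>f x. frechet_derivative f (at x)"
  have lin: "linear (?D f (g x))" if "x \<in> S" for x
    using Suc.prems that by (intro linear_frechet_derivative) auto
  have D: "((\<lambda>x. f (g x)) has_derivative (\<lambda>h. ?D f (g x) (?D g x h))) (at x)" if "x \<in> S" for x
  proof -
    have "(f \<circ> g has_derivative ?D f (g x) \<circ> ?D g x) (at x)"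
      using Suc.prems that by (intro diff_chain_at) (auto simp: frechet_derivative_works[symmetric])
    then show ?thesis by (simp add: o_def)
  qed
  have "times_differentiable_on k S (\<lambda>x. ?D (\<lambda>x. f (g x)) x h)" for h
  proof (rule times_differentiable_on_cong[OF assms(1)])
    have "times_differentiable_on k S (\<lambda>x. ?D f (g x) b)" for b
      using Suc.prems times_differentiable_on_SucD[OF Suc.prems(2)]
      by (intro Suc.IH[of "\<lambda>x. ?D f x b"]) auto
    then show "times_differentiable_on k S (\<lambda>x. \<Sum>b\<in>Basis. (?D g x h \<bullet> b) *\<^sub>R ?D f (g x) b)"
      using Suc.prems
      by (intro times_differentiable_on_sum assms(1)
          times_differentiable_on_bounded_bilinear[OF bounded_bilinear_scaleR]
          times_differentiable_on_bounded_linear[OF bounded_linear_inner_left]) auto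
    show "(\<Sum>b\<in>Basis. (?D g x h \<bullet> b) *\<^sub>R ?D f (g x) b) = ?D (\<lambda>x. f (g x)) x h" if "x \<in> S" for x
    proof -
      have "?D f (g x) (?D g x h) = ?D f (g x) (\<Sum>b\<in>Basis. (?D g x h \<bullet> b) *\<^sub>R b)"
        by (simp add: euclidean_representation)
      also have "\<dots> = (\<Sum>b\<in>Basis. (?D g x h \<bullet> b) *\<^sub>R ?D f (g x) b)"
        using lin[OF that] by (simp add: linear_sum linear_scale)
      finally show ?thesis
        using frechet_derivative_at[OF D[OF that]] by metis
    qed
  qed
  then show ?case
    using D by (auto simp: differentiable_def)
qed

section \<open>Smooth functions on open sets\<close>

lemma smooth_on_cong:
  "open S \<Longrightarrow> (\<And>y. y \<in> S \<Longrightarrow> f y = g y) \<Longrightarrow> smooth_on S f \<Longrightarrow> smooth_on S g"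
  unfolding smooth_on_def using times_differentiable_on_cong[of S f g] by blast

lemma smooth_on_subset: "smooth_on S f \<Longrightarrow> T \<subseteq> S \<Longrightarrow> smooth_on T f"
  unfolding smooth_on_def using times_differentiable_on_subset by blast

lemma smooth_on_local:
  assumes "\<And>x. x \<in> S \<Longrightarrow> \<exists>U. open U \<and> x \<in> U \<and> smooth_on (S \<inter> U) f"
  shows "smooth_on S f"
  unfolding smooth_on_def
proof (intro allI times_differentiable_on_local)
  fix k x assume "x \<in> S"
  then obtain U where "open U" "x \<in> U" "smooth_on (S \<inter> U) f"
    using assms by blast
  then show "\<exists>U. open U \<and> x \<in> U \<and> times_differentiable_on k (S \<inter> U) f"
    unfolding smooth_on_def by blast
qed

lemma smooth_on_const: "smooth_on S (\<lambda>x. c)"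
  by (simp add: smooth_on_def times_differentiable_on_const)

lemma smooth_on_add:
  "open S \<Longrightarrow> smooth_on S f \<Longrightarrow> smooth_on S g \<Longrightarrow> smooth_on S (\<lambda>x. f x + g x)"
  by (simp add: smooth_on_def times_differentiable_on_add)

lemma smooth_on_sum:
  "open S \<Longrightarrow> finite I \<Longrightarrow> (\<And>i. i \<in> I \<Longrightarrow> smooth_on S (f i)) \<Longrightarrow> smooth_on S (\<lambda>x. \<Sum>i\<in>I. f i x)"
  by (simp add: smooth_on_def times_differentiable_on_sum)

lemma smooth_on_bounded_linear:
  "bounded_linear L \<Longrightarrow> open S \<Longrightarrow> smooth_on S f \<Longrightarrow> smooth_on S (\<lambda>x. L (f x))"
  by (simp add: smooth_on_def times_differentiable_on_bounded_linear)

lemma smooth_on_bounded_bilinear: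
  "bounded_bilinear B \<Longrightarrow> open S \<Longrightarrow> smooth_on S f \<Longrightarrow> smooth_on S g \<Longrightarrow> smooth_on S (\<lambda>x. B (f x) (g x))"
  by (simp add: smooth_on_def times_differentiable_on_bounded_bilinear)

lemma smooth_on_mult:
  fixes f g :: "'a::euclidean_space \<Rightarrow> real"
  shows "open S \<Longrightarrow> smooth_on S f \<Longrightarrow> smooth_on S g \<Longrightarrow> smooth_on S (\<lambda>x. f x * g x)"
  by (rule smooth_on_bounded_bilinear[OF bounded_bilinear_mult])

lemma smooth_on_scaleR:
  "open S \<Longrightarrow> smooth_on S f \<Longrightarrow> smooth_on S g \<Longrightarrow> smooth_on S (\<lambda>x. f x *\<^sub>R g x)"
  by (rule smooth_on_bounded_bilinear[OF bounded_bilinear_scaleR])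

lemma smooth_on_vec_nth:
  fixes f :: "'a::euclidean_space \<Rightarrow> real ^ 'n::finite"
  shows "open S \<Longrightarrow> smooth_on S f \<Longrightarrow> smooth_on S (\<lambda>x. f x $ i)"
  by (rule smooth_on_bounded_linear[OF bounded_linear_vec_nth])

lemma smooth_on_prod:
  fixes f :: "'i \<Rightarrow> 'a::euclidean_space \<Rightarrow> real"
  assumes "open S" "finite I" "\<And>i. i \<in> I \<Longrightarrow> smooth_on S (f i)"
  shows "smooth_on S (\<lambda>x. \<Prod>i\<in>I. f i x)"
  using assms(2,3)
  by (induction I rule: finite_induct) (auto intro: smooth_on_const smooth_on_mult assms(1))

lemma smooth_on_det:
  fixes f :: "'a::euclidean_space \<Rightarrow> real ^ 'n::finite ^ 'n"
  assumes "open S" "\<And>i j. smooth_on S (\<lambda>x. f x $ i $ j)"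
  shows "smooth_on S (\<lambda>x. det (f x))"
  unfolding det_def by (intro smooth_on_sum smooth_on_mult smooth_on_prod smooth_on_const assms) simp_all

lemma smooth_on_compose:
  fixes g :: "'a::euclidean_space \<Rightarrow> 'b::euclidean_space"
    and f :: "'b \<Rightarrow> 'c::real_normed_vector"
  assumes "open S" "smooth_on T f" "smooth_on S g" "g ` S \<subseteq> T"
  shows "smooth_on S (\<lambda>x. f (g x))"
  using assms by (simp add: smooth_on_def times_differentiable_on_compose[where T=T])

lemma smooth_on_ident: "open S \<Longrightarrow> smooth_on S (\<lambda>x. x)"
proof -
  have "times_differentiable_on k S (\<lambda>x. x)" for k
    by (cases k) (auto simp: frechet_derivative_ident times_differentiable_on_const)
  then show ?thesis by (simp add: smooth_on_def)
qed

lemma smooth_on_differentiable: "smooth_on S f \<Longrightarrow> x \<in> S \<Longrightarrow> f differentiable (at x)"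
  unfolding smooth_on_def by (drule spec[of _ "Suc 0"]) simp

lemma smooth_on_has_derivative:
  "smooth_on S f \<Longrightarrow> x \<in> S \<Longrightarrow> (f has_derivative frechet_derivative f (at x)) (at x)"
  using smooth_on_differentiable frechet_derivative_works by blast

lemma smooth_on_frechet_derivative:
  "smooth_on S f \<Longrightarrow> smooth_on S (\<lambda>x. frechet_derivative f (at x) h)"
  unfolding smooth_on_def
proof
  fix k assume "\<forall>k. times_differentiable_on k S f"
  then have "times_differentiable_on (Suc k) S f" ..
  then show "times_differentiable_on k S (\<lambda>x. frechet_derivative f (at x) h)" by simp
qed

lemma smooth_on_continuous_on: "smooth_on S f \<Longrightarrow> continuous_on S f"
  unfolding smooth_on_def by (drule spec[of _ 0]) simp

text \<open>Up to a constant the derivative is a product of two copies of \<open>inverse\<close>, so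
  the induction closes on itself.\<close>

lemma smooth_on_inverse_pos: "smooth_on {0<..} (inverse :: real \<Rightarrow> real)"
proof -
  have D: "((inverse :: real \<Rightarrow> real) has_derivative (\<lambda>h. - (inverse x * h * inverse x))) (at x)"
    if "x > 0" for x
    using that by (intro has_derivative_inverse') auto
  have "times_differentiable_on k {0<..} (inverse :: real \<Rightarrow> real)" for k
  proof (induction k)
    case 0
    show ?case by (simp add: continuous_on_inverse)
  next
    case (Suc k)
    have "times_differentiable_on k {0<..} (\<lambda>x::real. frechet_derivative inverse (at x) h)" for h
    proof (rule times_differentiable_on_cong)
      show "times_differentiable_on k {0<..} (\<lambda>x::real. - h * (inverse x * inverse x))"
        by (intro times_differentiable_on_bounded_bilinear[OF bounded_bilinear_mult]
            times_differentiable_on_const Suc.IH) auto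
      fix x :: real assume "x \<in> {0<..}"
      then show "- h * (inverse x * inverse x) = frechet_derivative inverse (at x) h"
        using frechet_derivative_eqI[OF D, of x h] by (simp add: ac_simps)
    qed auto
    then show ?case
      using D by (auto simp: differentiable_def)
  qed
  then show ?thesis by (simp add: smooth_on_def)
qed

lemma smooth_on_sqrt_pos: "smooth_on {0<..} sqrt"
proof -
  have D: "(sqrt has_derivative (*) (inverse (sqrt x) / 2)) (at x)" if "x > 0" for x
    using DERIV_real_sqrt[OF that] by (simp add: has_field_derivative_def)
  have "times_differentiable_on k {0<..} sqrt" for k
  proof (induction k)
    case 0
    show ?case by (simp add: continuous_on_real_sqrt)
  next
    case (Suc k)
    have "times_differentiable_on k {0<..} (\<lambda>x. frechet_derivative sqrt (at x) h)" for h
    proof (rule times_differentiable_on_cong)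
      \<comment> \<open>Written with \<open>sqrt x * inverse x\<close> in place of
        \<open>inverse (sqrt x)\<close>, so that the induction hypothesis for \<open>sqrt\<close>
        and the smoothness of \<open>inverse\<close> apply.\<close>
      show "times_differentiable_on k {0<..} (\<lambda>x. h / 2 * (sqrt x * inverse x))"
        using smooth_on_inverse_pos
        by (intro times_differentiable_on_bounded_bilinear[OF bounded_bilinear_mult]
            times_differentiable_on_const Suc.IH) (auto simp: smooth_on_def)
      fix x :: real assume "x \<in> {0<..}"
      then have "sqrt x * inverse x = inverse (sqrt x)"
        by (simp add: field_simps)
      then show "h / 2 * (sqrt x * inverse x) = frechet_derivative sqrt (at x) h"
        using frechet_derivative_eqI[OF D, of x h] \<open>x \<in> {0<..}\<close>
        by (simp add: ac_simps)
    qed auto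
    then show ?case
      using D by (auto simp: differentiable_def)
  qed
  then show ?thesis by (simp add: smooth_on_def)
qed

lemma smooth_on_divide:
  fixes f g :: "'a::euclidean_space \<Rightarrow> real"
  assumes "open S" "smooth_on S f" "smooth_on S g" "\<And>x. x \<in> S \<Longrightarrow> g x > 0"
  shows "smooth_on S (\<lambda>x. f x / g x)"
  unfolding divide_inverse
  using assms by (intro smooth_on_mult smooth_on_compose[OF _ smooth_on_inverse_pos]) auto

lemma smooth_on_sqrt:
  fixes f :: "'a::euclidean_space \<Rightarrow> real"
  assumes "open S" "smooth_on S f" "\<And>x. x \<in> S \<Longrightarrow> f x > 0"
  shows "smooth_on S (\<lambda>x. sqrt (f x))"
  using assms by (intro smooth_on_compose[OF _ smooth_on_sqrt_pos]) auto

section \<open>The transport equation for densities\<close>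

text \<open>The mean value theorem is applied twice: in direction \<open>h\<close> to the difference
  of \<open>f\<close> across a step \<open>s\<close> in direction \<open>k\<close>, then in
  direction \<open>k\<close> to the resulting difference of first derivatives.\<close>

lemma second_difference_mvt:
  fixes f :: "'a::euclidean_space \<Rightarrow> real"
  assumes f: "smooth_on S f" and "s > 0"
    and S: "\<And>a b. 0 \<le> a \<Longrightarrow> a \<le> s \<Longrightarrow> 0 \<le> b \<Longrightarrow> b \<le> s \<Longrightarrow> x + a *\<^sub>R h + b *\<^sub>R k \<in> S"
  shows "\<exists>a b. 0 < a \<and> a < s \<and> 0 < b \<and> b < s \<and>
    f (x + s *\<^sub>R h + s *\<^sub>R k) - f (x + s *\<^sub>R h) - f (x + s *\<^sub>R k) + f x =
    s * s * frechet_derivative (\<lambda>y. frechet_derivative f (at y) h) (at (x + a *\<^sub>R h + b *\<^sub>R k)) k"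
proof -
  let ?D = "\<lambda>f y. frechet_derivative f (at y)"
  have line: "((\<lambda>t. F (c + t *\<^sub>R v)) has_real_derivative ?D F (c + a *\<^sub>R v) v) (at a)"
    if "smooth_on S F" "c + a *\<^sub>R v \<in> S" for F :: "'a \<Rightarrow> real" and c v a
  proof -
    note DF = smooth_on_has_derivative[OF that]
    have "((\<lambda>t. F (c + t *\<^sub>R v)) has_derivative (\<lambda>t. ?D F (c + a *\<^sub>R v) (t *\<^sub>R v))) (at a)"
      by (rule has_derivative_compose[where f="\<lambda>t. c + t *\<^sub>R v" and x=a, OF _ DF])
        (auto intro!: derivative_eq_intros)
    moreover have "?D F (c + a *\<^sub>R v) (t *\<^sub>R v) = ?D F (c + a *\<^sub>R v) v * t" for t
      using has_derivative_linear[OF DF] by (simp add: linear_scale)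
    ultimately show ?thesis
      by (simp add: has_field_derivative_def)
  qed
  have line1: "((\<lambda>t. F (x + t *\<^sub>R h + b *\<^sub>R k)) has_real_derivative ?D F (x + a *\<^sub>R h + b *\<^sub>R k) h) (at a)"
    if "smooth_on S F" "0 \<le> a" "a \<le> s" "0 \<le> b" "b \<le> s" for F :: "'a \<Rightarrow> real" and a b
    using line[OF that(1), of "x + b *\<^sub>R k" a h] S[OF that(2-)] by (simp add: algebra_simps)
  \<comment> \<open>The factors \<open>0\<close> give all four corners the shape treated by
    \<open>line1\<close>, so that both sides are values of one function of the coefficient of
    \<open>h\<close>.\<close>
  have "\<exists>a. 0 < a \<and> a < s \<and>
    (f (x + s *\<^sub>R h + s *\<^sub>R k) - f (x + s *\<^sub>R h + 0 *\<^sub>R k)) - (f (x + 0 *\<^sub>R h + s *\<^sub>R k) - f (x + 0 *\<^sub>R h + 0 *\<^sub>R k))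
    = (s - 0) * (?D f (x + a *\<^sub>R h + s *\<^sub>R k) h - ?D f (x + a *\<^sub>R h + 0 *\<^sub>R k) h)"
    using \<open>s > 0\<close> by (intro MVT2 DERIV_diff line1[OF f]) auto
  then obtain a where a: "0 < a" "a < s" and 1:
    "f (x + s *\<^sub>R h + s *\<^sub>R k) - f (x + s *\<^sub>R h) - f (x + s *\<^sub>R k) + f x
    = s * (?D f (x + a *\<^sub>R h + s *\<^sub>R k) h - ?D f (x + a *\<^sub>R h + 0 *\<^sub>R k) h)"
    by auto
  have "\<exists>b. 0 < b \<and> b < s \<and>
    ?D f (x + a *\<^sub>R h + s *\<^sub>R k) h - ?D f (x + a *\<^sub>R h + 0 *\<^sub>R k) h
    = (s - 0) * ?D (\<lambda>y. ?D f y h) (x + a *\<^sub>R h + b *\<^sub>R k) k"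
    by (rule MVT2) (use \<open>s > 0\<close> a S line[OF smooth_on_frechet_derivative[OF f]] in auto)
  then obtain b where b: "0 < b" "b < s" and 2:
    "?D f (x + a *\<^sub>R h + s *\<^sub>R k) h - ?D f (x + a *\<^sub>R h + 0 *\<^sub>R k) h
    = s * ?D (\<lambda>y. ?D f y h) (x + a *\<^sub>R h + b *\<^sub>R k) k"
    by auto
  show ?thesis
    using a b 1 2 by (intro exI[of _ a] exI[of _ b]) (simp add: mult.assoc)
qed

text \<open>The second difference is symmetric in \<open>h\<close> and \<open>k\<close>. By its mean
  value form the two mixed derivatives therefore share a value, each at some point of an arbitrarily
  small parallelogram, and continuity excludes a gap at \<open>x\<close>.\<close>

lemma mixed_second_derivative_real:
  fixes f :: "'a::euclidean_space \<Rightarrow> real"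
  assumes "open S" "x \<in> S" and f: "smooth_on S f"
  shows "frechet_derivative (\<lambda>y. frechet_derivative f (at y) h) (at x) k =
    frechet_derivative (\<lambda>y. frechet_derivative f (at y) k) (at x) h"
proof (rule ccontr)
  let ?D = "\<lambda>h k y. frechet_derivative (\<lambda>y. frechet_derivative f (at y) h) (at y) k"
  assume neq: "?D h k x \<noteq> ?D k h x"
  \<comment> \<open>Half the gap: numbers closer than \<open>e\<close> to the two distinct values
    cannot coincide.\<close>
  define e where "e = \<bar>?D h k x - ?D k h x\<bar> / 2"
  have "e > 0" using neq by (simp add: e_def)
  have near: "\<exists>d>0. \<forall>y. dist y x < d \<longrightarrow> \<bar>?D h k y - ?D h k x\<bar> < e" for h k
  proof -
    have "continuous_on S (?D h k)"
      by (intro smooth_on_continuous_on smooth_on_frechet_derivative f)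
    then have "isCont (?D h k) x"
      using assms by (simp add: continuous_on_eq_continuous_at)
    then show ?thesis
      using \<open>e > 0\<close> unfolding continuous_at_eps_delta by (auto simp: dist_real_def)
  qed
  obtain d1 where d1: "d1 > 0" "\<And>y. dist y x < d1 \<Longrightarrow> \<bar>?D h k y - ?D h k x\<bar> < e"
    using near by blast
  obtain d2 where d2: "d2 > 0" "\<And>y. dist y x < d2 \<Longrightarrow> \<bar>?D k h y - ?D k h x\<bar> < e"
    using near by blast
  obtain r where r: "r > 0" "ball x r \<subseteq> S"
    using assms openE by blast
  define d where "d = min r (min d1 d2)"
  have "d > 0" using r d1 d2 by (simp add: d_def)
  \<comment> \<open>Small enough to keep the parallelogram with sides \<open>s h\<close> and
    \<open>s k\<close> in the ball of radius \<open>d\<close>; the summand \<open>1\<close> keeps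
    the denominator positive for zero directions.\<close>
  define s where "s = d / (norm h + norm k + 1)"
  have "s > 0" using \<open>d > 0\<close> by (auto simp: s_def intro!: divide_pos_pos add_nonneg_pos)
  have bound: "dist (x + a *\<^sub>R u + b *\<^sub>R v) x < d"
    if "0 \<le> a" "a \<le> s" "0 \<le> b" "b \<le> s" "norm u + norm v = norm h + norm k" for a b u v
  proof -
    have "norm (a *\<^sub>R u + b *\<^sub>R v) \<le> norm (a *\<^sub>R u) + norm (b *\<^sub>R v)"
      by (rule norm_triangle_ineq)
    also have "\<dots> \<le> s * norm u + s * norm v"
      using that by (intro add_mono) (auto intro!: mult_right_mono)
    also have "\<dots> = s * (norm h + norm k)"
      using that(5) by (simp flip: distrib_left)
    also have "\<dots> < s * (norm h + norm k + 1)"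
      using \<open>s > 0\<close> by simp
    also have "\<dots> = d"
      using norm_ge_zero[of h] norm_ge_zero[of k] unfolding s_def
      by (subst nonzero_eq_divide_eq[symmetric]) (auto simp: add_nonneg_eq_0_iff)
    finally show ?thesis by (simp add: dist_norm add.assoc)
  qed
  have inS: "x + a *\<^sub>R u + b *\<^sub>R v \<in> S"
    if "0 \<le> a" "a \<le> s" "0 \<le> b" "b \<le> s" "norm u + norm v = norm h + norm k" for a b u v
    using bound[OF that] r(2) by (auto simp: d_def dist_commute)
  obtain a b where ab: "0 < a" "a < s" "0 < b" "b < s" and 1:
    "f (x + s *\<^sub>R h + s *\<^sub>R k) - f (x + s *\<^sub>R h) - f (x + s *\<^sub>R k) + f x =
      s * s * ?D h k (x + a *\<^sub>R h + b *\<^sub>R k)"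
    using second_difference_mvt[OF f \<open>s > 0\<close>, of x h k] inS by auto
  obtain a' b' where ab': "0 < a'" "a' < s" "0 < b'" "b' < s" and 2:
    "f (x + s *\<^sub>R k + s *\<^sub>R h) - f (x + s *\<^sub>R k) - f (x + s *\<^sub>R h) + f x =
      s * s * ?D k h (x + a' *\<^sub>R k + b' *\<^sub>R h)"
    using second_difference_mvt[OF f \<open>s > 0\<close>, of x k h] inS by (auto simp: add.commute)
  have "s * s * ?D h k (x + a *\<^sub>R h + b *\<^sub>R k) = s * s * ?D k h (x + a' *\<^sub>R k + b' *\<^sub>R h)"
    using 1 2 by (simp add: algebra_simps)
  then have "?D h k (x + a *\<^sub>R h + b *\<^sub>R k) = ?D k h (x + a' *\<^sub>R k + b' *\<^sub>R h)"
    using \<open>s > 0\<close> by simp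
  moreover have "\<bar>?D h k (x + a *\<^sub>R h + b *\<^sub>R k) - ?D h k x\<bar> < e"
    using bound[of a b h k] ab by (intro d1) (simp add: d_def)
  moreover have "\<bar>?D k h (x + a' *\<^sub>R k + b' *\<^sub>R h) - ?D k h x\<bar> < e"
    using bound[of a' b' k h] ab' by (intro d2) (simp add: d_def add.commute)
  moreover have False if "p = q" "\<bar>p - u\<bar> < \<bar>u - v\<bar> / 2" "\<bar>q - v\<bar> < \<bar>u - v\<bar> / 2" for p q u v :: real
    using that by (auto simp: abs_if field_simps split: if_splits)
  ultimately show False
    unfolding e_def by blast
qed

lemma mixed_second_derivative:
  fixes f :: "'a::euclidean_space \<Rightarrow> 'b::euclidean_space"
  assumes "open S" "x \<in> S" and f: "smooth_on S f"
  shows "frechet_derivative (\<lambda>y. frechet_derivative f (at y) h) (at x) k =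
    frechet_derivative (\<lambda>y. frechet_derivative f (at y) k) (at x) h"
proof (rule euclidean_eqI)
  fix b :: 'b
  let ?D = "\<lambda>f y. frechet_derivative f (at y)"
  have inner: "?D (\<lambda>y. F y \<bullet> b) y h = ?D F y h \<bullet> b" if "smooth_on S F" "y \<in> S"
    for F :: "'a \<Rightarrow> 'b" and y h
    by (intro frechet_derivative_eqI bounded_linear.has_derivative[OF bounded_linear_inner_left]
        smooth_on_has_derivative[OF that])
  have "?D (\<lambda>y. ?D f y h) x k \<bullet> b = ?D (\<lambda>y. ?D (\<lambda>y. f y \<bullet> b) y h) x k" for h k
    using frechet_derivative_cong_open[OF assms(1,2), of "\<lambda>y. ?D (\<lambda>y. f y \<bullet> b) y h" "\<lambda>y. ?D f y h \<bullet> b"]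
      inner f assms(2) by (simp add: smooth_on_frechet_derivative)
  moreover have "smooth_on S (\<lambda>y. f y \<bullet> b)"
    by (rule smooth_on_bounded_linear[OF bounded_linear_inner_left assms(1) f])
  ultimately show "?D (\<lambda>y. ?D f y h) x k \<bullet> b = ?D (\<lambda>y. ?D f y k) x h \<bullet> b"
    using mixed_second_derivative_real[OF assms(1,2)] by metis
qed

section \<open>Derivative of the determinant along a curve of matrices\<close>

lemma permutes_eq_id:
  assumes "\<And>i. i \<noteq> k \<Longrightarrow> p i = i" "p permutes UNIV"
  shows "p = id"
proof -
  have "p permutes {k}"
    using assms by (auto simp: permutes_def)
  then show ?thesis by simp
qed

text \<open>The product rule removes one factor from each Leibniz term. A permutation other than the
  identity moves at least two indices, so an off-diagonal zero of the identity matrix is left, and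
  only the diagonal term survives.\<close>

lemma det_has_derivative_at_identity:
  fixes A :: "real \<Rightarrow> real ^ 'n::finite ^ 'n"
  assumes "\<And>i j. ((\<lambda>t. A t $ i $ j) has_real_derivative A' $ i $ j) (at t)" and "A t = mat 1"
  shows "((\<lambda>t. det (A t)) has_real_derivative trace A') (at t)"
proof -
  let ?P = "{p. p permutes (UNIV :: 'n set)}"
  let ?d = "\<lambda>p. \<Sum>k\<in>UNIV. A' $ k $ p k * (\<Prod>i\<in>UNIV - {k}. A t $ i $ p i)"
  have "((\<lambda>t. det (A t)) has_real_derivative (\<Sum>p\<in>?P. of_int (sign p) * ?d p)) (at t)"
    unfolding det_def using assms(1)
    by (intro DERIV_sum DERIV_cmult has_field_derivative_prod) auto
  moreover have "?d p = (if p = id then trace A' else 0)" if p: "p \<in> ?P" for p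
  proof -
    have z: "(\<Prod>i\<in>UNIV - {k}. A t $ i $ p i) = (if p = id then 1 else 0)" for k
    proof (cases "p = id")
      case False
      then obtain i where "i \<noteq> k" "p i \<noteq> i"
        using permutes_eq_id[of k p] p by blast
      then show ?thesis
        using False by (auto simp: assms(2) mat_def intro!: prod_zero)
    qed (simp add: assms(2) mat_def)
    show ?thesis
      by (simp add: z trace_def)
  qed
  then have "(\<Sum>p\<in>?P. of_int (sign p) * ?d p) = (\<Sum>p\<in>?P. if p = id then trace A' else 0)"
    by (intro sum.cong) auto
  ultimately show ?thesis
    by (simp add: permutes_id)
qed

text \<open>Right multiplication by the inverse \<open>B\<close> of \<open>A t\<close> moves the
  base point to the identity matrix and the derivative to \<open>W\<close>; multiplying by
  \<open>det (A t)\<close> then cancels \<open>det B\<close>.\<close>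

lemma det_has_derivative:
  fixes A :: "real \<Rightarrow> real ^ 'n::finite ^ 'n"
  assumes A: "\<And>i j. ((\<lambda>t. A t $ i $ j) has_real_derivative (W ** A t) $ i $ j) (at t)"
    and "det (A t) \<noteq> 0"
  shows "((\<lambda>t. det (A t)) has_real_derivative trace W * det (A t)) (at t)"
proof -
  obtain B where B: "A t ** B = mat 1"
    using assms(2) by (meson invertible_det_nz invertible_right_inverse)
  have "((\<lambda>u. (A u ** B) $ i $ j) has_real_derivative W $ i $ j) (at t)" for i j
  proof -
    have "((\<lambda>u. (A u ** B) $ i $ j) has_real_derivative ((W ** A t) ** B) $ i $ j) (at t)"
      unfolding matrix_matrix_mult_def[of "A _" B] matrix_matrix_mult_def[of "W ** A t" B]
      by (auto intro!: DERIV_sum DERIV_cmult_right A)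
    then show ?thesis
      by (simp add: B flip: matrix_mul_assoc)
  qed
  then have "((\<lambda>u. det (A u ** B)) has_real_derivative trace W) (at t)"
    by (rule det_has_derivative_at_identity) (rule B)
  from DERIV_cmult_right[OF this, of "det (A t)"]
  have "((\<lambda>u. det (A u) * (det B * det (A t))) has_real_derivative trace W * det (A t)) (at t)"
    by (simp add: det_mul mult.assoc)
  moreover have "det B * det (A t) = 1"
    using arg_cong[OF B, of det] by (simp add: det_mul mult.commute)
  ultimately show ?thesis by simp
qed

text \<open>The sum on the right is the coefficient of the Lie derivative along \<open>w\<close> of the form with density \<open>\<rho>\<close>.\<close>

lemma pulled_back_density_has_derivative:
  fixes C :: "real \<times> (real ^ 'n::finite) \<Rightarrow> real ^ 'n" and \<rho> :: "real ^ 'n \<Rightarrow> real"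
  assumes "open S" "(0, y) \<in> S" and C: "smooth_on S C" and CS: "C ` S \<subseteq> T"
    and \<rho>: "smooth_on T \<rho>" and w: "smooth_on T w"
    and vel: "\<And>z. (0, z) \<in> S \<Longrightarrow> frechet_derivative C (at (0, z)) (1, 0) = w (C (0, z))"
    and nz: "det (matrix (\<lambda>h. frechet_derivative C (at (0, y)) (0, h))) \<noteq> 0"
  shows "((\<lambda>t. \<rho> (C (t, y)) * det (matrix (\<lambda>h. frechet_derivative C (at (t, y)) (0, h))))
     has_real_derivative
      (\<Sum>i\<in>UNIV. frechet_derivative (\<lambda>z. \<rho> z * w z $ i) (at (C (0, y))) (axis i 1)) *
      det (matrix (\<lambda>h. frechet_derivative C (at (0, y)) (0, h)))) (at 0)"
proof -
  let ?D = "\<lambda>f x. frechet_derivative f (at x)"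
  let ?x = "(0, y) :: real \<times> (real ^ 'n)"
  define c where "c = C ?x"
  have cT: "c \<in> T" using CS assms(2) by (auto simp: c_def)
  have time: "((\<lambda>t. F (t, y)) has_derivative (\<lambda>t. t *\<^sub>R ?D F ?x (1, 0))) (at 0)"
    if "smooth_on S F" for F :: "_ \<Rightarrow> 'b::real_normed_vector"
  proof -
    note DF = smooth_on_has_derivative[OF that assms(2)]
    have "((\<lambda>t. F (t, y)) has_derivative (\<lambda>t. ?D F ?x (t, 0))) (at 0)"
      by (rule has_derivative_compose[where f="\<lambda>t. (t, y)" and x=0, OF _ DF])
        (auto intro!: derivative_eq_intros)
    moreover have "(\<lambda>t. ?D F ?x (t, 0)) = (\<lambda>t. t *\<^sub>R ?D F ?x (1, 0))"
    proof
      fix t :: real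
      have "(t, 0) = t *\<^sub>R (1, 0 :: real ^ 'n)" by simp
      then show "?D F ?x (t, 0) = t *\<^sub>R ?D F ?x (1, 0)"
        by (metis linear_scale[OF has_derivative_linear[OF DF]])
    qed
    ultimately show ?thesis by (rule back_subst)
  qed
  have space: "((\<lambda>z. F (0, z)) has_derivative (\<lambda>h. ?D F ?x (0, h))) (at y)"
    if "smooth_on S F" for F :: "_ \<Rightarrow> 'b::real_normed_vector"
    by (rule has_derivative_compose[where f="\<lambda>z. (0, z)" and x=y,
          OF _ smooth_on_has_derivative[OF that assms(2)]])
      (auto intro!: derivative_eq_intros)
  define W where "W = ?D w c"
  have W: "(w has_derivative W) (at c)"
    unfolding W_def by (rule smooth_on_has_derivative[OF w cT])
  have linW: "linear W" using has_derivative_linear[OF W] .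
  let ?A = "\<lambda>t. matrix (\<lambda>h. ?D C (t, y) (0, h))"
  have lin0: "linear (\<lambda>h. ?D C ?x (0, h))"
    using has_derivative_linear[OF space[OF C]] .
  \<comment> \<open>Interchanging time and space derivatives turns the rate of change of the
    Jacobian matrix into the spatial derivative of the velocity, which the chain rule
    evaluates.\<close>
  have WA: "?D (\<lambda>x. ?D C x (0, h)) ?x (1, 0) = W (?D C ?x (0, h))" for h
  proof -
    have "?D (\<lambda>x. ?D C x (0, h)) ?x (1, 0) = ?D (\<lambda>x. ?D C x (1, 0)) ?x (0, h)"
      by (rule mixed_second_derivative[OF assms(1,2) C])
    moreover have "((\<lambda>z. ?D C (0, z) (1, 0)) has_derivative (\<lambda>h. W (?D C ?x (0, h)))) (at y)"
    proof -
      have "((\<lambda>z. w (C (0, z))) has_derivative (\<lambda>h. W (?D C ?x (0, h)))) (at y)"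
        using has_derivative_compose[OF space[OF C], of w W] W by (simp add: c_def)
      \<comment> \<open>The velocity identity holds on a whole neighbourhood of \<open>y\<close> in
        the time slice, so it may be differentiated in space.\<close>
      moreover have "open ((\<lambda>z. (0, z)) -` S)" "y \<in> (\<lambda>z. (0, z)) -` S"
        using assms(1,2) by (auto intro!: open_vimage continuous_intros)
      ultimately show ?thesis
        by (rule has_derivative_transform_within_open) (use vel in auto)
    qed
    ultimately show ?thesis
      using has_derivative_unique[OF space[OF smooth_on_frechet_derivative[OF C]], of "(1, 0)"]
      by metis
  qed
  have entries: "((\<lambda>t. ?A t $ i $ j) has_real_derivative (matrix W ** ?A 0) $ i $ j) (at 0)" for i j
  proof -
    have "((\<lambda>t. ?D C (t, y) (0, axis j 1) $ i) has_derivative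
        (\<lambda>t. (t *\<^sub>R W (?D C ?x (0, axis j 1))) $ i)) (at 0)"
      using time[OF smooth_on_frechet_derivative[OF C], of "(0, axis j 1)"] unfolding WA
      by (rule bounded_linear.has_derivative[OF bounded_linear_vec_nth])
    moreover have "W (?D C ?x (0, axis j 1)) $ i = (matrix W ** ?A 0) $ i $ j"
      using arg_cong[OF matrix_compose[OF lin0 linW], of "\<lambda>M. M $ i $ j"] by (simp add: matrix_def o_def)
    ultimately show ?thesis
      by (simp add: has_field_derivative_def matrix_def mult_commute_abs)
  qed
  have det': "((\<lambda>t. det (?A t)) has_real_derivative trace (matrix W) * det (?A 0)) (at 0)"
    by (rule det_has_derivative[OF entries nz])
  note D\<rho> = smooth_on_has_derivative[OF \<rho> cT]
  have lin\<rho>: "linear (?D \<rho> c)" using has_derivative_linear[OF D\<rho>] .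
  have \<rho>': "((\<lambda>t. \<rho> (C (t, y))) has_real_derivative ?D \<rho> c (w c)) (at 0)"
  proof -
    have "((\<lambda>t. \<rho> (C (t, y))) has_derivative (\<lambda>t. ?D \<rho> c (t *\<^sub>R w c))) (at 0)"
      using has_derivative_compose[OF time[OF C], of \<rho> "?D \<rho> c"] D\<rho> vel[OF assms(2)]
      by (simp add: c_def)
    then show ?thesis
      by (simp add: has_field_derivative_def linear_scale[OF lin\<rho>] mult_commute_abs)
  qed
  \<comment> \<open>The product rule splits the Lie derivative into the change of the density along
    \<open>w\<close> and the trace that the Jacobi formula produces.\<close>
  have "?D (\<lambda>z. \<rho> z * w z $ i) c (axis i 1) = ?D \<rho> c (axis i 1) * w c $ i + \<rho> c * W (axis i 1) $ i" for i
    by (rule frechet_derivative_eqI)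
      (auto intro!: derivative_eq_intros D\<rho> bounded_linear.has_derivative[OF bounded_linear_vec_nth] W)
  moreover have "(\<Sum>i\<in>UNIV. ?D \<rho> c (axis i 1) * w c $ i) = ?D \<rho> c (w c)"
  proof -
    have "?D \<rho> c (w c) = ?D \<rho> c (\<Sum>i\<in>UNIV. w c $ i *\<^sub>R axis i 1)"
      using basis_expansion[of "w c"] by (simp add: scalar_mult_eq_scaleR)
    then show ?thesis
      by (simp add: linear_sum[OF lin\<rho>] linear_scale[OF lin\<rho>] mult.commute)
  qed
  moreover have "trace (matrix W) = (\<Sum>i\<in>UNIV. W (axis i 1) $ i)"
    by (simp add: trace_def matrix_def)
  ultimately have "(\<Sum>i\<in>UNIV. ?D (\<lambda>z. \<rho> z * w z $ i) c (axis i 1)) =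
      ?D \<rho> c (w c) + \<rho> c * trace (matrix W)"
    by (simp add: sum.distrib sum_distrib_left)
  then show ?thesis
    using DERIV_mult[OF \<rho>' det'] by (simp add: c_def[symmetric] algebra_simps)
qed

section \<open>Change of variables for an arbitrary finite index type\<close>

text \<open>The change of variables theorem of the library needs a well-ordered index type; the type
  below is a copy of an arbitrary finite type, with an arbitrary well-order.\<close>

typedef 'a wo = "UNIV :: 'a set" ..

definition wo_rank :: "'a::finite wo \<Rightarrow> nat" where
  "wo_rank = (SOME f. inj f)"

lemma bij_Rep_wo: "bij Rep_wo"
  by (metis Abs_wo_inverse UNIV_I Rep_wo_inverse bij_iff)

lemma finite_UNIV_wo: "finite (UNIV :: 'a::finite wo set)"
proof -
  have "UNIV = Abs_wo ` (UNIV :: 'a set)"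
    by (metis Rep_wo_inverse surj_def)
  then show ?thesis by (metis finite finite_imageI)
qed

lemma inj_wo_rank: "inj (wo_rank :: 'a::finite wo \<Rightarrow> nat)"
  unfolding wo_rank_def
  using finite_imp_inj_to_nat_seg[OF finite_UNIV_wo] by (metis someI_ex)

instantiation wo :: (finite) wellorder
begin

definition "x \<le> y \<longleftrightarrow> wo_rank x \<le> wo_rank y"
definition "x < y \<longleftrightarrow> wo_rank x < wo_rank y"

instance
proof
  fix x y z :: "'a wo"
  show "x < y \<longleftrightarrow> x \<le> y \<and> \<not> y \<le> x"
    unfolding less_eq_wo_def less_wo_def by linarith
  show "x \<le> x"
    unfolding less_eq_wo_def by simp
  show "x \<le> y \<Longrightarrow> y \<le> z \<Longrightarrow> x \<le> z"
    unfolding less_eq_wo_def by linarith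
  show "x \<le> y \<Longrightarrow> y \<le> x \<Longrightarrow> x = y"
    unfolding less_eq_wo_def by (rule injD[OF inj_wo_rank]) linarith
  show "x \<le> y \<or> y \<le> x"
    unfolding less_eq_wo_def by linarith
next
  fix P :: "'a wo \<Rightarrow> bool" and a :: "'a wo"
  assume step: "\<And>x. (\<And>y. y < x \<Longrightarrow> P y) \<Longrightarrow> P x"
  show "P a"
    by (rule measure_induct_rule[of wo_rank P a], rule step) (simp add: less_wo_def)
qed

end

instance wo :: (finite) finite
  by standard (rule finite_UNIV_wo)

section \<open>Lebesgue measure and determinants under relabelling of coordinates\<close>

definition to_wo :: "real ^ 'n \<Rightarrow> real ^ ('n::finite) wo" where
  "to_wo x = (\<chi> i. x $ Rep_wo i)"

definition of_wo :: "real ^ ('n::finite) wo \<Rightarrow> real ^ 'n" where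
  "of_wo x = (\<chi> i. x $ Abs_wo i)"

lemma of_wo_to_wo [simp]: "of_wo (to_wo x) = x"
  by (simp add: of_wo_def to_wo_def vec_eq_iff Abs_wo_inverse)

lemma to_wo_of_wo [simp]: "to_wo (of_wo x) = x"
  by (simp add: of_wo_def to_wo_def vec_eq_iff Rep_wo_inverse)

lemma bounded_linear_to_wo: "bounded_linear to_wo"
  by (intro linear_conv_bounded_linear[THEN iffD1] linearI) (simp_all add: to_wo_def vec_eq_iff)

lemma bounded_linear_of_wo: "bounded_linear of_wo"
  by (intro linear_conv_bounded_linear[THEN iffD1] linearI) (simp_all add: of_wo_def vec_eq_iff)

lemma borel_measurable_of_wo [measurable]: "of_wo \<in> borel \<rightarrow>\<^sub>M borel"
  by (intro borel_measurable_continuous_onI linear_continuous_on bounded_linear_of_wo)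

lemma prod_Basis_vec:
  fixes F :: "real \<Rightarrow> real" and x :: "real ^ 'n::finite"
  shows "(\<Prod>b\<in>Basis. F (x \<bullet> b)) = (\<Prod>i\<in>UNIV. F (x $ i))"
proof -
  have "Basis = (\<lambda>i. axis i 1 :: real ^ 'n) ` UNIV"
    by (auto simp: Basis_vec_def)
  moreover have "inj (\<lambda>i. axis i 1 :: real ^ 'n)"
    by (simp add: inj_def axis_eq_axis)
  ultimately have "(\<Prod>b\<in>Basis. F (x \<bullet> b)) = (\<Prod>i\<in>UNIV. F (x \<bullet> axis i 1))"
    by (intro prod.reindex_cong) auto
  then show ?thesis
    by (simp add: inner_axis)
qed

text \<open>Relabelling coordinates takes boxes to boxes with the same side lengths, and Lebesgue
  measure is determined by its values on boxes.\<close>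

lemma lborel_distr_of_wo: "lborel = distr lborel borel (of_wo :: real ^ 'n::finite wo \<Rightarrow> _)"
proof (rule lborel_eqI)
  fix l u :: "real ^ 'n" assume lu: "\<And>b. b \<in> Basis \<Longrightarrow> l \<bullet> b \<le> u \<bullet> b"
  then have le: "l $ i \<le> u $ i" for i
    by (metis axis_in_Basis_iff insertI1 Basis_real_def inner_axis inner_real_def mult.right_neutral)
  have "of_wo -` box l u = box (to_wo l) (to_wo u)"
    by (auto simp: mem_box_cart of_wo_def to_wo_def)
      (metis Rep_wo_inverse Abs_wo_inverse UNIV_I)+
  then have "emeasure (distr lborel borel of_wo) (box l u) = emeasure lborel (box (to_wo l) (to_wo u))"
    by (simp add: emeasure_distr)
  also have "\<dots> = ennreal (\<Prod>b\<in>Basis. (to_wo u - to_wo l) \<bullet> b)"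
    by (rule emeasure_lborel_box) (auto simp: Basis_vec_def inner_axis to_wo_def le)
  also have "(\<Prod>b\<in>Basis. (to_wo u - to_wo l) \<bullet> b) = (\<Prod>i\<in>UNIV. (u - l) $ Rep_wo i)"
    by (subst prod_Basis_vec[where F="\<lambda>x. x"]) (simp add: to_wo_def)
  also have "\<dots> = (\<Prod>i\<in>UNIV. (u - l) $ i)"
    by (rule prod.reindex_bij_betw[OF bij_Rep_wo])
  also have "\<dots> = (\<Prod>b\<in>Basis. (u - l) \<bullet> b)"
    by (rule prod_Basis_vec[where F="\<lambda>x. x", symmetric])
  finally show "emeasure (distr lborel borel of_wo) (box l u) = ennreal (\<Prod>b\<in>Basis. (u - l) \<bullet> b)" .
qed simp

text \<open>Conjugation with \<open>f\<close>, here \<open>?c\<close>, is a sign-preserving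
  bijection between the permutations of the two index types and matches the Leibniz terms.\<close>

lemma det_reindex:
  fixes f :: "'m::finite \<Rightarrow> 'n::finite" and A :: "'a::comm_ring_1 ^ 'n ^ 'n"
  assumes f: "bij f"
  shows "det (\<chi> i j. A $ f i $ f j) = det A"
proof -
  let ?c = "\<lambda>p x. if x \<in> UNIV then f (p (inv_into UNIV f x)) else x"
  have c: "?c p = map_permutation UNIV f p" for p
    using f by (auto simp: map_permutation_def restrict_id_def fun_eq_iff bij_def)
  have "det A = (\<Sum>p | p permutes UNIV. of_int (sign (?c p)) * (\<Prod>i\<in>UNIV. A $ i $ ?c p i))"
    unfolding det_def by (rule sum.reindex_bij_betw[OF bij_betw_permutations[OF f], symmetric])
  also have "\<dots> = (\<Sum>p | p permutes UNIV. of_int (sign p) * (\<Prod>i\<in>UNIV. A $ f i $ f (p i)))"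
  proof (rule sum.cong[OF refl])
    fix p :: "'m \<Rightarrow> 'm" assume "p \<in> {p. p permutes UNIV}"
    then have "sign (?c p) = sign p"
      unfolding c using f by (intro sign_map_permutation) (auto simp: bij_def)
    moreover have "(\<Prod>i\<in>UNIV. A $ i $ ?c p i) = (\<Prod>i\<in>UNIV. A $ f i $ ?c p (f i))"
      by (rule prod.reindex_bij_betw[OF f, symmetric])
    ultimately show "of_int (sign (?c p)) * (\<Prod>i\<in>UNIV. A $ i $ ?c p i)
        = of_int (sign p) * (\<Prod>i\<in>UNIV. A $ f i $ f (p i))"
      using f by (simp add: bij_def)
  qed
  finally show ?thesis by (simp add: det_def)
qed

lemma det_matrix_wo: "det (matrix (to_wo \<circ> L \<circ> of_wo)) = det (matrix (L :: real ^ 'n::finite \<Rightarrow> real ^ 'n))"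
proof -
  have "of_wo (axis j 1) = axis (Rep_wo j) 1" for j :: "'n wo"
    by (auto simp: of_wo_def axis_def vec_eq_iff Abs_wo_inverse Rep_wo_inverse)
  then have "matrix (to_wo \<circ> L \<circ> of_wo) = (\<chi> i j. matrix L $ Rep_wo i $ Rep_wo j)"
    by (simp add: matrix_def to_wo_def)
  then show ?thesis
    by (simp add: det_reindex[OF bij_Rep_wo])
qed

text \<open>The substitution theorem \<open>cov_invertible_nonneg_eq\<close> concerns gauge
  integrals with real values; finiteness supplies the real number \<open>r\<close> that links the
  two kinds of integral.\<close>

lemma nn_integral_change_of_variables_wellorder:
  fixes f :: "real ^ 'n::{finite,wellorder} \<Rightarrow> real" and g :: "real ^ 'n::_ \<Rightarrow> real ^ 'n::_"
  assumes "\<And>x. x \<in> S \<Longrightarrow> (g has_derivative g' x) (at x within S)"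
    and "\<And>y. y \<in> T \<Longrightarrow> (h has_derivative h' y) (at y within T)"
    and f: "\<And>y. y \<in> T \<Longrightarrow> 0 \<le> f y"
    and gS: "\<And>x. x \<in> S \<Longrightarrow> g x \<in> T \<and> h (g x) = x"
    and "\<And>y. y \<in> T \<Longrightarrow> h y \<in> S \<and> g (h y) = y"
    and "\<And>y. y \<in> T \<Longrightarrow> h' y \<circ> g' (h y) = id"
    and meas: "(\<lambda>y. indicator T y * f y) \<in> borel_measurable borel"
    and fin: "(\<integral>\<^sup>+y\<in>T. ennreal (f y) \<partial>lborel) < \<infinity>"
  shows "(\<integral>\<^sup>+y\<in>T. ennreal (f y) \<partial>lborel)
    = (\<integral>\<^sup>+x\<in>S. ennreal (\<bar>det (matrix (g' x))\<bar> * f (g x)) \<partial>lborel)"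
proof -
  obtain r where r: "r \<ge> 0" "(\<integral>\<^sup>+y\<in>T. ennreal (f y) \<partial>lborel) = ennreal r"
    using fin by (cases "\<integral>\<^sup>+y\<in>T. ennreal (f y) \<partial>lborel" rule: ennreal_cases) auto
  have "(\<integral>\<^sup>+y. ennreal (indicator T y * f y) \<partial>lborel) = (\<integral>\<^sup>+y\<in>T. ennreal (f y) \<partial>lborel)"
    by (intro nn_integral_cong) (auto simp: indicator_def)
  then have "((\<lambda>y. indicator T y * f y) has_integral r) UNIV"
    using f r meas by (intro nn_integral_has_integral) (auto simp: indicator_def)
  moreover have "(\<lambda>y. indicator T y * f y) = (\<lambda>y. if y \<in> T then f y else 0)"
    by (auto simp: indicator_def)
  ultimately have "(f has_integral r) T"
    by (simp only: has_integral_restrict_UNIV)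
  then have "((\<lambda>x. \<bar>det (matrix (g' x))\<bar> * f (g x)) has_integral r) S"
    by (subst cov_invertible_nonneg_eq[where g = g and f = f, OF assms(1-6)])
  then have "(\<integral>\<^sup>+x\<in>S. ennreal (\<bar>det (matrix (g' x))\<bar> * f (g x)) \<partial>lborel) = ennreal r"
    using gS f by (intro nn_integral_has_integral_lebesgue') auto
  then show ?thesis using r by simp
qed

text \<open>Conjugation with \<open>to_wo\<close> and \<open>of_wo\<close> carries the maps to the
  well-ordered index type. The integrals on both sides move along the image measure, which is where
  the two measurability assumptions enter.\<close>

theorem nn_integral_change_of_variables:
  fixes f :: "real ^ 'n::finite \<Rightarrow> real" and g :: "real ^ 'n \<Rightarrow> real ^ 'n"
  assumes g: "\<And>x. x \<in> S \<Longrightarrow> (g has_derivative g' x) (at x)"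
    and h: "\<And>y. y \<in> T \<Longrightarrow> (h has_derivative h' y) (at y)"
    and f: "\<And>y. y \<in> T \<Longrightarrow> 0 \<le> f y"
    and gS: "\<And>x. x \<in> S \<Longrightarrow> g x \<in> T \<and> h (g x) = x"
    and hT: "\<And>y. y \<in> T \<Longrightarrow> h y \<in> S \<and> g (h y) = y"
    and meas: "(\<lambda>y. indicator T y * f y) \<in> borel_measurable borel"
    and meas': "(\<lambda>x. indicator S x * (\<bar>det (matrix (g' x))\<bar> * f (g x))) \<in> borel_measurable borel"
    and id: "\<And>y. y \<in> T \<Longrightarrow> h' y \<circ> g' (h y) = id"
    and fin: "(\<integral>\<^sup>+y\<in>T. ennreal (f y) \<partial>lborel) < \<infinity>"
  shows "(\<integral>\<^sup>+y\<in>T. ennreal (f y) \<partial>lborel)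
    = (\<integral>\<^sup>+x\<in>S. ennreal (\<bar>det (matrix (g' x))\<bar> * f (g x)) \<partial>lborel)"
proof -
  have transfer: "(\<integral>\<^sup>+y\<in>T. ennreal (F y) \<partial>lborel) = (\<integral>\<^sup>+y\<in>of_wo -` T. ennreal (F (of_wo y)) \<partial>lborel)"
    if "(\<lambda>y. indicator T y * F y) \<in> borel_measurable borel" for F :: "real ^ 'n \<Rightarrow> real" and T
  proof -
    have eq: "(\<integral>\<^sup>+y\<in>T. ennreal (F y) \<partial>M) = (\<integral>\<^sup>+y. ennreal (indicator T y * F y) \<partial>M)" for M
      by (intro nn_integral_cong) (auto simp: indicator_def)
    have "(\<integral>\<^sup>+y\<in>T. ennreal (F y) \<partial>lborel) = (\<integral>\<^sup>+y. ennreal (indicator T (of_wo y) * F (of_wo y)) \<partial>lborel)"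
      using that by (subst lborel_distr_of_wo, subst eq, subst nn_integral_distr) auto
    also have "\<dots> = (\<integral>\<^sup>+y\<in>of_wo -` T. ennreal (F (of_wo y)) \<partial>lborel)"
      by (intro nn_integral_cong) (auto simp: indicator_def)
    finally show ?thesis .
  qed
  have lift: "((\<lambda>x. to_wo (k (of_wo x))) has_derivative to_wo \<circ> k' \<circ> of_wo) (at x within U)"
    if "(k has_derivative k') (at (of_wo x))" for k k' :: "real ^ 'n \<Rightarrow> real ^ 'n" and x U
  proof -
    have "((\<lambda>x. k (of_wo x)) has_derivative (\<lambda>v. k' (of_wo v))) (at x within U)"
      by (rule has_derivative_compose[where f=of_wo and f'=of_wo, OF _ that])
        (rule bounded_linear_imp_has_derivative[OF bounded_linear_of_wo])
    from bounded_linear.has_derivative[OF bounded_linear_to_wo this] show ?thesis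
      by (simp add: o_def)
  qed
  have "(\<integral>\<^sup>+y\<in>of_wo -` T. ennreal (f (of_wo y)) \<partial>lborel) =
     (\<integral>\<^sup>+x\<in>of_wo -` S. ennreal (\<bar>det (matrix (to_wo \<circ> g' (of_wo x) \<circ> of_wo))\<bar> *
        f (of_wo (to_wo (g (of_wo x))))) \<partial>lborel)"
  proof (rule nn_integral_change_of_variables_wellorder)
    show "((\<lambda>x. to_wo (g (of_wo x))) has_derivative to_wo \<circ> g' (of_wo x) \<circ> of_wo) (at x within of_wo -` S)"
      if "x \<in> of_wo -` S" for x using that by (intro lift g) auto
    show "((\<lambda>x. to_wo (h (of_wo x))) has_derivative to_wo \<circ> h' (of_wo x) \<circ> of_wo) (at x within of_wo -` T)"
      if "x \<in> of_wo -` T" for x using that by (intro lift h) auto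
    show "(to_wo \<circ> h' (of_wo y) \<circ> of_wo) \<circ> (to_wo \<circ> g' (of_wo (to_wo (h (of_wo y)))) \<circ> of_wo) = id"
      if "y \<in> of_wo -` T" for y
      using id[of "of_wo y"] that by (auto simp: fun_eq_iff)
    show "(\<lambda>y. indicator (of_wo -` T) y * f (of_wo y)) \<in> borel_measurable borel"
      using measurable_compose[OF borel_measurable_of_wo meas] by (simp add: indicator_def)
    show "(\<integral>\<^sup>+y\<in>of_wo -` T. ennreal (f (of_wo y)) \<partial>lborel) < \<infinity>"
      using fin transfer[OF meas] by simp
  qed (use f gS hT in auto)
  also have "\<dots> = (\<integral>\<^sup>+x\<in>S. ennreal (\<bar>det (matrix (g' x))\<bar> * f (g x)) \<partial>lborel)"
    by (simp add: det_matrix_wo transfer[OF meas'])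
  finally show ?thesis
    by (simp add: transfer[OF meas])
qed

section \<open>Charts, tangent maps and the diffeomorphism group\<close>

locale oriented_manifold =
  fixes A :: "('m::t2_space, 'n::finite) chart set"
  assumes atlas: "oriented_atlas A"
begin

section \<open>Charts and their images\<close>

lemma chart_covering: "\<exists>\<kappa>\<in>A. p \<in> chart_dom \<kappa>"
  using atlas unfolding oriented_atlas_def by blast

lemma chart_at: "chart_at A p \<in> A" "p \<in> chart_dom (chart_at A p)"
  using someI_ex[of "\<lambda>\<kappa>. \<kappa> \<in> A \<and> p \<in> chart_dom \<kappa>"] chart_covering[of p]
  unfolding chart_at_def by blast+

lemma open_chart_dom: "\<kappa> \<in> A \<Longrightarrow> open (chart_dom \<kappa>)"
  and open_chart_img: "\<kappa> \<in> A \<Longrightarrow> open (chart_img \<kappa>)"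
  and chart_homeomorphism:
    "\<kappa> \<in> A \<Longrightarrow> homeomorphism (chart_dom \<kappa>) (chart_img \<kappa>) (chart_fun \<kappa>) (chart_inv \<kappa>)"
  using atlas unfolding oriented_atlas_def by blast+

lemma chart_inv_chart_fun [simp]: "\<kappa> \<in> A \<Longrightarrow> p \<in> chart_dom \<kappa> \<Longrightarrow> chart_inv \<kappa> (chart_fun \<kappa> p) = p"
  using chart_homeomorphism by (meson homeomorphism_apply1)

lemma chart_fun_chart_inv [simp]: "\<kappa> \<in> A \<Longrightarrow> y \<in> chart_img \<kappa> \<Longrightarrow> chart_fun \<kappa> (chart_inv \<kappa> y) = y"
  using chart_homeomorphism by (meson homeomorphism_apply2)

lemma chart_fun_in_img [simp]: "p \<in> chart_dom \<kappa> \<Longrightarrow> chart_fun \<kappa> p \<in> chart_img \<kappa>"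
  by (simp add: chart_img_def)

lemma chart_inv_in_dom [simp]: "\<kappa> \<in> A \<Longrightarrow> y \<in> chart_img \<kappa> \<Longrightarrow> chart_inv \<kappa> y \<in> chart_dom \<kappa>"
  by (auto simp: chart_img_def)

lemma continuous_on_chart_fun: "\<kappa> \<in> A \<Longrightarrow> continuous_on (chart_dom \<kappa>) (chart_fun \<kappa>)"
  using chart_homeomorphism homeomorphism_cont1 by blast

lemma continuous_on_chart_inv: "\<kappa> \<in> A \<Longrightarrow> continuous_on (chart_img \<kappa>) (chart_inv \<kappa>)"
  using chart_homeomorphism homeomorphism_cont2 by blast

lemma chart_fun_image:
  assumes "\<kappa> \<in> A" "U \<subseteq> chart_dom \<kappa>"
  shows "chart_fun \<kappa> ` U = chart_img \<kappa> \<inter> chart_inv \<kappa> -` U"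
  using assms by (force simp: chart_img_def)

lemma open_chart_fun_image:
  assumes "\<kappa> \<in> A" "U \<subseteq> chart_dom \<kappa>" "open U"
  shows "open (chart_fun \<kappa> ` U)"
  unfolding chart_fun_image[OF assms(1,2)]
  using continuous_on_open_vimage[OF open_chart_img[OF assms(1)]] continuous_on_chart_inv assms
  by (metis Int_commute)

lemma open_local_dom:
  assumes "\<kappa> \<in> A" "\<theta> \<in> A" "continuous_on UNIV f"
  shows "open (chart_fun \<kappa> ` (chart_dom \<kappa> \<inter> f -` chart_dom \<theta>))"
  using assms open_chart_dom
  by (intro open_chart_fun_image open_Int open_vimage) auto

section \<open>Local representatives and the chain rule\<close>

lemma local_rep_smooth:
  assumes "smooth_map A f" "\<kappa> \<in> A" "\<theta> \<in> A"
  shows "smooth_on (chart_fun \<kappa> ` (chart_dom \<kappa> \<inter> f -` chart_dom \<theta>)) (local_rep \<kappa> \<theta> f)"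
  using assms unfolding smooth_map_def by blast

lemma smooth_map_continuous: "smooth_map A f \<Longrightarrow> continuous_on UNIV f"
  unfolding smooth_map_def by blast

lemma local_rep_has_derivative:
  assumes "smooth_map A f" "\<kappa> \<in> A" "\<theta> \<in> A" "p \<in> chart_dom \<kappa>" "f p \<in> chart_dom \<theta>"
  shows "(local_rep \<kappa> \<theta> f has_derivative local_deriv \<kappa> \<theta> f p) (at (chart_fun \<kappa> p))"
  unfolding local_deriv_def
  using assms by (intro smooth_on_has_derivative[OF local_rep_smooth]) auto

lemma linear_local_deriv:
  assumes "smooth_map A f" "\<kappa> \<in> A" "\<theta> \<in> A" "p \<in> chart_dom \<kappa>" "f p \<in> chart_dom \<theta>"
  shows "linear (local_deriv \<kappa> \<theta> f p)"
  using local_rep_has_derivative[OF assms] by (rule has_derivative_linear)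

text \<open>With \<open>f\<close> or \<open>g\<close> the identity this becomes the rule for
  changing the chart in the target or in the source, which governs coordinate vectors and tangent
  maps.\<close>

lemma local_deriv_compose:
  assumes f: "smooth_map A f" and g: "smooth_map A g" and "\<kappa> \<in> A" "\<mu> \<in> A" "\<theta> \<in> A"
    and p: "p \<in> chart_dom \<kappa>" "g p \<in> chart_dom \<mu>" "f (g p) \<in> chart_dom \<theta>"
  shows "local_deriv \<kappa> \<theta> (f \<circ> g) p = local_deriv \<mu> \<theta> f (g p) \<circ> local_deriv \<kappa> \<mu> g p"
proof -
  let ?U = "chart_fun \<kappa> ` (chart_dom \<kappa> \<inter> g -` chart_dom \<mu>)"
  have eq: "local_rep \<kappa> \<mu> g (chart_fun \<kappa> p) = chart_fun \<mu> (g p)"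
    using assms by (simp add: local_rep_def)
  have "(local_rep \<mu> \<theta> f \<circ> local_rep \<kappa> \<mu> g has_derivative
      local_deriv \<mu> \<theta> f (g p) \<circ> local_deriv \<kappa> \<mu> g p) (at (chart_fun \<kappa> p))"
    using assms by (intro diff_chain_at local_rep_has_derivative) (simp_all add: eq local_rep_has_derivative)
  then have "(local_rep \<kappa> \<theta> (f \<circ> g) has_derivative
      local_deriv \<mu> \<theta> f (g p) \<circ> local_deriv \<kappa> \<mu> g p) (at (chart_fun \<kappa> p))"
  proof (rule has_derivative_transform_within_open)
    show "open ?U"
      using open_local_dom smooth_map_continuous[OF g] assms by blast
    show "chart_fun \<kappa> p \<in> ?U" using p by auto
    show "(local_rep \<mu> \<theta> f \<circ> local_rep \<kappa> \<mu> g) y = local_rep \<kappa> \<theta> (f \<circ> g) y" if "y \<in> ?U" for y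
      using that assms by (auto simp: local_rep_def)
  qed
  then show ?thesis
    unfolding local_deriv_def[of \<kappa> \<theta> "f \<circ> g"] by (metis frechet_derivative_at)
qed

lemma smooth_map_id: "smooth_map A id"
  using atlas unfolding smooth_map_def oriented_atlas_def by (auto simp: continuous_on_id)

lemma smooth_map_compose:
  assumes f: "smooth_map A f" and g: "smooth_map A g"
  shows "smooth_map A (f \<circ> g)"
  unfolding smooth_map_def
proof (intro conjI ballI)
  have cont: "continuous_on UNIV f" "continuous_on UNIV g"
    using f g smooth_map_continuous by auto
  show "continuous_on UNIV (f \<circ> g)"
    using cont by (intro continuous_on_compose) (auto intro: continuous_on_subset)
  fix \<kappa> \<theta> assume "\<kappa> \<in> A" "\<theta> \<in> A"
  show "smooth_on (chart_fun \<kappa> ` (chart_dom \<kappa> \<inter> (f \<circ> g) -` chart_dom \<theta>)) (local_rep \<kappa> \<theta> (f \<circ> g))"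
  proof (rule smooth_on_local)
    fix y assume "y \<in> chart_fun \<kappa> ` (chart_dom \<kappa> \<inter> (f \<circ> g) -` chart_dom \<theta>)"
    then obtain p where p: "p \<in> chart_dom \<kappa>" "f (g p) \<in> chart_dom \<theta>" "y = chart_fun \<kappa> p"
      by auto
    obtain \<mu> where \<mu>: "\<mu> \<in> A" "g p \<in> chart_dom \<mu>"
      using chart_covering by blast
    \<comment> \<open>On this smaller set the intermediate point stays in the single chart
      \<open>\<mu>\<close>, so the local representative factors.\<close>
    let ?U = "chart_fun \<kappa> ` (chart_dom \<kappa> \<inter> g -` (chart_dom \<mu> \<inter> f -` chart_dom \<theta>))"
    have "open ?U"
      using \<open>\<kappa> \<in> A\<close> \<open>\<theta> \<in> A\<close> \<mu>(1) cont
      by (intro open_chart_fun_image open_Int open_vimage open_chart_dom) auto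
    moreover have "y \<in> ?U"
      using p \<mu> by auto
    moreover have "smooth_on ?U (local_rep \<kappa> \<theta> (f \<circ> g))"
    proof (rule smooth_on_cong[OF \<open>open ?U\<close>])
      show "smooth_on ?U (\<lambda>y. local_rep \<mu> \<theta> f (local_rep \<kappa> \<mu> g y))"
      proof (rule smooth_on_compose[OF \<open>open ?U\<close> local_rep_smooth[OF f \<mu>(1) \<open>\<theta> \<in> A\<close>]])
        show "smooth_on ?U (local_rep \<kappa> \<mu> g)"
          by (rule smooth_on_subset[OF local_rep_smooth[OF g \<open>\<kappa> \<in> A\<close> \<mu>(1)]]) auto
      qed (use \<open>\<kappa> \<in> A\<close> in \<open>auto simp: local_rep_def\<close>)
    qed (use \<open>\<kappa> \<in> A\<close> \<mu>(1) in \<open>auto simp: local_rep_def\<close>)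
    ultimately show "\<exists>U. open U \<and> y \<in> U \<and> smooth_on
        (chart_fun \<kappa> ` (chart_dom \<kappa> \<inter> (f \<circ> g) -` chart_dom \<theta>) \<inter> U) (local_rep \<kappa> \<theta> (f \<circ> g))"
      by (meson inf_le2 smooth_on_subset)
  qed
qed

section \<open>Tangent spaces, coordinate frames and tangent maps\<close>

lemma local_deriv_id:
  assumes "\<kappa> \<in> A" "p \<in> chart_dom \<kappa>"
  shows "local_deriv \<kappa> \<kappa> id p = id"
proof -
  have "(local_rep \<kappa> \<kappa> id has_derivative id) (at (chart_fun \<kappa> p))"
    by (rule has_derivative_transform_within_open[of id _ _ _ "chart_img \<kappa>"])
      (use assms open_chart_img in \<open>auto simp: local_rep_def id_def\<close>)
  then show ?thesis
    unfolding local_deriv_def by (metis frechet_derivative_at)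
qed

lemma tangent_spaceD:
  assumes "X \<in> tangent_space A p" "\<kappa> \<in> A" "\<theta> \<in> A" "p \<in> chart_dom \<kappa>" "p \<in> chart_dom \<theta>"
  shows "local_deriv \<kappa> \<theta> id p (X \<kappa>) = X \<theta>"
proof -
  have "X \<theta> = local_deriv \<kappa> \<theta> id p (X \<kappa>)"
    using assms unfolding tangent_space_def by blast
  then show ?thesis by (rule sym)
qed

lemma tangent_space_outside:
  "X \<in> tangent_space A p \<Longrightarrow> \<kappa> \<notin> A \<or> p \<notin> chart_dom \<kappa> \<Longrightarrow> X \<kappa> = 0"
  unfolding tangent_space_def by blast

lemma tangent_space_lincomb:
  assumes "X \<in> tangent_space A p" "Y \<in> tangent_space A p"
  shows "(\<lambda>\<kappa>. a *\<^sub>R X \<kappa> + b *\<^sub>R Y \<kappa>) \<in> tangent_space A p"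
  unfolding tangent_space_def
proof (intro CollectI conjI ballI impI allI)
  fix \<kappa> \<theta> assume \<kappa>\<theta>: "\<kappa> \<in> A" "\<theta> \<in> A" "p \<in> chart_dom \<kappa> \<inter> chart_dom \<theta>"
  then have "linear (local_deriv \<kappa> \<theta> id p)"
    by (intro linear_local_deriv smooth_map_id) auto
  then show "a *\<^sub>R X \<theta> + b *\<^sub>R Y \<theta> = local_deriv \<kappa> \<theta> id p (a *\<^sub>R X \<kappa> + b *\<^sub>R Y \<kappa>)"
    using \<kappa>\<theta> assms tangent_spaceD[of _ p \<kappa> \<theta>] by (simp add: linear_add linear_scale)
qed (simp add: tangent_space_outside[OF assms(1)] tangent_space_outside[OF assms(2)])

lemma zero_in_tangent_space: "(\<lambda>\<kappa>. 0) \<in> tangent_space A p"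
proof -
  have "linear (local_deriv \<kappa> \<theta> id p)" if "\<kappa> \<in> A" "\<theta> \<in> A" "p \<in> chart_dom \<kappa> \<inter> chart_dom \<theta>" for \<kappa> \<theta>
    using that by (intro linear_local_deriv smooth_map_id) auto
  then show ?thesis by (simp add: tangent_space_def linear_0)
qed

lemma tangent_space_sum:
  assumes "finite I" "\<And>i. i \<in> I \<Longrightarrow> X i \<in> tangent_space A p"
  shows "(\<lambda>\<kappa>. \<Sum>i\<in>I. c i *\<^sub>R X i \<kappa>) \<in> tangent_space A p"
  using assms
proof (induction I rule: finite_induct)
  case empty
  show ?case by (simp add: zero_in_tangent_space)
next
  case (insert i I)
  then show ?case
    using tangent_space_lincomb[of "X i" p "\<lambda>\<kappa>. \<Sum>i\<in>I. c i *\<^sub>R X i \<kappa>" "c i" 1] by simp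
qed

lemma coord_vec_tangent:
  assumes "\<kappa> \<in> A" "p \<in> chart_dom \<kappa>"
  shows "coord_vec A \<kappa> p i \<in> tangent_space A p"
  unfolding tangent_space_def
proof (intro CollectI conjI ballI impI allI)
  fix \<theta> \<theta>' assume "\<theta> \<in> A" "\<theta>' \<in> A" "p \<in> chart_dom \<theta> \<inter> chart_dom \<theta>'"
  then show "coord_vec A \<kappa> p i \<theta>' = local_deriv \<theta> \<theta>' id p (coord_vec A \<kappa> p i \<theta>)"
    using local_deriv_compose[OF smooth_map_id smooth_map_id, of \<kappa> \<theta> \<theta>' p] assms
    by (simp add: coord_vec_def)
qed (auto simp: coord_vec_def)

text \<open>One component fixes all others: the transitions give those in charts around
  \<open>p\<close>, and the rest are 0 by convention.\<close>

lemma tangent_vector_eqI: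
  assumes "X \<in> tangent_space A p" "Y \<in> tangent_space A p" "\<kappa> \<in> A" "p \<in> chart_dom \<kappa>" "X \<kappa> = Y \<kappa>"
  shows "X = Y"
proof
  fix \<theta>
  show "X \<theta> = Y \<theta>"
  proof (cases "\<theta> \<in> A \<and> p \<in> chart_dom \<theta>")
    case True
    then show ?thesis
      using tangent_spaceD[OF assms(1), of \<kappa> \<theta>] tangent_spaceD[OF assms(2), of \<kappa> \<theta>] assms by simp
  qed (use assms tangent_space_outside in metis)
qed

lemma coord_vec_self:
  "\<kappa> \<in> A \<Longrightarrow> p \<in> chart_dom \<kappa> \<Longrightarrow> coord_vec A \<kappa> p i \<kappa> = axis i 1"
  by (simp add: coord_vec_def local_deriv_id)

lemma tangent_vector_expansion:
  assumes "X \<in> tangent_space A p" "\<kappa> \<in> A" "p \<in> chart_dom \<kappa>"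
  shows "X = (\<lambda>\<theta>. \<Sum>i\<in>UNIV. X \<kappa> $ i *\<^sub>R coord_vec A \<kappa> p i \<theta>)"
proof (rule tangent_vector_eqI[OF assms(1) _ assms(2,3)])
  show "(\<lambda>\<theta>. \<Sum>i\<in>UNIV. X \<kappa> $ i *\<^sub>R coord_vec A \<kappa> p i \<theta>) \<in> tangent_space A p"
    using assms by (intro tangent_space_sum coord_vec_tangent) auto
  show "X \<kappa> = (\<Sum>i\<in>UNIV. X \<kappa> $ i *\<^sub>R coord_vec A \<kappa> p i \<kappa>)"
    using basis_expansion[of "X \<kappa>"] by (simp add: coord_vec_self[OF assms(2,3)] scalar_mult_eq_scaleR)
qed

text \<open>\<open>tangent_map\<close> reads \<open>X\<close> in the chosen chart at
  \<open>p\<close>; the chain rule with the identity frees the formula from that choice.\<close>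

lemma tangent_map_eq:
  assumes f: "smooth_map A f" and X: "X \<in> tangent_space A p"
    and "\<kappa> \<in> A" "\<theta> \<in> A" "p \<in> chart_dom \<kappa>" "f p \<in> chart_dom \<theta>"
  shows "tangent_map A f p X \<theta> = local_deriv \<kappa> \<theta> f p (X \<kappa>)"
proof -
  let ?\<kappa> = "chart_at A p"
  have "local_deriv \<kappa> \<theta> f p = local_deriv ?\<kappa> \<theta> f p \<circ> local_deriv \<kappa> ?\<kappa> id p"
    using local_deriv_compose[OF f smooth_map_id, of \<kappa> ?\<kappa> \<theta> p] assms chart_at[of p] by simp
  then show ?thesis
    using tangent_spaceD[OF X \<open>\<kappa> \<in> A\<close> chart_at(1)[of p]] assms chart_at[of p]
    by (simp add: tangent_map_def)
qed

lemma tangent_map_tangent: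
  assumes f: "smooth_map A f" and X: "X \<in> tangent_space A p"
  shows "tangent_map A f p X \<in> tangent_space A (f p)"
  unfolding tangent_space_def
proof (intro CollectI conjI ballI impI allI)
  fix \<theta> \<theta>' assume \<theta>: "\<theta> \<in> A" "\<theta>' \<in> A" "f p \<in> chart_dom \<theta> \<inter> chart_dom \<theta>'"
  note ch = chart_at[of p]
  have "local_deriv (chart_at A p) \<theta>' f p = local_deriv \<theta> \<theta>' id (f p) \<circ> local_deriv (chart_at A p) \<theta> f p"
    using local_deriv_compose[OF smooth_map_id f, of "chart_at A p" \<theta> \<theta>' p] \<theta> ch by simp
  then show "tangent_map A f p X \<theta>' = local_deriv \<theta> \<theta>' id (f p) (tangent_map A f p X \<theta>)"
    using \<theta> by (simp add: tangent_map_def)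
qed (auto simp: tangent_map_def)

lemma tangent_map_compose:
  assumes f: "smooth_map A f" and g: "smooth_map A g" and X: "X \<in> tangent_space A p"
  shows "tangent_map A (f \<circ> g) p X = tangent_map A f (g p) (tangent_map A g p X)"
proof -
  note ch = chart_at[of p] chart_at[of "g p"] chart_at[of "f (g p)"]
  show ?thesis
  proof (rule tangent_vector_eqI)
    show "tangent_map A (f \<circ> g) p X \<in> tangent_space A (f (g p))"
      using tangent_map_tangent[OF smooth_map_compose[OF f g] X] by simp
    show "tangent_map A f (g p) (tangent_map A g p X) \<in> tangent_space A (f (g p))"
      by (intro tangent_map_tangent f g X)
    show "tangent_map A (f \<circ> g) p X (chart_at A (f (g p))) =
        tangent_map A f (g p) (tangent_map A g p X) (chart_at A (f (g p)))"
      using tangent_map_eq[OF smooth_map_compose[OF f g] X, of "chart_at A p" "chart_at A (f (g p))"]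
        tangent_map_eq[OF f tangent_map_tangent[OF g X], of "chart_at A (g p)" "chart_at A (f (g p))"]
        tangent_map_eq[OF g X, of "chart_at A p" "chart_at A (g p)"]
        local_deriv_compose[OF f g, of "chart_at A p" "chart_at A (g p)" "chart_at A (f (g p))" p] ch
      by simp
  qed (use ch in auto)
qed

lemma pullback_compose:
  assumes "smooth_map A f" "smooth_map A g" "\<And>i. X i \<in> tangent_space A p"
  shows "pullback A (f \<circ> g) \<omega> p X = pullback A f \<omega> (g p) (\<lambda>i. tangent_map A g p (X i))"
  using assms by (simp add: pullback_def tangent_map_compose)

lemma tangent_map_id:
  assumes "X \<in> tangent_space A p"
  shows "tangent_map A id p X = X"
  using tangent_map_tangent[OF smooth_map_id assms] tangent_map_eq[OF smooth_map_id assms]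
    chart_at[of p] assms
  by (intro tangent_vector_eqI[of _ p _ "chart_at A p"]) (simp_all add: local_deriv_id)

section \<open>The diffeomorphism group and its volume-preserving subgroup\<close>

lemma DiffD:
  assumes "\<xi> \<in> Diff A"
  shows "bij \<xi>" "smooth_map A \<xi>" "smooth_map A (inv \<xi>)"
  using assms by (auto simp: Diff_def)

lemma Diff_det_pos:
  assumes "\<xi> \<in> Diff A" "\<kappa> \<in> A" "\<theta> \<in> A" "p \<in> chart_dom \<kappa>" "\<xi> p \<in> chart_dom \<theta>"
  shows "det (matrix (local_deriv \<kappa> \<theta> \<xi> p)) > 0"
  using assms by (auto simp: Diff_def)

lemma id_in_Diff: "id \<in> Diff A"
  using atlas smooth_map_id by (auto simp: Diff_def oriented_atlas_def)

lemma det_local_deriv_compose: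
  assumes "smooth_map A f" "smooth_map A g" "\<kappa> \<in> A" "\<mu> \<in> A" "\<theta> \<in> A"
    "p \<in> chart_dom \<kappa>" "g p \<in> chart_dom \<mu>" "f (g p) \<in> chart_dom \<theta>"
  shows "det (matrix (local_deriv \<kappa> \<theta> (f \<circ> g) p)) =
    det (matrix (local_deriv \<mu> \<theta> f (g p))) * det (matrix (local_deriv \<kappa> \<mu> g p))"
  using assms
  by (simp add: local_deriv_compose matrix_compose linear_local_deriv det_mul)

lemma compose_in_Diff:
  assumes \<xi>: "\<xi> \<in> Diff A" and \<eta>: "\<eta> \<in> Diff A"
  shows "\<xi> \<circ> \<eta> \<in> Diff A"
proof -
  have "inv (\<xi> \<circ> \<eta>) = inv \<eta> \<circ> inv \<xi>"
    using o_inv_distrib DiffD assms by blast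
  moreover have "det (matrix (local_deriv \<kappa> \<theta> (\<xi> \<circ> \<eta>) p)) > 0"
    if "\<kappa> \<in> A" "\<theta> \<in> A" "p \<in> chart_dom \<kappa>" "\<xi> (\<eta> p) \<in> chart_dom \<theta>" for \<kappa> \<theta> p
    using det_local_deriv_compose[OF DiffD(2)[OF \<xi>] DiffD(2)[OF \<eta>], of \<kappa> "chart_at A (\<eta> p)" \<theta> p]
      that chart_at[of "\<eta> p"] Diff_det_pos[OF \<xi>] Diff_det_pos[OF \<eta>]
    by simp
  ultimately show ?thesis
    using DiffD[OF \<xi>] DiffD[OF \<eta>] by (auto simp: Diff_def intro: smooth_map_compose bij_comp)
qed

text \<open>The chain rule for \<open>\<xi> \<circ> inv \<xi>\<close> makes the two determinants
  reciprocal, so they have the same sign.\<close>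

lemma inv_in_Diff:
  assumes \<xi>: "\<xi> \<in> Diff A"
  shows "inv \<xi> \<in> Diff A"
proof -
  note D = DiffD[OF \<xi>]
  have "det (matrix (local_deriv \<kappa> \<theta> (inv \<xi>) p)) > 0"
    if "\<kappa> \<in> A" "\<theta> \<in> A" "p \<in> chart_dom \<kappa>" "inv \<xi> p \<in> chart_dom \<theta>" for \<kappa> \<theta> p
  proof -
    have "\<xi> (inv \<xi> p) = p"
      using D(1) by (simp add: bij_is_surj surj_f_inv_f)
    moreover have "\<xi> \<circ> inv \<xi> = id"
      using D(1) by (simp add: bij_is_surj surj_iff[symmetric])
    ultimately have "det (matrix (local_deriv \<theta> \<kappa> \<xi> (inv \<xi> p))) * det (matrix (local_deriv \<kappa> \<theta> (inv \<xi>) p)) = 1"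
      using det_local_deriv_compose[OF D(2,3), of \<kappa> \<theta> \<kappa> p] that by (simp add: local_deriv_id matrix_id)
    moreover have "det (matrix (local_deriv \<theta> \<kappa> \<xi> (inv \<xi> p))) > 0"
      using Diff_det_pos[OF \<xi>] that \<open>\<xi> (inv \<xi> p) = p\<close> by simp
    ultimately show ?thesis
      by (metis zero_less_mult_pos zero_less_one)
  qed
  then show ?thesis
    using D by (simp add: Diff_def bij_imp_bij_inv inv_inv_eq)
qed

lemma id_in_Diff_vol: "id \<in> Diff_vol A \<omega>"
  by (auto simp: Diff_vol_def id_in_Diff pullback_def tangent_map_id)

lemma compose_in_Diff_vol:
  assumes "\<xi> \<in> Diff_vol A \<omega>" "\<eta> \<in> Diff_vol A \<omega>"
  shows "\<xi> \<circ> \<eta> \<in> Diff_vol A \<omega>"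
proof -
  have \<xi>: "\<xi> \<in> Diff A" and \<eta>: "\<eta> \<in> Diff A"
    using assms by (auto simp: Diff_vol_def)
  have "pullback A (\<xi> \<circ> \<eta>) \<omega> p X = \<omega> p X" if X: "\<And>i. X i \<in> tangent_space A p" for p X
  proof -
    have "pullback A (\<xi> \<circ> \<eta>) \<omega> p X = pullback A \<xi> \<omega> (\<eta> p) (\<lambda>i. tangent_map A \<eta> p (X i))"
      by (intro pullback_compose X DiffD \<xi> \<eta>)
    also have "\<dots> = \<omega> (\<eta> p) (\<lambda>i. tangent_map A \<eta> p (X i))"
      using assms(1) tangent_map_tangent[OF DiffD(2)[OF \<eta>] X] by (auto simp: Diff_vol_def)
    also have "\<dots> = \<omega> p X"
      using assms(2) X by (auto simp: Diff_vol_def pullback_def)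
    finally show ?thesis .
  qed
  then show ?thesis
    using compose_in_Diff[OF \<xi> \<eta>] by (auto simp: Diff_vol_def)
qed

end

text \<open>Every matrix on the segment from the identity to \<open>G\<close> has a positive
  quadratic form and is therefore invertible, so the determinant cannot change sign along the
  segment.\<close>

lemma det_positive_definite:
  fixes G :: "real ^ 'n::finite ^ 'n"
  assumes "\<And>v. v \<noteq> 0 \<Longrightarrow> v \<bullet> (G *v v) > 0"
  shows "det G > 0"
proof (rule ccontr)
  assume neg: "\<not> det G > 0"
  \<comment> \<open>Given by its entries, so that the continuity of the determinant is read off from
    the Leibniz formula.\<close>
  let ?M = "\<lambda>t. (\<chi> i j. (1 - t) * mat 1 $ i $ j + t * G $ i $ j) :: real ^ 'n ^ 'n"
  have M: "?M t = (1 - t) *\<^sub>R mat 1 + t *\<^sub>R G" for t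
    by (simp add: vec_eq_iff)
  have "\<exists>t\<ge>0. t \<le> 1 \<and> det (?M t) = 0"
  proof (rule IVT2')
    have "?M 0 = mat 1" "?M 1 = G" by (simp_all add: vec_eq_iff)
    then show "det (?M 1) \<le> 0" "0 \<le> det (?M 0)" using neg by simp_all
    show "continuous_on {0..1} (\<lambda>t. det (?M t))"
      unfolding det_def by (intro continuous_intros)
  qed simp
  then obtain t where t: "0 \<le> t" "t \<le> 1" "det (?M t) = 0" by blast
  then have "\<not> invertible (?M t)" by (simp add: invertible_det_nz)
  then obtain v where v: "v \<noteq> 0" "?M t *v v = 0"
    by (meson invertible_left_inverse matrix_left_invertible_ker)
  have "0 = v \<bullet> (?M t *v v)" using v by simp
  also have "\<dots> = (1 - t) * (v \<bullet> v) + t * (v \<bullet> (G *v v))"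
    unfolding M by (simp add: matrix_vector_mult_add_rdistrib scaleR_matrix_vector_assoc[symmetric] inner_add_right)
  also have "\<dots> > 0"
  proof (cases "t = 0")
    case False
    then show ?thesis
      using t assms[OF v(1)] by (intro add_nonneg_pos mult_nonneg_nonneg mult_pos_pos) auto
  qed (use v in simp)
  finally show False by simp
qed

section \<open>Volume form, Jacobian and divergence\<close>

locale riemannian_manifold = oriented_manifold A
  for A :: "('m::t2_space, 'n::finite) chart set" +
  fixes g :: "'m \<Rightarrow> ('m, 'n) tvec \<Rightarrow> ('m, 'n) tvec \<Rightarrow> real"
  assumes metric: "riemannian_metric A g"
begin

abbreviation vol :: "('m, 'n) nform" where
  "vol \<equiv> volume_form A g"

abbreviation coeff :: "('m, 'n) chart \<Rightarrow> real ^ 'n \<Rightarrow> real" where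
  "coeff \<equiv> form_coeff A vol"

definition gram :: "('m, 'n) chart \<Rightarrow> 'm \<Rightarrow> real ^ 'n ^ 'n" where
  "gram \<kappa> p = (\<chi> i j. g p (coord_vec A \<kappa> p i) (coord_vec A \<kappa> p j))"

section \<open>The metric and its Gram matrices\<close>

lemma metric_sym:
  "X \<in> tangent_space A p \<Longrightarrow> Y \<in> tangent_space A p \<Longrightarrow> g p X Y = g p Y X"
  and metric_lincomb:
  "X \<in> tangent_space A p \<Longrightarrow> Y \<in> tangent_space A p \<Longrightarrow> Z \<in> tangent_space A p \<Longrightarrow>
    g p (\<lambda>\<kappa>. a *\<^sub>R X \<kappa> + b *\<^sub>R Y \<kappa>) Z = a * g p X Z + b * g p Y Z"
  and metric_pos: "X \<in> tangent_space A p \<Longrightarrow> X \<noteq> (\<lambda>\<kappa>. 0) \<Longrightarrow> g p X X > 0"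
  using metric unfolding riemannian_metric_def by blast+

lemma metric_sum:
  assumes "finite I" "\<And>i. i \<in> I \<Longrightarrow> X i \<in> tangent_space A p" and Z: "Z \<in> tangent_space A p"
  shows "g p (\<lambda>\<kappa>. \<Sum>i\<in>I. c i *\<^sub>R X i \<kappa>) Z = (\<Sum>i\<in>I. c i * g p (X i) Z)"
  using assms(1,2)
proof (induction I rule: finite_induct)
  case empty
  show ?case
    using metric_lincomb[OF zero_in_tangent_space zero_in_tangent_space Z, of 0 0] by simp
next
  case (insert i I)
  have "g p (\<lambda>\<kappa>. c i *\<^sub>R X i \<kappa> + 1 *\<^sub>R (\<Sum>i\<in>I. c i *\<^sub>R X i \<kappa>)) Z =
      c i * g p (X i) Z + 1 * g p (\<lambda>\<kappa>. \<Sum>i\<in>I. c i *\<^sub>R X i \<kappa>) Z"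
    using insert by (intro metric_lincomb tangent_space_sum Z) auto
  then show ?case using insert by simp
qed

lemma metric_expansion:
  assumes X: "X \<in> tangent_space A p" and Y: "Y \<in> tangent_space A p" and \<kappa>: "\<kappa> \<in> A" "p \<in> chart_dom \<kappa>"
  shows "g p X Y = (\<Sum>i\<in>UNIV. \<Sum>j\<in>UNIV. X \<kappa> $ i * (gram \<kappa> p $ i $ j * Y \<kappa> $ j))"
proof -
  note e = coord_vec_tangent[OF \<kappa>]
  have "g p Z W = (\<Sum>i\<in>UNIV. Z \<kappa> $ i * g p (coord_vec A \<kappa> p i) W)"
    if "Z \<in> tangent_space A p" "W \<in> tangent_space A p" for Z W
    by (subst tangent_vector_expansion[OF that(1) \<kappa>]) (simp add: metric_sum e that)
  note expand = this
  have "g p (coord_vec A \<kappa> p i) Y = (\<Sum>j\<in>UNIV. gram \<kappa> p $ i $ j * Y \<kappa> $ j)" for i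
    using expand[OF Y e, of i] metric_sym[OF e Y]
    by (simp add: gram_def metric_sym[OF e e] mult.commute)
  then show ?thesis
    using expand[OF X Y] by (simp add: sum_distrib_left)
qed

lemma gram_positive_definite:
  assumes \<kappa>: "\<kappa> \<in> A" "p \<in> chart_dom \<kappa>" and "v \<noteq> 0"
  shows "v \<bullet> (gram \<kappa> p *v v) > 0"
proof -
  define X where "X = (\<lambda>\<theta>. \<Sum>i\<in>UNIV. v $ i *\<^sub>R coord_vec A \<kappa> p i \<theta>)"
  have X: "X \<in> tangent_space A p"
    unfolding X_def by (intro tangent_space_sum coord_vec_tangent \<kappa>) auto
  have X\<kappa>: "X \<kappa> = v"
    using basis_expansion[of v] by (simp add: X_def coord_vec_self[OF \<kappa>] scalar_mult_eq_scaleR)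
  then have "g p X X > 0"
    using \<open>v \<noteq> 0\<close> by (intro metric_pos X) auto
  then show ?thesis
    by (simp add: metric_expansion[OF X X \<kappa>] X\<kappa> inner_vec_def matrix_vector_mult_def sum_distrib_left)
qed

lemma det_gram_pos: "\<kappa> \<in> A \<Longrightarrow> p \<in> chart_dom \<kappa> \<Longrightarrow> det (gram \<kappa> p) > 0"
  by (intro det_positive_definite gram_positive_definite)

text \<open>The transformation law of a bilinear form: the columns of the transition derivative are
  the components in \<open>\<theta>\<close> of the coordinate vectors of
  \<open>\<kappa>\<close>.\<close>

lemma gram_chart_change:
  assumes \<kappa>: "\<kappa> \<in> A" "p \<in> chart_dom \<kappa>" and \<theta>: "\<theta> \<in> A" "p \<in> chart_dom \<theta>"
  shows "gram \<kappa> p = transpose (matrix (local_deriv \<kappa> \<theta> id p)) ** gram \<theta> p ** matrix (local_deriv \<kappa> \<theta> id p)"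
proof -
  let ?J = "matrix (local_deriv \<kappa> \<theta> id p)"
  have J: "coord_vec A \<kappa> p i \<theta> $ k = ?J $ k $ i" for i k
    using \<theta> by (simp add: coord_vec_def matrix_def)
  have "gram \<kappa> p $ i $ j = (transpose ?J ** gram \<theta> p ** ?J) $ i $ j" for i j
  proof -
    have "gram \<kappa> p $ i $ j = (\<Sum>k\<in>UNIV. \<Sum>l\<in>UNIV. ?J $ k $ i * (gram \<theta> p $ k $ l * ?J $ l $ j))"
      using metric_expansion[OF coord_vec_tangent[OF \<kappa>] coord_vec_tangent[OF \<kappa>] \<theta>]
      by (simp add: gram_def[of \<kappa>] J)
    also have "\<dots> = (\<Sum>l\<in>UNIV. \<Sum>k\<in>UNIV. ?J $ k $ i * (gram \<theta> p $ k $ l * ?J $ l $ j))"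
      by (rule sum.swap)
    finally show ?thesis
      by (simp add: matrix_matrix_mult_def transpose_def sum_distrib_right mult.assoc)
  qed
  then show ?thesis by (simp add: vec_eq_iff)
qed

section \<open>The volume form, its pullbacks and the Jacobian\<close>

lemma det_matrix_tangent_change:
  assumes \<kappa>: "\<kappa> \<in> A" "p \<in> chart_dom \<kappa>" and \<theta>: "\<theta> \<in> A" "f p \<in> chart_dom \<theta>"
    and f: "smooth_map A f" and X: "\<And>i. X i \<in> tangent_space A p"
  shows "det (\<chi> i j. tangent_map A f p (X j) \<theta> $ i) =
    det (matrix (local_deriv \<kappa> \<theta> f p)) * det (\<chi> i j. X j \<kappa> $ i)"
proof -
  have "tangent_map A f p (X j) \<theta> = matrix (local_deriv \<kappa> \<theta> f p) *v X j \<kappa>" for j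
    using tangent_map_eq[OF f X \<kappa>(1) \<theta>(1) \<kappa>(2) \<theta>(2)] linear_local_deriv[OF f \<kappa>(1) \<theta>(1) \<kappa>(2) \<theta>(2)]
    by (simp add: matrix_works)
  then have "(\<chi> i j. tangent_map A f p (X j) \<theta> $ i) = matrix (local_deriv \<kappa> \<theta> f p) ** (\<chi> i j. X j \<kappa> $ i)"
    by (simp add: vec_eq_iff matrix_matrix_mult_def matrix_vector_mult_def)
  then show ?thesis by (simp add: det_mul)
qed

text \<open>Frees the volume form from the chosen chart. The Gram determinant changes by the square
  of the transition determinant, the determinant of the components by the transition determinant
  itself; as the atlas is oriented, the square root introduces no sign.\<close>

lemma volume_form_eq_gram:
  assumes \<kappa>: "\<kappa> \<in> A" "p \<in> chart_dom \<kappa>" and X: "\<And>i. X i \<in> tangent_space A p"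
  shows "vol p X = sqrt (det (gram \<kappa> p)) * det (\<chi> i j. X j \<kappa> $ i)"
proof -
  let ?\<theta> = "chart_at A p"
  note \<theta> = chart_at[of p]
  let ?J = "matrix (local_deriv ?\<theta> \<kappa> id p)"
  have "det ?J > 0"
    using Diff_det_pos[OF id_in_Diff] \<kappa> \<theta> by simp
  have "det (gram ?\<theta> p) = (det ?J)\<^sup>2 * det (gram \<kappa> p)"
    using gram_chart_change[OF \<theta> \<kappa>] by (simp add: det_mul power2_eq_square)
  then have "sqrt (det (gram ?\<theta> p)) = det ?J * sqrt (det (gram \<kappa> p))"
    using \<open>det ?J > 0\<close> by (simp add: real_sqrt_mult)
  moreover have "det (\<chi> i j. X j \<kappa> $ i) = det ?J * det (\<chi> i j. X j ?\<theta> $ i)"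
    using det_matrix_tangent_change[OF \<theta> \<kappa>(1), of id X] \<kappa>(2) X smooth_map_id
    by (simp add: tangent_map_id)
  ultimately show ?thesis
    by (simp add: volume_form_def Let_def gram_def)
qed

lemma coeff_eq_gram:
  assumes \<kappa>: "\<kappa> \<in> A" "y \<in> chart_img \<kappa>"
  shows "coeff \<kappa> y = sqrt (det (gram \<kappa> (chart_inv \<kappa> y)))"
proof -
  have p: "chart_inv \<kappa> y \<in> chart_dom \<kappa>" using \<kappa> by simp
  have "(\<chi> i j. coord_vec A \<kappa> (chart_inv \<kappa> y) j \<kappa> $ i) = mat 1"
    by (simp add: coord_vec_self[OF \<kappa>(1) p] vec_eq_iff mat_def axis_def)
  then show ?thesis
    unfolding form_coeff_def
    by (subst volume_form_eq_gram[OF \<kappa>(1) p coord_vec_tangent[OF \<kappa>(1) p]]) simp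
qed

lemma coeff_pos: "\<kappa> \<in> A \<Longrightarrow> y \<in> chart_img \<kappa> \<Longrightarrow> coeff \<kappa> y > 0"
  by (simp add: coeff_eq_gram det_gram_pos)

lemma coeff_smooth:
  assumes "\<kappa> \<in> A"
  shows "smooth_on (chart_img \<kappa>) (coeff \<kappa>)"
proof (rule smooth_on_cong[OF open_chart_img[OF assms]])
  show "smooth_on (chart_img \<kappa>) (\<lambda>y. sqrt (det (gram \<kappa> (chart_inv \<kappa> y))))"
    using metric assms
    by (intro smooth_on_sqrt smooth_on_det open_chart_img det_gram_pos)
      (simp_all add: riemannian_metric_def gram_def Let_def)
qed (simp add: coeff_eq_gram assms)

lemma volume_form_eq:
  assumes "\<kappa> \<in> A" "p \<in> chart_dom \<kappa>" "\<And>i. X i \<in> tangent_space A p"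
  shows "vol p X = coeff \<kappa> (chart_fun \<kappa> p) * det (\<chi> i j. X j \<kappa> $ i)"
  using assms volume_form_eq_gram[OF assms] by (simp add: coeff_eq_gram)

lemma pullback_volume_form:
  assumes f: "smooth_map A f" and \<kappa>: "\<kappa> \<in> A" "p \<in> chart_dom \<kappa>" and \<theta>: "\<theta> \<in> A" "f p \<in> chart_dom \<theta>"
    and X: "\<And>i. X i \<in> tangent_space A p"
  shows "pullback A f vol p X = coeff \<theta> (chart_fun \<theta> (f p)) * det (matrix (local_deriv \<kappa> \<theta> f p))
    / coeff \<kappa> (chart_fun \<kappa> p) * vol p X"
  unfolding pullback_def volume_form_eq[OF \<kappa> X]
    volume_form_eq[OF \<theta> tangent_map_tangent[OF f X]] det_matrix_tangent_change[OF \<kappa> \<theta> f X]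
  using coeff_pos[OF \<kappa>(1) chart_fun_in_img[OF \<kappa>(2)]] by simp

text \<open>The factor is unique because \<open>vol\<close> does not vanish on the coordinate frame
  of \<open>\<kappa>\<close>. Any charts around \<open>p\<close> and \<open>f p\<close> may be used,
  which makes all later local computations possible.\<close>

lemma Jac_eq:
  assumes f: "smooth_map A f" and \<kappa>: "\<kappa> \<in> A" "p \<in> chart_dom \<kappa>" and \<theta>: "\<theta> \<in> A" "f p \<in> chart_dom \<theta>"
  shows "Jac A vol f p = coeff \<theta> (chart_fun \<theta> (f p)) * det (matrix (local_deriv \<kappa> \<theta> f p))
    / coeff \<kappa> (chart_fun \<kappa> p)"
  unfolding Jac_def
proof (rule the_equality)
  fix r assume r: "\<forall>X. (\<forall>i. X i \<in> tangent_space A p) \<longrightarrow> pullback A f vol p X = r * vol p X"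
  let ?E = "coord_vec A \<kappa> p"
  have E: "?E i \<in> tangent_space A p" for i
    by (rule coord_vec_tangent[OF \<kappa>])
  have "vol p ?E = coeff \<kappa> (chart_fun \<kappa> p)"
    using \<kappa> by (simp add: form_coeff_def)
  then have "vol p ?E \<noteq> 0"
    using coeff_pos \<kappa> by (metis chart_fun_in_img less_irrefl)
  moreover have "r * vol p ?E = coeff \<theta> (chart_fun \<theta> (f p)) * det (matrix (local_deriv \<kappa> \<theta> f p))
    / coeff \<kappa> (chart_fun \<kappa> p) * vol p ?E"
    using spec[OF r, of ?E] E unfolding pullback_volume_form[OF f \<kappa> \<theta> E] by simp
  ultimately show "r = coeff \<theta> (chart_fun \<theta> (f p)) * det (matrix (local_deriv \<kappa> \<theta> f p))
    / coeff \<kappa> (chart_fun \<kappa> p)"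
    by (auto simp only: mult_cancel_right)
qed (use pullback_volume_form[OF f \<kappa> \<theta>] in blast)

lemma Jac_id: "Jac A vol id p = 1"
  using Jac_eq[OF smooth_map_id chart_at chart_at(1)[of p]] chart_at[of p]
    coeff_pos[OF chart_at(1) chart_fun_in_img[OF chart_at(2)], of p]
  by (simp add: local_deriv_id matrix_id)

text \<open>The Jacobian of the identity is 1; here it is read in two different charts.\<close>

lemma coeff_chart_change:
  assumes \<kappa>: "\<kappa> \<in> A" "p \<in> chart_dom \<kappa>" and \<theta>: "\<theta> \<in> A" "p \<in> chart_dom \<theta>"
  shows "coeff \<kappa> (chart_fun \<kappa> p) = coeff \<theta> (chart_fun \<theta> p) * det (matrix (local_deriv \<kappa> \<theta> id p))"
  using Jac_eq[OF smooth_map_id \<kappa> \<theta>(1)] \<theta>(2) coeff_pos[OF \<kappa>(1) chart_fun_in_img[OF \<kappa>(2)]]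
  by (simp add: Jac_id field_simps)

lemma Jac_pos:
  assumes "\<xi> \<in> Diff A"
  shows "Jac A vol \<xi> p > 0"
  unfolding Jac_eq[OF DiffD(2)[OF assms] chart_at[of p] chart_at[of "\<xi> p"]]
  by (intro divide_pos_pos mult_pos_pos coeff_pos chart_fun_in_img chart_at Diff_det_pos[OF assms])

lemma pullback_eq_Jac:
  assumes f: "smooth_map A f" and X: "\<And>i. X i \<in> tangent_space A p"
  shows "pullback A f vol p X = Jac A vol f p * vol p X"
  using pullback_volume_form[OF f chart_at[of p] chart_at[of "f p"] X] Jac_eq[OF f chart_at[of p] chart_at[of "f p"]]
  by simp

section \<open>Jacobians and cosets\<close>

lemma Jac_compose_Diff_vol:
  assumes \<eta>: "\<eta> \<in> Diff_vol A vol" and \<xi>: "\<xi> \<in> Diff A"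
  shows "Jac A vol (\<eta> \<circ> \<xi>) = Jac A vol \<xi>"
proof
  fix p
  have "pullback A (\<eta> \<circ> \<xi>) vol p X = pullback A \<xi> vol p X" if X: "\<And>i. X i \<in> tangent_space A p" for X
  proof -
    have "pullback A (\<eta> \<circ> \<xi>) vol p X = pullback A \<eta> vol (\<xi> p) (\<lambda>i. tangent_map A \<xi> p (X i))"
      using \<eta> by (intro pullback_compose X DiffD \<xi>) (simp add: Diff_vol_def)
    also have "\<dots> = vol (\<xi> p) (\<lambda>i. tangent_map A \<xi> p (X i))"
      using \<eta> tangent_map_tangent[OF DiffD(2)[OF \<xi>] X] by (auto simp: Diff_vol_def)
    finally show ?thesis by (simp add: pullback_def)
  qed
  then show "Jac A vol (\<eta> \<circ> \<xi>) p = Jac A vol \<xi> p"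
    unfolding Jac_def by (intro arg_cong[of _ _ The] ext) auto
qed

text \<open>Vectors at \<open>q\<close> are pushed by \<open>inv \<eta>\<close> to a point where the
  pullbacks by \<open>\<xi>\<close> and \<open>\<eta>\<close> agree. Replacing \<open>\<xi>\<close>
  by \<open>\<eta>\<close> there reduces the pullback to that of the identity.\<close>

lemma Diff_vol_quotient:
  assumes \<xi>: "\<xi> \<in> Diff A" and \<eta>: "\<eta> \<in> Diff A" and eq: "Jac A vol \<xi> = Jac A vol \<eta>"
  shows "\<xi> \<circ> inv \<eta> \<in> Diff_vol A vol"
proof -
  have "pullback A (\<xi> \<circ> inv \<eta>) vol q X = vol q X" if X: "\<And>i. X i \<in> tangent_space A q" for q X
  proof -
    let ?p = "inv \<eta> q" and ?Y = "\<lambda>i. tangent_map A (inv \<eta>) q (X i)"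
    have Y: "?Y i \<in> tangent_space A ?p" for i
      by (intro tangent_map_tangent DiffD \<eta> X)
    have "pullback A (\<xi> \<circ> inv \<eta>) vol q X = pullback A \<xi> vol ?p ?Y"
      by (intro pullback_compose X DiffD \<xi> \<eta>)
    also have "\<dots> = pullback A \<eta> vol ?p ?Y"
      using pullback_eq_Jac[OF DiffD(2)[OF \<xi>] Y] pullback_eq_Jac[OF DiffD(2)[OF \<eta>] Y] eq by simp
    also have "\<dots> = pullback A (\<eta> \<circ> inv \<eta>) vol q X"
      by (intro pullback_compose[symmetric] X DiffD \<eta>)
    also have "\<eta> \<circ> inv \<eta> = id"
      using DiffD(1)[OF \<eta>] by (simp add: bij_is_surj surj_iff[symmetric])
    also have "pullback A id vol q X = vol q X"
      using X by (simp add: pullback_def tangent_map_id)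
    finally show ?thesis .
  qed
  then show ?thesis
    using compose_in_Diff[OF \<xi> inv_in_Diff[OF \<eta>]] by (auto simp: Diff_vol_def)
qed

lemma right_coset_subset:
  assumes \<xi>: "\<xi> \<in> Diff A" and \<eta>: "\<eta> \<in> Diff A" and eq: "Jac A vol \<xi> = Jac A vol \<eta>"
  shows "right_coset A vol \<xi> \<subseteq> right_coset A vol \<eta>"
proof
  fix \<zeta> assume "\<zeta> \<in> right_coset A vol \<xi>"
  then obtain \<alpha> where \<alpha>: "\<alpha> \<in> Diff_vol A vol" "\<zeta> = \<alpha> \<circ> \<xi>"
    by (auto simp: right_coset_def)
  have "\<zeta> = (\<alpha> \<circ> (\<xi> \<circ> inv \<eta>)) \<circ> \<eta>"
    using DiffD(1)[OF \<eta>] by (simp add: \<alpha>(2) fun_eq_iff bij_is_inj)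
  moreover have "\<alpha> \<circ> (\<xi> \<circ> inv \<eta>) \<in> Diff_vol A vol"
    by (intro compose_in_Diff_vol \<alpha>(1) Diff_vol_quotient assms)
  ultimately show "\<zeta> \<in> right_coset A vol \<eta>"
    unfolding right_coset_def by blast
qed

lemma right_coset_eq_iff:
  assumes \<xi>: "\<xi> \<in> Diff A" and \<eta>: "\<eta> \<in> Diff A"
  shows "right_coset A vol \<xi> = right_coset A vol \<eta> \<longleftrightarrow> Jac A vol \<xi> = Jac A vol \<eta>"
proof
  assume "right_coset A vol \<xi> = right_coset A vol \<eta>"
  moreover have "\<xi> \<in> right_coset A vol \<xi>"
    unfolding right_coset_def using id_in_Diff_vol by (intro CollectI exI[of _ id]) simp
  ultimately obtain \<alpha> where "\<alpha> \<in> Diff_vol A vol" "\<xi> = \<alpha> \<circ> \<eta>"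
    by (auto simp: right_coset_def)
  then show "Jac A vol \<xi> = Jac A vol \<eta>"
    using Jac_compose_Diff_vol[OF _ \<eta>] by simp
qed (use right_coset_subset assms in \<open>simp add: subset_antisym\<close>)

section \<open>Smooth functions on the manifold\<close>

lemma smooth_funI:
  assumes "\<And>\<kappa> p. \<kappa> \<in> A \<Longrightarrow> p \<in> chart_dom \<kappa> \<Longrightarrow>
    \<exists>U. open U \<and> chart_fun \<kappa> p \<in> U \<and> smooth_on U (\<lambda>y. u (chart_inv \<kappa> y))"
  shows "smooth_fun A u"
  unfolding smooth_fun_def
proof (intro ballI smooth_on_local)
  fix \<kappa> y assume "\<kappa> \<in> A" "y \<in> chart_img \<kappa>"
  then obtain U where U: "open U" "y \<in> U" "smooth_on U (\<lambda>y. u (chart_inv \<kappa> y))"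
    using assms[of \<kappa> "chart_inv \<kappa> y"] by auto
  then show "\<exists>U. open U \<and> y \<in> U \<and> smooth_on (chart_img \<kappa> \<inter> U) (\<lambda>y. u (chart_inv \<kappa> y))"
    by (meson inf_le2 smooth_on_subset)
qed

lemma smooth_fun_mult: "smooth_fun A u \<Longrightarrow> smooth_fun A v \<Longrightarrow> smooth_fun A (\<lambda>x. u x * v x)"
  unfolding smooth_fun_def by (intro ballI smooth_on_mult open_chart_img) auto

lemma smooth_fun_const: "smooth_fun A (\<lambda>x. c)"
  unfolding smooth_fun_def by (simp add: smooth_on_const)

lemma smooth_fun_sqrt:
  "smooth_fun A u \<Longrightarrow> (\<And>x. u x > 0) \<Longrightarrow> smooth_fun A (\<lambda>x. sqrt (u x))"
  unfolding smooth_fun_def by (intro ballI smooth_on_sqrt open_chart_img) auto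

lemma smooth_fun_compose:
  assumes u: "smooth_fun A u" and f: "smooth_map A f"
  shows "smooth_fun A (\<lambda>x. u (f x))"
proof (rule smooth_funI)
  fix \<kappa> p assume \<kappa>: "\<kappa> \<in> A" "p \<in> chart_dom \<kappa>"
  obtain \<theta> where \<theta>: "\<theta> \<in> A" "f p \<in> chart_dom \<theta>" using chart_covering by blast
  let ?U = "chart_fun \<kappa> ` (chart_dom \<kappa> \<inter> f -` chart_dom \<theta>)"
  have U: "open ?U" using open_local_dom \<kappa> \<theta> smooth_map_continuous[OF f] by blast
  have "smooth_on ?U (\<lambda>y. u (f (chart_inv \<kappa> y)))"
  proof (rule smooth_on_cong[OF U])
    show "smooth_on ?U (\<lambda>y. u (chart_inv \<theta> (local_rep \<kappa> \<theta> f y)))"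
      using u \<kappa> \<theta>
      by (intro smooth_on_compose[OF U _ local_rep_smooth[OF f], of "chart_img \<theta>"])
        (auto simp: smooth_fun_def local_rep_def)
  qed (use \<kappa> \<theta> in \<open>auto simp: local_rep_def\<close>)
  then show "\<exists>U. open U \<and> chart_fun \<kappa> p \<in> U \<and> smooth_on U (\<lambda>y. u (f (chart_inv \<kappa> y)))"
    using U \<kappa> \<theta> by blast
qed

lemma smooth_fun_continuous:
  assumes "smooth_fun A u"
  shows "continuous_on UNIV u"
proof -
  have "continuous_on (chart_dom \<kappa>) u" if "\<kappa> \<in> A" for \<kappa>
  proof -
    have "continuous_on (chart_img \<kappa>) (\<lambda>y. u (chart_inv \<kappa> y))"
      using assms that smooth_on_continuous_on unfolding smooth_fun_def by blast
    then have "continuous_on (chart_dom \<kappa>) (\<lambda>p. u (chart_inv \<kappa> (chart_fun \<kappa> p)))"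
      by (rule continuous_on_compose2[OF _ continuous_on_chart_fun[OF that]]) auto
    then show ?thesis
      using that by (simp cong: continuous_on_cong)
  qed
  then have "continuous_on (\<Union>\<kappa>\<in>A. chart_dom \<kappa>) u"
    using open_chart_dom by (intro continuous_on_open_UN) auto
  then show ?thesis
    using atlas by (simp add: oriented_atlas_def)
qed

lemma local_det_smooth:
  assumes f: "smooth_map A f" and "\<kappa> \<in> A" "\<theta> \<in> A"
  shows "smooth_on (chart_fun \<kappa> ` (chart_dom \<kappa> \<inter> f -` chart_dom \<theta>))
    (\<lambda>y. det (matrix (frechet_derivative (local_rep \<kappa> \<theta> f) (at y))))"
  using smooth_on_vec_nth[OF open_local_dom smooth_on_frechet_derivative[OF local_rep_smooth]]
    assms smooth_map_continuous[OF f]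
  by (intro smooth_on_det open_local_dom) (simp_all add: matrix_def)

lemma local_coeff_smooth:
  assumes f: "smooth_map A f" and \<kappa>: "\<kappa> \<in> A" and \<theta>: "\<theta> \<in> A"
  shows "smooth_on (chart_fun \<kappa> ` (chart_dom \<kappa> \<inter> f -` chart_dom \<theta>)) (\<lambda>y. coeff \<theta> (local_rep \<kappa> \<theta> f y))"
  using \<kappa> by (intro smooth_on_compose[OF open_local_dom[OF \<kappa> \<theta> smooth_map_continuous[OF f]]
      coeff_smooth[OF \<theta>] local_rep_smooth[OF f \<kappa> \<theta>]]) (auto simp: local_rep_def)

text \<open>Keeping one pair of charts fixed near \<open>p\<close> makes the quotient in
  \<open>Jac_eq\<close> a smooth function of the coordinates.\<close>

lemma Jac_smooth:
  assumes f: "smooth_map A f"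
  shows "smooth_fun A (Jac A vol f)"
proof (rule smooth_funI)
  fix \<kappa> p assume \<kappa>: "\<kappa> \<in> A" "p \<in> chart_dom \<kappa>"
  obtain \<theta> where \<theta>: "\<theta> \<in> A" "f p \<in> chart_dom \<theta>" using chart_covering by blast
  let ?U = "chart_fun \<kappa> ` (chart_dom \<kappa> \<inter> f -` chart_dom \<theta>)"
  have U: "open ?U" using open_local_dom \<kappa> \<theta> smooth_map_continuous[OF f] by blast
  have "smooth_on ?U (\<lambda>y. Jac A vol f (chart_inv \<kappa> y))"
  proof (rule smooth_on_cong[OF U])
    have "smooth_on ?U (coeff \<kappa>)"
      by (rule smooth_on_subset[OF coeff_smooth[OF \<kappa>(1)]]) auto
    then show "smooth_on ?U (\<lambda>y. coeff \<theta> (local_rep \<kappa> \<theta> f y) *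
        det (matrix (frechet_derivative (local_rep \<kappa> \<theta> f) (at y))) / coeff \<kappa> y)"
      using \<kappa>(1) \<theta>(1) f
      by (intro smooth_on_divide smooth_on_mult local_det_smooth local_coeff_smooth U)
        (auto intro!: coeff_pos)
    fix y assume "y \<in> ?U"
    then obtain q where q: "y = chart_fun \<kappa> q" "q \<in> chart_dom \<kappa>" "f q \<in> chart_dom \<theta>" by auto
    then show "coeff \<theta> (local_rep \<kappa> \<theta> f y) * det (matrix (frechet_derivative (local_rep \<kappa> \<theta> f) (at y)))
        / coeff \<kappa> y = Jac A vol f (chart_inv \<kappa> y)"
      using Jac_eq[OF f \<kappa>(1) q(2) \<theta>(1) q(3)] \<kappa>(1) by (simp add: local_rep_def local_deriv_def)
  qed
  then show "\<exists>U. open U \<and> chart_fun \<kappa> p \<in> U \<and> smooth_on U (\<lambda>y. Jac A vol f (chart_inv \<kappa> y))"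
    using U \<kappa> \<theta> by blast
qed

lemma Psi_smooth: "\<xi> \<in> Diff A \<Longrightarrow> smooth_fun A (Psi A vol \<xi>)"
  unfolding Psi_def by (intro smooth_fun_sqrt Jac_smooth Jac_pos DiffD)

text \<open>The coefficient of the Lie derivative of \<open>vol\<close> along \<open>v\<close>, in
  any chart; \<open>divergence\<close> is its quotient by \<open>coeff\<close> in the chosen
  chart.\<close>

definition lie_coeff :: "('m, 'n) chart \<Rightarrow> ('m \<Rightarrow> ('m, 'n) tvec) \<Rightarrow> real ^ 'n \<Rightarrow> real" where
  "lie_coeff \<kappa> v y = (\<Sum>i\<in>UNIV. frechet_derivative
     (\<lambda>z. coeff \<kappa> z * v (chart_inv \<kappa> z) \<kappa> $ i) (at y) (axis i 1))"

text \<open>The chart independence of the divergence is read off from the transport equation for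
  \<open>y \<mapsto> y + t v(y)\<close>, used once for the density of \<open>\<kappa>\<close> and once, after composing with the
  transition map, for the density of \<open>\<theta>\<close>: both compute the same derivative.\<close>

lemma lie_coeff_chart_change:
  assumes v: "vector_field A v" and \<kappa>: "\<kappa> \<in> A" "p \<in> chart_dom \<kappa>" and \<theta>: "\<theta> \<in> A" "p \<in> chart_dom \<theta>"
  shows "lie_coeff \<kappa> v (chart_fun \<kappa> p) =
    lie_coeff \<theta> v (chart_fun \<theta> p) * det (matrix (local_deriv \<kappa> \<theta> id p))"
proof -
  let ?D = "\<lambda>f x. frechet_derivative f (at x)"
  define w where "w = (\<lambda>\<kappa> y. v (chart_inv \<kappa> y) \<kappa>)"
  have w: "smooth_on (chart_img \<kappa>) (w \<kappa>)" if "\<kappa> \<in> A" for \<kappa>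
    using v that by (simp add: vector_field_def w_def)
  have lie: "lie_coeff \<kappa> v y = (\<Sum>i\<in>UNIV. ?D (\<lambda>z. coeff \<kappa> z * w \<kappa> z $ i) y (axis i 1))" for \<kappa> y
    by (simp add: lie_coeff_def w_def)
  define \<phi> where "\<phi> = local_rep \<kappa> \<theta> id"
  define U where "U = chart_fun \<kappa> ` (chart_dom \<kappa> \<inter> chart_dom \<theta>)"
  define y where "y = chart_fun \<kappa> p"
  have U: "open U" "U \<subseteq> chart_img \<kappa>" "y \<in> U"
    using open_local_dom[OF \<kappa>(1) \<theta>(1) smooth_map_continuous[OF smooth_map_id]] \<kappa> \<theta>
    by (auto simp: U_def y_def)
  have \<phi>: "smooth_on U \<phi>"
    using local_rep_smooth[OF smooth_map_id \<kappa>(1) \<theta>(1)] by (simp add: U_def \<phi>_def)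
  have \<phi>U: "\<phi> ` U \<subseteq> chart_img \<theta>"
    using \<kappa> by (auto simp: U_def \<phi>_def local_rep_def)
  \<comment> \<open>Straight-line motion does the work of the flow of \<open>v\<close>, because the
    transport equation takes the velocity only at time 0.\<close>
  define \<psi> where "\<psi> = (\<lambda>x. snd x + fst x *\<^sub>R w \<kappa> (snd x))"
  have "smooth_on (UNIV \<times> chart_img \<kappa>) \<psi>"
    unfolding \<psi>_def
    by (intro smooth_on_add smooth_on_scaleR smooth_on_compose[OF _ w[OF \<kappa>(1)]]
        smooth_on_bounded_linear[OF bounded_linear_fst] smooth_on_bounded_linear[OF bounded_linear_snd]
        smooth_on_ident open_Times open_UNIV open_chart_img \<kappa>(1)) auto
  \<comment> \<open>The region of time-space in which the moving point stays in the overlap of the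
    charts, so that the transition map can be applied to it.\<close>
  moreover define S where "S = (UNIV \<times> chart_img \<kappa>) \<inter> \<psi> -` U"
  ultimately have S: "open S" "smooth_on S \<psi>"
    using U \<kappa>(1) smooth_on_continuous_on
    by (auto intro!: continuous_open_preimage open_Times open_chart_img intro: smooth_on_subset)
  have \<psi>S: "\<psi> ` S \<subseteq> U" by (auto simp: S_def)
  have \<psi>0: "\<psi> (0, z) = z" for z by (simp add: \<psi>_def)
  have S0: "(0, z) \<in> S \<longleftrightarrow> z \<in> U" for z using U(2) by (auto simp: S_def \<psi>0)
  have D\<psi>: "?D \<psi> (0, z) (s, h) = s *\<^sub>R w \<kappa> z + h" if "z \<in> U" for s z h
  proof -
    have "(w \<kappa> has_derivative ?D (w \<kappa>) z) (at z)"
      using that U(2) by (intro smooth_on_has_derivative[OF w[OF \<kappa>(1)]]) auto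
    then have "((\<lambda>x. w \<kappa> (snd x)) has_derivative (\<lambda>h. ?D (w \<kappa>) z (snd h))) (at (0, z))"
      by (intro has_derivative_compose[where f = snd and g = "w \<kappa>"]) (auto intro!: derivative_eq_intros)
    then have "(\<psi> has_derivative (\<lambda>x. snd x + fst x *\<^sub>R w \<kappa> z)) (at (0, z))"
      unfolding \<psi>_def by (auto intro!: derivative_eq_intros)
    then show ?thesis
      by (simp add: frechet_derivative_eqI add.commute)
  qed
  define C where "C = (\<lambda>x. \<phi> (\<psi> x))"
  have C: "smooth_on S C" "C ` S \<subseteq> chart_img \<theta>"
    using smooth_on_compose[OF S(1) \<phi> S(2) \<psi>S] \<psi>S \<phi>U by (auto simp: C_def)
  have DC: "?D C x h = ?D \<phi> (\<psi> x) (?D \<psi> x h)" if "x \<in> S" for x h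
    unfolding C_def using that \<psi>S
    by (intro frechet_derivative_eqI has_derivative_compose[where f = \<psi> and g = \<phi>]
        smooth_on_has_derivative[OF S(2)] smooth_on_has_derivative[OF \<phi>]) auto
  have local: "?D \<phi> (chart_fun \<kappa> q) = local_deriv \<kappa> \<theta> id q" for q
    by (simp add: local_deriv_def \<phi>_def)
  \<comment> \<open>At time 0 the spatial derivative of \<open>\<psi>\<close> is the identity, so
    the determinant factor is 1.\<close>
  have d1: "((\<lambda>t. coeff \<kappa> (\<psi> (t, y)) * det (matrix (\<lambda>h. ?D \<psi> (t, y) (0, h)))) has_real_derivative
      lie_coeff \<kappa> v y) (at 0)"
    using pulled_back_density_has_derivative[of S y \<psi> "chart_img \<kappa>" "coeff \<kappa>" "w \<kappa>"]
      S \<psi>S U w \<kappa>(1) coeff_smooth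
    by (simp add: S0 \<psi>0 D\<psi> matrix_id[unfolded id_def] lie subset_trans)
  have d2: "((\<lambda>t. coeff \<theta> (C (t, y)) * det (matrix (\<lambda>h. ?D C (t, y) (0, h)))) has_real_derivative
      lie_coeff \<theta> v (chart_fun \<theta> p) * det (matrix (local_deriv \<kappa> \<theta> id p))) (at 0)"
  proof -
    have "?D C (0, z) (1, 0) = w \<theta> (C (0, z))" if "(0, z) \<in> S" for z
    proof -
      from that obtain q where q: "z = chart_fun \<kappa> q" "q \<in> chart_dom \<kappa>" "q \<in> chart_dom \<theta>"
        by (auto simp: S0 U_def)
      have "v q \<in> tangent_space A q" using v by (simp add: vector_field_def)
      then have "local_deriv \<kappa> \<theta> id q (w \<kappa> z) = v q \<theta>"
        using tangent_spaceD[of "v q" q \<kappa> \<theta>] q \<kappa>(1) \<theta>(1) by (simp add: w_def)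
      moreover have "C (0, z) = chart_fun \<theta> q"
        using q \<kappa>(1) by (simp add: C_def \<psi>0 \<phi>_def local_rep_def)
      moreover have "?D C (0, z) (1, 0) = local_deriv \<kappa> \<theta> id q (w \<kappa> z)"
        using DC[OF that, of "(1, 0)"] D\<psi>[of z 1 0] that local[of q] by (simp add: \<psi>0 S0 q(1))
      ultimately show ?thesis
        using q \<theta>(1) by (simp add: w_def)
    qed
    moreover have "matrix (\<lambda>h. ?D C (0, y) (0, h)) = matrix (local_deriv \<kappa> \<theta> id p)"
      using U(3) by (simp add: DC S0 \<psi>0 D\<psi> local y_def)
    moreover have "det (matrix (local_deriv \<kappa> \<theta> id p)) \<noteq> 0"
      using Diff_det_pos[OF id_in_Diff \<kappa>(1) \<theta>(1) \<kappa>(2)] \<theta>(2) by simp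
    moreover have "C (0, y) = chart_fun \<theta> p"
      using \<kappa> by (simp add: C_def \<psi>0 \<phi>_def local_rep_def y_def)
    ultimately show ?thesis
      using pulled_back_density_has_derivative[of S y C "chart_img \<theta>" "coeff \<theta>" "w \<theta>"]
        S C U w \<theta>(1) coeff_smooth
      by (simp add: S0 lie)
  qed
  have "((\<lambda>t. coeff \<theta> (C (t, y)) * det (matrix (\<lambda>h. ?D C (t, y) (0, h)))) has_real_derivative
      lie_coeff \<kappa> v y) (at 0)"
  \<comment> \<open>The two functions of \<open>t\<close> agree near 0: the coefficients differ by
    the transition determinant, which the chain rule restores in the derivative of
    \<open>C\<close>.\<close>
  proof (rule has_field_derivative_transform_within_open[OF d1])
    show "open ((\<lambda>t. (t, y)) -` S)" "0 \<in> (\<lambda>t. (t, y)) -` S"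
      using S(1) U(3) by (auto intro!: open_vimage continuous_intros simp: S0)
    fix t assume "t \<in> (\<lambda>t. (t, y)) -` S"
    then have t: "(t, y) \<in> S" by simp
    then obtain q where q: "\<psi> (t, y) = chart_fun \<kappa> q" "q \<in> chart_dom \<kappa>" "q \<in> chart_dom \<theta>"
      using \<psi>S by (auto simp: U_def)
    have lin: "linear (\<lambda>h. ?D \<psi> (t, y) (0, h))"
      using linear_compose[OF bounded_linear.linear[OF bounded_linear_Pair[OF bounded_linear_zero bounded_linear_ident]]
          has_derivative_linear[OF smooth_on_has_derivative[OF S(2) t]]]
      by (simp add: o_def)
    have "matrix (\<lambda>h. ?D C (t, y) (0, h)) =
        matrix (local_deriv \<kappa> \<theta> id q) ** matrix (\<lambda>h. ?D \<psi> (t, y) (0, h))"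
      using matrix_compose[OF lin linear_local_deriv[OF smooth_map_id \<kappa>(1) \<theta>(1) q(2)]] q
      by (simp add: DC[OF t] q(1) local o_def)
    moreover have "C (t, y) = chart_fun \<theta> q"
      using q \<kappa>(1) by (simp add: C_def \<phi>_def local_rep_def)
    ultimately show "coeff \<kappa> (\<psi> (t, y)) * det (matrix (\<lambda>h. ?D \<psi> (t, y) (0, h))) =
        coeff \<theta> (C (t, y)) * det (matrix (\<lambda>h. ?D C (t, y) (0, h)))"
      by (simp add: q(1) coeff_chart_change[OF \<kappa>(1) q(2) \<theta>(1) q(3)] det_mul)
  qed
  from DERIV_unique[OF this d2] show ?thesis
    by (simp add: y_def)
qed

text \<open>Numerator and denominator change charts by the same positive determinant. The divergence
  thus has one formula on a whole chart domain, from which its smoothness follows.\<close>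

lemma divergence_eq:
  assumes v: "vector_field A v" and \<kappa>: "\<kappa> \<in> A" "p \<in> chart_dom \<kappa>"
  shows "divergence A vol v p = lie_coeff \<kappa> v (chart_fun \<kappa> p) / coeff \<kappa> (chart_fun \<kappa> p)"
proof -
  note \<theta> = chart_at[of p]
  have "det (matrix (local_deriv (chart_at A p) \<kappa> id p)) > 0"
    using Diff_det_pos[OF id_in_Diff \<theta>(1) \<kappa>(1) \<theta>(2)] \<kappa>(2) by simp
  then show ?thesis
    using lie_coeff_chart_change[OF v \<theta> \<kappa>] coeff_chart_change[OF \<theta> \<kappa>]
    by (simp add: divergence_def Let_def lie_coeff_def)
qed

lemma divergence_smooth:
  assumes v: "vector_field A v"
  shows "smooth_fun A (divergence A vol v)"
  unfolding smooth_fun_def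
proof
  fix \<kappa> assume \<kappa>: "\<kappa> \<in> A"
  note op = open_chart_img[OF \<kappa>]
  have "smooth_on (chart_img \<kappa>) (\<lambda>z. coeff \<kappa> z * v (chart_inv \<kappa> z) \<kappa> $ i)" for i
    using v \<kappa> by (intro smooth_on_mult smooth_on_vec_nth op coeff_smooth) (auto simp: vector_field_def)
  then have "smooth_on (chart_img \<kappa>) (\<lambda>y. lie_coeff \<kappa> v y / coeff \<kappa> y)"
    unfolding lie_coeff_def using \<kappa>
    by (intro smooth_on_divide smooth_on_sum smooth_on_frechet_derivative op coeff_smooth coeff_pos) auto
  then show "smooth_on (chart_img \<kappa>) (\<lambda>y. divergence A vol v (chart_inv \<kappa> y))"
    by (rule smooth_on_cong[OF op, rotated]) (use \<kappa> in \<open>simp add: divergence_eq[OF v]\<close>)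
qed

lemma divergence_lincomb:
  assumes v: "vector_field A v" and w: "vector_field A w"
  shows "divergence A vol (\<lambda>p \<kappa>. a *\<^sub>R v p \<kappa> + b *\<^sub>R w p \<kappa>) p =
    a * divergence A vol v p + b * divergence A vol w p"
proof -
  define \<kappa> where "\<kappa> = chart_at A p"
  define y where "y = chart_fun \<kappa> p"
  have \<kappa>: "\<kappa> \<in> A" "y \<in> chart_img \<kappa>"
    using chart_at by (auto simp: \<kappa>_def y_def)
  note op = open_chart_img[OF \<kappa>(1)]
  let ?u = "\<lambda>v i z. coeff \<kappa> z * v (chart_inv \<kappa> z) \<kappa> $ i"
  have u: "(?u v i has_derivative frechet_derivative (?u v i) (at y)) (at y)" if "vector_field A v" for v i
    using that \<kappa>
    by (intro smooth_on_has_derivative[of "chart_img \<kappa>"] smooth_on_mult smooth_on_vec_nth op coeff_smooth)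
      (auto simp: vector_field_def)
  have "frechet_derivative (?u (\<lambda>p \<kappa>. a *\<^sub>R v p \<kappa> + b *\<^sub>R w p \<kappa>) i) (at y) h =
      a * frechet_derivative (?u v i) (at y) h + b * frechet_derivative (?u w i) (at y) h" for i h
  proof (rule frechet_derivative_eqI)
    have "?u (\<lambda>p \<kappa>. a *\<^sub>R v p \<kappa> + b *\<^sub>R w p \<kappa>) i = (\<lambda>z. a * ?u v i z + b * ?u w i z)"
      by (simp add: fun_eq_iff algebra_simps)
    then show "(?u (\<lambda>p \<kappa>. a *\<^sub>R v p \<kappa> + b *\<^sub>R w p \<kappa>) i has_derivative
        (\<lambda>h. a * frechet_derivative (?u v i) (at y) h + b * frechet_derivative (?u w i) (at y) h)) (at y)"
      by (simp only:) (intro has_derivative_add has_derivative_mult_right u v w)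
  qed
  then show ?thesis
    by (simp add: divergence_def Let_def \<kappa>_def[symmetric] y_def[symmetric] sum.distrib
        sum_distrib_left add_divide_distrib)
qed

end

section \<open>Volume measure and the map into the sphere\<close>

text \<open>The substitution formula for a diffeomorphism is available only on sets inside suitable
  chart domains. Splitting \<open>B\<close> into \<open>B \<inter> W\<close> and the rest lets
  finite additivity extend it.\<close>

lemma measures_agree_on_finite_cover:
  assumes sets: "sets M = sets borel" "sets N = sets borel"
    and F: "finite F" "\<And>W. W \<in> F \<Longrightarrow> W \<in> sets borel"
    and eq: "\<And>W B. W \<in> F \<Longrightarrow> B \<in> sets borel \<Longrightarrow> B \<subseteq> W \<Longrightarrow> emeasure M B = emeasure N B"
    and B: "B \<in> sets borel" "B \<subseteq> \<Union>F"
  shows "emeasure M B = emeasure N B"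
  using F eq B
proof (induction F arbitrary: B rule: finite_induct)
  case empty
  then show ?case by simp
next
  case (insert W F)
  have "W \<in> sets borel" using insert.prems by simp
  then have "B \<inter> W \<in> sets borel" "B - W \<in> sets borel"
    using insert.prems by auto
  moreover from this have "emeasure M (B \<inter> W) = emeasure N (B \<inter> W)"
    using insert.prems(2)[of W "B \<inter> W"] by simp
  moreover have "emeasure M (B - W) = emeasure N (B - W)"
  proof (rule insert.IH)
    show "emeasure M C = emeasure N C" if "V \<in> F" "C \<in> sets borel" "C \<subseteq> V" for V C
      using insert.prems(2)[OF _ that(2,3)] that(1) by blast
  qed (use insert.prems(1,4) \<open>B - W \<in> sets borel\<close> in auto)
  moreover have "(B \<inter> W) \<union> (B - W) = B" "(B \<inter> W) \<inter> (B - W) = {}" by auto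
  ultimately show ?case
    using plus_emeasure[of "B \<inter> W" M "B - W"] plus_emeasure[of "B \<inter> W" N "B - W"] sets by simp
qed

lemma borel_measurable_continuous_on_indicator_subset:
  fixes f :: "'a::topological_space \<Rightarrow> real"
  assumes "continuous_on U f" "T \<subseteq> U" "T \<in> sets borel"
  shows "(\<lambda>x. indicator T x * f x) \<in> borel_measurable borel"
  using borel_measurable_continuous_on_indicator[OF assms(3) continuous_on_subset[OF assms(1,2)]] by simp

text \<open>The time derivative at the centre is subtracted as a constant slope. By continuity the
  remaining slope stays below \<open>e / 2\<close> nearby, so the mean value inequality bounds the
  quotient for all nearby \<open>y\<close> at once; the other \<open>e / 2\<close> compares the time
  derivatives at \<open>(0, y)\<close> and at the centre.\<close>

lemma locally_uniform_difference_quotient: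
  fixes \<Gamma> :: "real \<times> 'a::euclidean_space \<Rightarrow> real"
  assumes S: "open S" "(0, y0) \<in> S" and \<Gamma>: "smooth_on S \<Gamma>" and "e > 0"
  shows "\<exists>\<delta>>0. \<forall>h y. h \<noteq> 0 \<longrightarrow> \<bar>h\<bar> < \<delta> \<longrightarrow> dist y y0 < \<delta> \<longrightarrow> (h, y) \<in> S \<and> (0, y) \<in> S \<and>
    \<bar>(\<Gamma> (h, y) - \<Gamma> (0, y)) / h - frechet_derivative \<Gamma> (at (0, y)) (1, 0)\<bar> < e"
proof -
  let ?d = "\<lambda>x. frechet_derivative \<Gamma> (at x) (1, 0)"
  have "continuous_on S ?d"
    by (intro smooth_on_continuous_on smooth_on_frechet_derivative \<Gamma>)
  then have "isCont ?d (0, y0)"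
    using S by (simp add: continuous_on_eq_continuous_at)
  then have "\<forall>u>0. \<exists>r>0. \<forall>x. dist x (0, y0) < r \<longrightarrow> \<bar>?d x - ?d (0, y0)\<bar> < u"
    unfolding continuous_at_eps_delta dist_real_def .
  from this[THEN spec, THEN mp, OF half_gt_zero[OF \<open>e > 0\<close>]]
  obtain r1 where r1: "r1 > 0" "\<And>x. dist x (0, y0) < r1 \<Longrightarrow> \<bar>?d x - ?d (0, y0)\<bar> < e / 2"
    by blast
  obtain r2 where r2: "r2 > 0" "ball (0, y0) r2 \<subseteq> S"
    using S openE by blast
  \<comment> \<open>Halved because the distance in the product is bounded by the sum of the
    distances in the two factors.\<close>
  define \<delta> where "\<delta> = min r1 r2 / 2"
  have "\<delta> > 0" using r1 r2 by (simp add: \<delta>_def)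
  have near: "dist (t, y) (0, y0) < min r1 r2" if "\<bar>t\<bar> < \<delta>" "dist y y0 < \<delta>" for t y
  proof -
    have "dist (t, y) (0, y0) \<le> \<bar>t\<bar> + dist y y0"
      unfolding dist_prod_def using sqrt_sum_squares_le_sum[of "\<bar>t\<bar>" "dist y y0"] by (simp add: dist_real_def)
    also have "\<dots> < \<delta> + \<delta>" using that by linarith
    finally show ?thesis by (simp add: \<delta>_def)
  qed
  have inS: "(t, y) \<in> S" if "\<bar>t\<bar> < \<delta>" "dist y y0 < \<delta>" for t y
    using near[OF that] r2(2) by (auto simp: dist_commute)
  have close: "\<bar>?d (t, y) - ?d (0, y0)\<bar> < e / 2" if "\<bar>t\<bar> < \<delta>" "dist y y0 < \<delta>" for t y
    using near[OF that] by (intro r1(2)) simp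
  have "\<bar>(\<Gamma> (h, y) - \<Gamma> (0, y)) / h - ?d (0, y)\<bar> < e" if h: "h \<noteq> 0" "\<bar>h\<bar> < \<delta>" and y: "dist y y0 < \<delta>" for h y
  proof -
    let ?q = "?d (0, y0)"
    have "norm ((\<Gamma> (h, y) - h * ?q) - (\<Gamma> (0, y) - 0 * ?q)) \<le> e / 2 * norm (h - 0)"
    proof (rule field_differentiable_bound[where S = "{- \<bar>h\<bar>..\<bar>h\<bar>}" and f' = "\<lambda>t. ?d (t, y) - ?q"
          and f = "\<lambda>t. \<Gamma> (t, y) - t * ?q"])
      fix t assume "t \<in> {- \<bar>h\<bar>..\<bar>h\<bar>}"
      then have t: "\<bar>t\<bar> < \<delta>" using h by auto
      show "norm (?d (t, y) - ?q) \<le> e / 2"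
        using close[OF t y] by simp
      note D = smooth_on_has_derivative[OF \<Gamma> inS[OF t y]]
      have "((\<lambda>t. \<Gamma> (t, y)) has_derivative (\<lambda>s. frechet_derivative \<Gamma> (at (t, y)) (s, 0))) (at t)"
        by (rule has_derivative_compose[where f = "\<lambda>t. (t, y)" and x = t, OF _ D])
          (auto intro!: derivative_eq_intros)
      moreover have "frechet_derivative \<Gamma> (at (t, y)) (s, 0) = ?d (t, y) * s" for s
        using linear_scale[OF has_derivative_linear[OF D], of s "(1, 0)"] by (auto simp: mult.commute)
      ultimately have "((\<lambda>t. \<Gamma> (t, y)) has_real_derivative ?d (t, y)) (at t)"
        unfolding has_field_derivative_def by (metis (no_types, lifting) ext)
      then have "((\<lambda>t. \<Gamma> (t, y) - t * ?q) has_real_derivative ?d (t, y) - 1 * ?q) (at t)"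
        by (intro DERIV_diff DERIV_cmult_right DERIV_ident)
      then show "((\<lambda>t. \<Gamma> (t, y) - t * ?q) has_real_derivative ?d (t, y) - ?q) (at t within {- \<bar>h\<bar>..\<bar>h\<bar>})"
        unfolding mult_1 by (rule has_field_derivative_at_within)
    qed auto
    moreover have "(\<Gamma> (h, y) - \<Gamma> (0, y)) / h - ?q = ((\<Gamma> (h, y) - h * ?q) - (\<Gamma> (0, y) - 0 * ?q)) / h"
      using h(1) by (simp add: field_simps)
    ultimately have "\<bar>(\<Gamma> (h, y) - \<Gamma> (0, y)) / h - ?q\<bar> \<le> e / 2"
      using h(1) by (simp add: abs_divide divide_le_eq)
    moreover have "\<bar>?d (0, y) - ?q\<bar> < e / 2"
      using close[of 0 y] y \<open>\<delta> > 0\<close> by simp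
    ultimately show ?thesis by linarith
  qed
  then show ?thesis
    using \<open>\<delta> > 0\<close> inS by (intro exI[of _ \<delta>]) auto
qed

locale riemannian_volume = riemannian_manifold A g
  for A :: "('m::t2_space, 'n::finite) chart set" and g +
  fixes M :: "'m measure"
  assumes compact: "compact (UNIV :: 'm set)"
    and volume: "measure_of_form A vol M"
    and total: "emeasure M UNIV = 1"
begin

section \<open>The volume measure in charts\<close>

lemma sets_M [simp, measurable_cong]: "sets M = sets borel"
  using volume by (simp add: measure_of_form_def)

lemma space_M [simp]: "space M = UNIV"
  using sets_eq_imp_space_eq[OF sets_M] by simp

lemma emeasure_M:
  "\<kappa> \<in> A \<Longrightarrow> B \<in> sets borel \<Longrightarrow> B \<subseteq> chart_dom \<kappa> \<Longrightarrow>
    emeasure M B = (\<integral>\<^sup>+y\<in>chart_fun \<kappa> ` B. ennreal (coeff \<kappa> y) \<partial>lborel)"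
  using volume by (simp add: measure_of_form_def)

lemma measure_M: "measure M UNIV = 1"
  by (simp add: measure_def total)

sublocale finite_measure M
  by standard (simp add: total)

lemma borel_measurable_M [simp]: "borel_measurable M = borel_measurable borel"
  by (rule measurable_cong_sets) simp_all

text \<open>The image under the chart is a preimage under its continuous inverse.\<close>

lemma borel_chart_fun_image:
  assumes "\<kappa> \<in> A" "B \<in> sets borel" "B \<subseteq> chart_dom \<kappa>"
  shows "chart_fun \<kappa> ` B \<in> sets borel"
proof -
  have "chart_inv \<kappa> -` B \<inter> space (restrict_space borel (chart_img \<kappa>)) \<in> sets (restrict_space borel (chart_img \<kappa>))"
    using assms by (intro measurable_sets[OF borel_measurable_continuous_on_restrict] continuous_on_chart_inv)
  then show ?thesis
    using open_chart_img[OF assms(1)] chart_fun_image[OF assms(1,3)]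
    by (simp add: sets_restrict_space_iff space_restrict_space Int_commute)
qed

text \<open>On the chart domain \<open>M\<close> is the image under the inverse chart of Lebesgue
  measure with density \<open>coeff \<kappa>\<close>. The specification of \<open>M\<close> on Borel
  sets amounts to this equality of measures, and the integral formula follows from it.\<close>

lemma nn_integral_chart:
  assumes \<kappa>: "\<kappa> \<in> A" and B: "B \<in> sets borel" "B \<subseteq> chart_dom \<kappa>" and f: "f \<in> borel_measurable borel"
  shows "(\<integral>\<^sup>+x\<in>B. f x \<partial>M) = (\<integral>\<^sup>+y\<in>chart_fun \<kappa> ` B. ennreal (coeff \<kappa> y) * f (chart_inv \<kappa> y) \<partial>lborel)"
proof -
  let ?I = "chart_img \<kappa>"
  \<comment> \<open>Off the chart image \<open>k\<close> takes a constant value, which keeps it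
    Borel on the whole space; the density \<open>c\<close> vanishes there.\<close>
  define k where "k = (\<lambda>y. if y \<in> ?I then chart_inv \<kappa> y else undefined)"
  define c where "c = (\<lambda>y. ennreal (indicator ?I y * coeff \<kappa> y))"
  have I [measurable]: "?I \<in> sets borel"
    using open_chart_img[OF \<kappa>] by simp
  have [measurable]: "chart_dom \<kappa> \<in> sets borel"
    using open_chart_dom[OF \<kappa>] by simp
  have [measurable]: "k \<in> borel \<rightarrow>\<^sub>M borel"
    unfolding k_def
    by (subst measurable_If_restrict_space_iff)
      (auto intro: borel_measurable_continuous_on_restrict continuous_on_chart_inv \<kappa>)
  have [measurable]: "c \<in> borel_measurable borel"
    unfolding c_def
    using borel_measurable_continuous_on_indicator_subset[OF smooth_on_continuous_on[OF coeff_smooth[OF \<kappa>]] subset_refl I]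
    by measurable
  note [measurable] = f B(1)
  have image: "indicator (chart_fun \<kappa> ` C) y = (indicator ?I y * indicator C (k y) :: ennreal)"
    if "C \<subseteq> chart_dom \<kappa>" for C y
    using chart_fun_image[OF \<kappa> that] by (auto simp: k_def indicator_def)
  have "density M (indicator (chart_dom \<kappa>)) = distr (density lborel c) borel k"
  proof (rule measure_eqI)
    fix C assume "C \<in> sets (density M (indicator (chart_dom \<kappa>)))"
    then have C [measurable]: "C \<in> sets borel" by simp
    let ?C = "C \<inter> chart_dom \<kappa>"
    have "emeasure (density M (indicator (chart_dom \<kappa>))) C = emeasure M ?C"
      by (simp add: emeasure_density nn_integral_indicator flip: indicator_inter_arith)
        (simp add: Int_commute)
    also have "\<dots> = (\<integral>\<^sup>+y\<in>chart_fun \<kappa> ` ?C. ennreal (coeff \<kappa> y) \<partial>lborel)"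
      by (rule emeasure_M[OF \<kappa>]) auto
    also have "\<dots> = (\<integral>\<^sup>+y. c y * indicator C (k y) \<partial>lborel)"
      by (intro nn_integral_cong, subst image) (auto simp: c_def k_def indicator_def \<kappa>)
    also have "\<dots> = emeasure (distr (density lborel c) borel k) C"
      using measurable_sets[of k borel borel C]
      by (simp add: emeasure_distr emeasure_density indicator_vimage[symmetric])
    finally show "emeasure (density M (indicator (chart_dom \<kappa>))) C = emeasure (distr (density lborel c) borel k) C" .
  qed simp
  note distr = this
  have "(\<integral>\<^sup>+x\<in>B. f x \<partial>M) = (\<integral>\<^sup>+x. indicator (chart_dom \<kappa>) x * (f x * indicator B x) \<partial>M)"
    using B(2) by (intro nn_integral_cong) (auto simp: indicator_def)
  also have "\<dots> = (\<integral>\<^sup>+x. f x * indicator B x \<partial>density M (indicator (chart_dom \<kappa>)))"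
    by (simp add: nn_integral_density)
  also have "\<dots> = (\<integral>\<^sup>+y. c y * (f (k y) * indicator B (k y)) \<partial>lborel)"
    unfolding distr by (simp add: nn_integral_distr nn_integral_density)
  also have "\<dots> = (\<integral>\<^sup>+y\<in>chart_fun \<kappa> ` B. ennreal (coeff \<kappa> y) * f (chart_inv \<kappa> y) \<partial>lborel)"
    by (intro nn_integral_cong, subst image[OF B(2)]) (auto simp: c_def k_def indicator_def)
  finally show ?thesis .
qed

section \<open>Change of variables under a diffeomorphism\<close>

lemma Diff_measurable:
  assumes "\<xi> \<in> Diff A"
  shows "\<xi> \<in> borel \<rightarrow>\<^sub>M borel" "inv \<xi> \<in> borel \<rightarrow>\<^sub>M borel"
  using DiffD[OF assms] by (auto intro!: borel_measurable_continuous_onI smooth_map_continuous)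

lemma smooth_fun_measurable: "smooth_fun A u \<Longrightarrow> u \<in> borel_measurable borel"
  by (intro borel_measurable_continuous_onI smooth_fun_continuous)

lemma Diff_image_eq:
  assumes "\<xi> \<in> Diff A"
  shows "\<xi> ` B = inv \<xi> -` B"
  using DiffD(1)[OF assms] by (simp add: bij_vimage_eq_inv_image bij_imp_bij_inv inv_inv_eq)

text \<open>Substitution with the local representative of \<open>\<xi>\<close>. The determinant
  times the ratio of the coefficients is the coordinate formula of the Jacobian, and positivity
  removes the absolute value.\<close>

lemma emeasure_Diff_image_local:
  assumes \<xi>: "\<xi> \<in> Diff A" and \<kappa>: "\<kappa> \<in> A" and \<theta>: "\<theta> \<in> A"
    and B: "B \<in> sets borel" "B \<subseteq> chart_dom \<kappa> \<inter> \<xi> -` chart_dom \<theta>"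
  shows "emeasure M (\<xi> ` B) = (\<integral>\<^sup>+x\<in>B. ennreal (Jac A vol \<xi> x) \<partial>M)"
proof -
  note sm = DiffD(2,3)[OF \<xi>]
  have inv: "inv \<xi> (\<xi> q) = q" "inv \<xi> \<circ> \<xi> = id" for q
    using DiffD(1)[OF \<xi>] by (simp_all add: bij_is_inj)
  have \<xi>B: "\<xi> ` B \<in> sets borel" "\<xi> ` B \<subseteq> chart_dom \<theta>"
    using measurable_sets[OF Diff_measurable(2)[OF \<xi>] B(1)] B(2) Diff_image_eq[OF \<xi>, of B]
    by (simp, blast)
  let ?S = "chart_fun \<kappa> ` B" and ?T = "chart_fun \<theta> ` \<xi> ` B"
  let ?U = "chart_fun \<kappa> ` (chart_dom \<kappa> \<inter> \<xi> -` chart_dom \<theta>)"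
  let ?g = "local_rep \<kappa> \<theta> \<xi>" and ?h = "local_rep \<theta> \<kappa> (inv \<xi>)"
  let ?g' = "\<lambda>y. frechet_derivative ?g (at y)" and ?h' = "\<lambda>y. frechet_derivative ?h (at y)"
  have ST: "?S \<in> sets borel" "?T \<in> sets borel" "?S \<subseteq> ?U" "?T \<subseteq> chart_img \<theta>"
    using \<xi>B B by (auto intro!: borel_chart_fun_image \<kappa> \<theta>)
  \<comment> \<open>The finite total volume provides the finiteness required by the substitution
    formula.\<close>
  have fin: "emeasure M (\<xi> ` B) < \<infinity>"
    by (simp add: less_top[symmetric])
  have "emeasure M (\<xi> ` B) = (\<integral>\<^sup>+y\<in>?T. ennreal (coeff \<theta> y) \<partial>lborel)"
    by (rule emeasure_M[OF \<theta> \<xi>B])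
  also have "\<dots> = (\<integral>\<^sup>+x\<in>?S. ennreal (\<bar>det (matrix (?g' x))\<bar> * coeff \<theta> (?g x)) \<partial>lborel)"
  proof (rule nn_integral_change_of_variables)
    fix y assume "y \<in> ?S"
    then obtain q where q: "q \<in> B" "y = chart_fun \<kappa> q" by auto
    then have q': "q \<in> chart_dom \<kappa>" "\<xi> q \<in> chart_dom \<theta>" using B(2) by auto
    show "(?g has_derivative ?g' y) (at y)"
      using q q' \<kappa> \<theta> sm by (auto intro!: smooth_on_has_derivative[OF local_rep_smooth])
    show "?g y \<in> ?T \<and> ?h (?g y) = y"
      using q q' \<kappa> \<theta> by (simp add: local_rep_def inv)
  next
    fix z assume "z \<in> ?T"
    then obtain q where q: "q \<in> B" "z = chart_fun \<theta> (\<xi> q)" by auto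
    then have q': "q \<in> chart_dom \<kappa>" "\<xi> q \<in> chart_dom \<theta>" using B(2) by auto
    show "(?h has_derivative ?h' z) (at z)"
      unfolding q(2)
      using q' \<kappa> \<theta> sm by (intro smooth_on_has_derivative[OF local_rep_smooth]) (auto simp: inv)
    show "0 \<le> coeff \<theta> z"
      using coeff_pos[OF \<theta>, of z] q' by (simp add: q(2))
    have hz: "?h z = chart_fun \<kappa> q"
      using q q' \<theta> by (simp add: local_rep_def inv)
    show "?h z \<in> ?S \<and> ?g (?h z) = z"
      unfolding hz using q q' \<kappa> by (simp add: local_rep_def)
    show "?h' z \<circ> ?g' (?h z) = id"
      using local_deriv_compose[OF sm(2,1) \<kappa> \<theta> \<kappa>, of q] q' local_deriv_id[OF \<kappa> q'(1)]
      unfolding hz by (simp add: inv q(2) local_deriv_def)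
  next
    show "(\<lambda>y. indicator ?T y * coeff \<theta> y) \<in> borel_measurable borel"
      by (rule borel_measurable_continuous_on_indicator_subset[OF smooth_on_continuous_on[OF coeff_smooth[OF \<theta>]] ST(4,2)])
    show "(\<lambda>x. indicator ?S x * (\<bar>det (matrix (?g' x))\<bar> * coeff \<theta> (?g x))) \<in> borel_measurable borel"
      using local_det_smooth[OF sm(1) \<kappa> \<theta>] local_coeff_smooth[OF sm(1) \<kappa> \<theta>]
      by (intro borel_measurable_continuous_on_indicator_subset[OF _ ST(3,1)] continuous_intros)
        (auto dest: smooth_on_continuous_on)
    show "(\<integral>\<^sup>+y\<in>?T. ennreal (coeff \<theta> y) \<partial>lborel) < \<infinity>"
      using fin by (simp add: emeasure_M[OF \<theta> \<xi>B])
  qed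
  also have "\<dots> = (\<integral>\<^sup>+x\<in>?S. ennreal (coeff \<kappa> x) * ennreal (Jac A vol \<xi> (chart_inv \<kappa> x)) \<partial>lborel)"
  proof (rule nn_integral_cong)
    fix x
    show "ennreal (\<bar>det (matrix (?g' x))\<bar> * coeff \<theta> (?g x)) * indicator ?S x =
      ennreal (coeff \<kappa> x) * ennreal (Jac A vol \<xi> (chart_inv \<kappa> x)) * indicator ?S x"
    proof (cases "x \<in> ?S")
      case True
      then obtain q where q: "q \<in> B" "x = chart_fun \<kappa> q" by auto
      then have q': "q \<in> chart_dom \<kappa>" "\<xi> q \<in> chart_dom \<theta>" using B(2) by auto
      have "det (matrix (?g' x)) > 0"
        using Diff_det_pos[OF \<xi> \<kappa> \<theta> q'] by (simp add: local_deriv_def q(2))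
      moreover have "coeff \<kappa> x > 0"
        using coeff_pos[OF \<kappa>] q' by (simp add: q(2))
      moreover have "Jac A vol \<xi> q = coeff \<theta> (?g x) * det (matrix (?g' x)) / coeff \<kappa> x"
        using Jac_eq[OF sm(1) \<kappa> q'(1) \<theta> q'(2)] q' \<kappa> by (simp add: local_deriv_def q(2) local_rep_def)
      moreover have "chart_inv \<kappa> x = q" using q q' \<kappa> by simp
      ultimately have "\<bar>det (matrix (?g' x))\<bar> * coeff \<theta> (?g x) = coeff \<kappa> x * Jac A vol \<xi> (chart_inv \<kappa> x)"
        by simp
      then show ?thesis
        using \<open>coeff \<kappa> x > 0\<close> Jac_pos[OF \<xi>, of "chart_inv \<kappa> x"] by (simp add: ennreal_mult less_imp_le)
    qed simp
  qed
  also have "\<dots> = (\<integral>\<^sup>+x\<in>B. ennreal (Jac A vol \<xi> x) \<partial>M)"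
    using B smooth_fun_measurable[OF Jac_smooth[OF sm(1)]]
    by (intro nn_integral_chart[symmetric] \<kappa>) auto
  finally show ?thesis .
qed

text \<open>Pairs of charts occur because \<open>\<xi>\<close> may map one chart domain across
  several others.\<close>

lemma finite_chart_cover:
  assumes \<xi>: "\<xi> \<in> Diff A"
  shows "\<exists>F. finite F \<and> F \<subseteq> A \<times> A \<and> (\<Union>(\<kappa>, \<theta>)\<in>F. chart_dom \<kappa> \<inter> \<xi> -` chart_dom \<theta>) = UNIV"
proof -
  let ?W = "\<lambda>(\<kappa>, \<theta>). chart_dom \<kappa> \<inter> \<xi> -` chart_dom \<theta>"
  have "\<exists>F\<subseteq>A \<times> A. finite F \<and> UNIV \<subseteq> (\<Union>a\<in>F. ?W a)"
  proof (rule compactE_image[OF compact, of "A \<times> A" ?W])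
    show "open (?W a)" if "a \<in> A \<times> A" for a
      using that open_chart_dom smooth_map_continuous[OF DiffD(2)[OF \<xi>]] by (auto intro!: open_Int open_vimage)
    show "UNIV \<subseteq> (\<Union>a\<in>A \<times> A. ?W a)"
    proof
      fix p
      show "p \<in> (\<Union>a\<in>A \<times> A. ?W a)"
        using chart_at[of p] chart_at[of "\<xi> p"] by (intro UN_I[of "(chart_at A p, chart_at A (\<xi> p))"]) auto
    qed
  qed auto
  then show ?thesis by (metis top.extremum_uniqueI)
qed

text \<open>Both measures give \<open>B\<close> the volume of its image under \<open>\<xi>\<close>,
  which is why the inverse appears on the right. The local formula yields this on each piece of the
  finite cover.\<close>

lemma density_Jac:
  assumes \<xi>: "\<xi> \<in> Diff A"
  shows "density M (\<lambda>x. ennreal (Jac A vol \<xi> x)) = distr M borel (inv \<xi>)"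
proof (rule measure_eqI)
  note [measurable] = Diff_measurable[OF \<xi>] smooth_fun_measurable[OF Jac_smooth[OF DiffD(2)[OF \<xi>]]]
  let ?W = "\<lambda>(\<kappa>, \<theta>). chart_dom \<kappa> \<inter> \<xi> -` chart_dom \<theta>"
  fix B assume "B \<in> sets (density M (\<lambda>x. ennreal (Jac A vol \<xi> x)))"
  then have B: "B \<in> sets borel" by simp
  obtain F where F: "finite F" "F \<subseteq> A \<times> A" "(\<Union>a\<in>F. ?W a) = UNIV"
    using finite_chart_cover[OF \<xi>] by auto
  show "emeasure (density M (\<lambda>x. ennreal (Jac A vol \<xi> x))) B = emeasure (distr M borel (inv \<xi>)) B"
  proof (rule measures_agree_on_finite_cover[of _ _ "?W ` F"])
    fix W assume "W \<in> ?W ` F"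
    then obtain \<kappa> \<theta> where \<kappa>\<theta>: "\<kappa> \<in> A" "\<theta> \<in> A" "W = ?W (\<kappa>, \<theta>)"
      using F(2) by auto
    show "W \<in> sets borel"
      using \<kappa>\<theta>(3) open_chart_dom[OF \<kappa>\<theta>(1)] open_chart_dom[OF \<kappa>\<theta>(2)]
        smooth_map_continuous[OF DiffD(2)[OF \<xi>]]
      by (simp add: open_Int open_vimage)
    fix C assume C: "C \<in> sets borel" "C \<subseteq> W"
    have "emeasure (density M (\<lambda>x. ennreal (Jac A vol \<xi> x))) C = (\<integral>\<^sup>+x\<in>C. ennreal (Jac A vol \<xi> x) \<partial>M)"
      using C(1) by (simp add: emeasure_density)
    also have "\<dots> = emeasure M (\<xi> ` C)"
      using C \<kappa>\<theta> by (intro emeasure_Diff_image_local[symmetric] \<xi>) auto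
    also have "\<dots> = emeasure (distr M borel (inv \<xi>)) C"
      using C(1) by (simp add: emeasure_distr Diff_image_eq[OF \<xi>])
    finally show "emeasure (density M (\<lambda>x. ennreal (Jac A vol \<xi> x))) C = emeasure (distr M borel (inv \<xi>)) C" .
  qed (use F B in auto)
qed simp

lemma integral_Jac_compose:
  assumes \<xi>: "\<xi> \<in> Diff A" and u: "smooth_fun A u"
  shows "(\<integral>x. Jac A vol \<xi> x * u (\<xi> x) \<partial>M) = (\<integral>x. u x \<partial>M)"
proof -
  note [measurable] = Diff_measurable[OF \<xi>] smooth_fun_measurable[OF Jac_smooth[OF DiffD(2)[OF \<xi>]]]
    smooth_fun_measurable[OF u]
  have "(\<integral>x. Jac A vol \<xi> x * u (\<xi> x) \<partial>M) = (\<integral>x. u (\<xi> x) \<partial>density M (\<lambda>x. ennreal (Jac A vol \<xi> x)))"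
    by (subst integral_density) (auto simp: Jac_pos[OF \<xi>] less_imp_le)
  also have "\<dots> = (\<integral>x. u (\<xi> (inv \<xi> x)) \<partial>M)"
    unfolding density_Jac[OF \<xi>] by (rule integral_distr) auto
  also have "\<dots> = (\<integral>x. u x \<partial>M)"
    using DiffD(1)[OF \<xi>] by (simp add: bij_is_surj surj_f_inv_f)
  finally show ?thesis .
qed

section \<open>Unit norm of the square root of the Jacobian\<close>

lemma smooth_fun_integrable:
  assumes "smooth_fun A u"
  shows "integrable M u"
proof -
  have "bounded (u ` UNIV)"
    by (intro compact_imp_bounded compact_continuous_image smooth_fun_continuous assms compact)
  then obtain b where "\<And>x. norm (u x) \<le> b"
    unfolding bounded_iff by auto
  then show ?thesis
    using smooth_fun_measurable[OF assms] by (intro integrable_const_bound) auto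
qed

lemma Psi_square: "\<xi> \<in> Diff A \<Longrightarrow> (Psi A vol \<xi> x)\<^sup>2 = Jac A vol \<xi> x"
  using Jac_pos[of \<xi> x] by (simp add: Psi_def)

lemma Psi_in_sphere:
  assumes \<xi>: "\<xi> \<in> Diff A"
  shows "Psi A vol \<xi> \<in> L2_sphere A M"
proof -
  have "(\<integral>x. Jac A vol \<xi> x \<partial>M) = 1"
    using integral_Jac_compose[OF \<xi> smooth_fun_const, of 1] measure_M by simp
  then show ?thesis
    using \<xi> by (simp add: L2_sphere_def Psi_square Psi_smooth smooth_fun_integrable Jac_smooth DiffD)
qed

section \<open>The differential of \<open>Psi\<close>\<close>

definition Psi_differential :: "('m \<Rightarrow> 'm) \<Rightarrow> ('m \<Rightarrow> ('m, 'n) tvec) \<Rightarrow> 'm \<Rightarrow> real" where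
  "Psi_differential \<eta> V x = 1 / 2 * divergence A vol (V \<circ> inv \<eta>) (\<eta> x) * Psi A vol \<eta> x"

lemma tangent_Diff_vector_field:
  assumes \<eta>: "\<eta> \<in> Diff A" and V: "V \<in> tangent_Diff A \<eta>"
  shows "vector_field A (V \<circ> inv \<eta>)" "V \<circ> inv \<eta> \<circ> \<eta> = V"
proof -
  obtain v where v: "vector_field A v" "V = v \<circ> \<eta>"
    using V by (auto simp: tangent_Diff_def)
  then have "V \<circ> inv \<eta> = v"
    using DiffD(1)[OF \<eta>] by (simp add: fun_eq_iff bij_is_surj surj_f_inv_f)
  then show "vector_field A (V \<circ> inv \<eta>)" "V \<circ> inv \<eta> \<circ> \<eta> = V"
    using v by simp_all
qed

lemma Psi_differential_smooth:
  assumes \<eta>: "\<eta> \<in> Diff A" and V: "V \<in> tangent_Diff A \<eta>"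
  shows "smooth_fun A (Psi_differential \<eta> V)"
  unfolding Psi_differential_def
  using tangent_Diff_vector_field(1)[OF assms] \<eta>
  by (intro smooth_fun_mult smooth_fun_const smooth_fun_compose[OF divergence_smooth] Psi_smooth DiffD)

lemma Psi_differential_isometric:
  assumes \<eta>: "\<eta> \<in> Diff A" and V: "V \<in> tangent_Diff A \<eta>" and W: "W \<in> tangent_Diff A \<eta>"
  shows "(\<integral>x. Psi_differential \<eta> V x * Psi_differential \<eta> W x \<partial>M) = H1_metric A vol M \<eta> V W"
proof -
  let ?u = "\<lambda>x. 1 / 4 * (divergence A vol (V \<circ> inv \<eta>) x * divergence A vol (W \<circ> inv \<eta>) x)"
  have "Psi_differential \<eta> V x * Psi_differential \<eta> W x = Jac A vol \<eta> x * ?u (\<eta> x)" for x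
    unfolding Psi_square[OF \<eta>, symmetric] by (simp add: Psi_differential_def power2_eq_square)
  then have "(\<integral>x. Psi_differential \<eta> V x * Psi_differential \<eta> W x \<partial>M) = (\<integral>x. Jac A vol \<eta> x * ?u (\<eta> x) \<partial>M)"
    by presburger
  also have "\<dots> = (\<integral>x. ?u x \<partial>M)"
    using tangent_Diff_vector_field(1)[OF \<eta>] V W
    by (intro integral_Jac_compose \<eta> smooth_fun_mult smooth_fun_const divergence_smooth)
  also have "\<dots> = H1_metric A vol M \<eta> V W"
    unfolding H1_metric_def by (rule integral_mult_right_zero)
  finally show ?thesis .
qed

text \<open>Joint continuity in time and space makes the domain of the coordinate expression open,
  so the derivatives behind \<open>smooth_on\<close> are meaningful there and the transport equation
  applies.\<close>

lemma curve_representation: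
  assumes c: "smooth_curve A c" and c0: "c 0 = \<eta>" and \<kappa>: "\<kappa> \<in> A" "p \<in> chart_dom \<kappa>"
    and \<theta>: "\<theta> \<in> A" "\<eta> p \<in> chart_dom \<theta>"
  obtains S where "open S" "(0, chart_fun \<kappa> p) \<in> S" "smooth_on S (\<lambda>x. local_rep \<kappa> \<theta> (c (fst x)) (snd x))"
    "\<And>t y. (t, y) \<in> S \<Longrightarrow> c t \<in> Diff A \<and> y \<in> chart_img \<kappa> \<and> c t (chart_inv \<kappa> y) \<in> chart_dom \<theta>"
proof -
  obtain \<epsilon> where \<epsilon>: "\<epsilon> > 0" "\<And>t. t \<in> {-\<epsilon><..<\<epsilon>} \<Longrightarrow> c t \<in> Diff A"
    "continuous_on ({-\<epsilon><..<\<epsilon>} \<times> UNIV) (\<lambda>(t, p). c t p)"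
    "smooth_on {(t, y). t \<in> {-\<epsilon><..<\<epsilon>} \<and> y \<in> chart_img \<kappa> \<and> c t (chart_inv \<kappa> y) \<in> chart_dom \<theta>}
        (\<lambda>(t, y). local_rep \<kappa> \<theta> (c t) y)"
    using c \<kappa>(1) \<theta>(1) unfolding smooth_curve_def by blast
  let ?S = "{(t, y). t \<in> {-\<epsilon><..<\<epsilon>} \<and> y \<in> chart_img \<kappa> \<and> c t (chart_inv \<kappa> y) \<in> chart_dom \<theta>}"
  let ?P = "{-\<epsilon><..<\<epsilon>} \<times> chart_img \<kappa>"
  have "continuous_on ?P (\<lambda>x. (fst x, chart_inv \<kappa> (snd x)))"
    by (intro continuous_intros continuous_on_compose2[OF continuous_on_chart_inv[OF \<kappa>(1)]]) auto
  then have "continuous_on ?P (\<lambda>x. (\<lambda>(t, p). c t p) (fst x, chart_inv \<kappa> (snd x)))"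
    by (rule continuous_on_compose2[OF \<epsilon>(3)]) auto
  then have "open (?P \<inter> (\<lambda>x. (\<lambda>(t, p). c t p) (fst x, chart_inv \<kappa> (snd x))) -` chart_dom \<theta>)"
    using \<kappa>(1) \<theta>(1) by (intro continuous_open_preimage open_Times open_chart_img open_chart_dom) auto
  also have "?P \<inter> (\<lambda>x. (\<lambda>(t, p). c t p) (fst x, chart_inv \<kappa> (snd x))) -` chart_dom \<theta> = ?S"
    by auto
  finally have "open ?S" .
  moreover have "(0, chart_fun \<kappa> p) \<in> ?S"
    using \<epsilon>(1) \<kappa> \<theta> c0 by auto
  moreover have "smooth_on ?S (\<lambda>x. local_rep \<kappa> \<theta> (c (fst x)) (snd x))"
    using \<epsilon>(4) by (simp add: case_prod_unfold)
  ultimately show thesis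
    by (rule that) (use \<epsilon>(2) in auto)
qed

text \<open>In one fixed pair of charts \<open>Psi\<close> along the curve becomes a single function
  \<open>\<Gamma>\<close>, smooth jointly in time and space, so its difference quotients converge
  uniformly near \<open>p\<close>. The transport equation identifies their limit.\<close>

lemma Psi_difference_quotient_local:
  assumes \<eta>: "\<eta> \<in> Diff A" and V: "V \<in> tangent_Diff A \<eta>"
    and c: "smooth_curve A c" and c0: "c 0 = \<eta>" and vel: "has_velocity A c V" and "e > 0"
  shows "\<exists>U \<delta>. open U \<and> p \<in> U \<and> \<delta> > 0 \<and> (\<forall>h x. h \<noteq> 0 \<longrightarrow> \<bar>h\<bar> < \<delta> \<longrightarrow> x \<in> U \<longrightarrow>
    \<bar>(Psi A vol (c h) x - Psi A vol \<eta> x) / h - Psi_differential \<eta> V x\<bar> < e)"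
proof -
  let ?D = "\<lambda>f x. frechet_derivative f (at x)"
  define v where "v = V \<circ> inv \<eta>"
  have v: "vector_field A v" and V_eq: "V q = v (\<eta> q)" for q
    using tangent_Diff_vector_field[OF \<eta> V] by (auto simp: v_def fun_eq_iff)
  define \<kappa> where "\<kappa> = chart_at A p"
  define \<theta> where "\<theta> = chart_at A (\<eta> p)"
  have \<kappa>: "\<kappa> \<in> A" "p \<in> chart_dom \<kappa>" and \<theta>: "\<theta> \<in> A" "\<eta> p \<in> chart_dom \<theta>"
    by (simp_all add: \<kappa>_def \<theta>_def chart_at)
  define C where "C = (\<lambda>x. local_rep \<kappa> \<theta> (c (fst x)) (snd x))"
  obtain S where S: "open S" "(0, chart_fun \<kappa> p) \<in> S" "smooth_on S C"
    "\<And>t y. (t, y) \<in> S \<Longrightarrow> c t \<in> Diff A \<and> y \<in> chart_img \<kappa> \<and> c t (chart_inv \<kappa> y) \<in> chart_dom \<theta>"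
    by (rule curve_representation[OF c c0 \<kappa> \<theta>, folded C_def]) (blast intro: that)
  have CS: "C ` S \<subseteq> chart_img \<theta>"
    using S(4) by (fastforce simp: C_def local_rep_def)
  define J where "J = (\<lambda>x. coeff \<theta> (C x) * det (matrix (\<lambda>h. ?D C x (0, h))))"
  define \<Gamma> where "\<Gamma> = (\<lambda>x. sqrt (J x / coeff \<kappa> (snd x)))"
  \<comment> \<open>The spatial part of the derivative of \<open>C\<close> is the local derivative
    of \<open>c t\<close>; hence \<open>J\<close> divided by the coefficient in the source chart is
    the Jacobian of \<open>c t\<close>.\<close>
  have spatial: "?D C (t, y) (0, h) = local_deriv \<kappa> \<theta> (c t) (chart_inv \<kappa> y) h" if "(t, y) \<in> S" for t y h
  proof -
    have "((\<lambda>z. C (t, z)) has_derivative (\<lambda>h. ?D C (t, y) (0, h))) (at y)"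
      by (rule has_derivative_compose[where f = "\<lambda>z. (t, z)" and x = y,
            OF _ smooth_on_has_derivative[OF S(3) that]])
        (auto intro!: derivative_eq_intros)
    then show ?thesis
      using S(4)[OF that] \<kappa>(1) by (simp add: local_deriv_def C_def frechet_derivative_eqI)
  qed
  have Jac: "J (t, y) / coeff \<kappa> y = Jac A vol (c t) (chart_inv \<kappa> y)" if "(t, y) \<in> S" for t y
    using S(4)[OF that] \<kappa>(1) \<theta>(1) Jac_eq[OF _ \<kappa>(1) _ \<theta>(1), of "c t" "chart_inv \<kappa> y"] spatial[OF that] DiffD(2)
    by (simp add: J_def C_def local_rep_def)
  have Psi: "\<Gamma> (t, y) = Psi A vol (c t) (chart_inv \<kappa> y)" if "(t, y) \<in> S" for t y
    using Jac[OF that] by (simp add: \<Gamma>_def Psi_def)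
  have "smooth_on S J"
    unfolding J_def
    using smooth_on_vec_nth[OF S(1) smooth_on_frechet_derivative[OF S(3)]]
    by (intro smooth_on_mult smooth_on_det S(1) smooth_on_compose[OF S(1) coeff_smooth[OF \<theta>(1)] S(3) CS])
      (simp add: matrix_def)
  moreover have "smooth_on S (\<lambda>x. coeff \<kappa> (snd x))"
    using S(4)
    by (intro smooth_on_compose[OF S(1) coeff_smooth[OF \<kappa>(1)]]
        smooth_on_bounded_linear[OF bounded_linear_snd] smooth_on_ident S(1)) auto
  ultimately have \<Gamma>: "smooth_on S \<Gamma>"
    unfolding \<Gamma>_def using S(4) Jac Jac_pos coeff_pos[OF \<kappa>(1)]
    by (intro smooth_on_sqrt smooth_on_divide S(1)) auto
  have rate: "?D \<Gamma> (0, y) (1, 0) = Psi_differential \<eta> V (chart_inv \<kappa> y)" if y: "(0, y) \<in> S" for y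
  proof -
    define q where "q = chart_inv \<kappa> y"
    have q: "q \<in> chart_dom \<kappa>" "y = chart_fun \<kappa> q" "\<eta> q \<in> chart_dom \<theta>" "C (0, y) = chart_fun \<theta> (\<eta> q)"
      using S(4)[OF y] \<kappa>(1) c0 by (auto simp: q_def C_def local_rep_def)
    have time: "((\<lambda>t. F (t, z)) has_vector_derivative ?D F (0, z) (1, 0)) (at 0)"
      if "smooth_on S F" "(0, z) \<in> S" for F :: "_ \<Rightarrow> 'x::real_normed_vector" and z
    proof -
      note DF = smooth_on_has_derivative[OF that]
      have "((\<lambda>t. F (t, z)) has_derivative (\<lambda>s. ?D F (0, z) (s, 0))) (at 0)"
        by (rule has_derivative_compose[where f = "\<lambda>t. (t, z)" and x = 0, OF _ DF])
          (auto intro!: derivative_eq_intros)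
      moreover have "?D F (0, z) (s, 0) = s *\<^sub>R ?D F (0, z) (1, 0)" for s
        using linear_scale[OF has_derivative_linear[OF DF], of s "(1, 0)"] by auto
      ultimately show ?thesis
        unfolding has_vector_derivative_def by (metis (no_types, lifting) ext)
    qed
    \<comment> \<open>\<open>has_velocity\<close> concerns the path of each single point, the
      transport equation the time derivative of \<open>C\<close>; uniqueness of derivatives
      identifies the two.\<close>
    have "?D C (0, z) (1, 0) = v (chart_inv \<theta> (C (0, z))) \<theta>" if "(0, z) \<in> S" for z
    proof -
      let ?q = "chart_inv \<kappa> z"
      have "((\<lambda>t. chart_fun \<theta> (c t ?q)) has_vector_derivative V ?q \<theta>) (at 0)"
        using vel S(4)[OF that] \<theta>(1) by (simp add: has_velocity_def)
      moreover have "chart_inv \<theta> (C (0, z)) = \<eta> ?q"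
        using S(4)[OF that] \<theta>(1) c0 by (simp add: C_def local_rep_def)
      ultimately show ?thesis
        using vector_derivative_unique_at[OF time[OF S(3) that]] by (simp add: C_def local_rep_def V_eq)
    qed
    moreover have det: "matrix (\<lambda>h. ?D C (0, y) (0, h)) = matrix (local_deriv \<kappa> \<theta> \<eta> q)"
      using spatial[OF y] c0 by (simp add: q_def)
    moreover have "det (matrix (local_deriv \<kappa> \<theta> \<eta> q)) > 0"
      using Diff_det_pos[OF \<eta> \<kappa>(1) \<theta>(1) q(1,3)] .
    ultimately have "((\<lambda>t. J (t, y)) has_real_derivative
        lie_coeff \<theta> v (C (0, y)) * det (matrix (\<lambda>h. ?D C (0, y) (0, h)))) (at 0)"
      unfolding J_def lie_coeff_def
      using v \<theta>(1)
      by (intro pulled_back_density_has_derivative[OF S(1) y S(3) CS coeff_smooth])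
        (auto simp: vector_field_def)
    moreover have "lie_coeff \<theta> v (C (0, y)) * det (matrix (\<lambda>h. ?D C (0, y) (0, h))) =
        divergence A vol v (\<eta> q) * J (0, y)"
      using divergence_eq[OF v \<theta>(1) q(3)] coeff_pos[OF \<theta>(1) chart_fun_in_img[OF q(3)]]
      by (simp add: J_def q(4))
    ultimately have "((\<lambda>t. J (t, y) / coeff \<kappa> y) has_real_derivative
        divergence A vol v (\<eta> q) * (J (0, y) / coeff \<kappa> y)) (at 0)"
      using DERIV_cdivide[of "\<lambda>t. J (t, y)" _ 0 UNIV "coeff \<kappa> y"] by simp
    moreover have pos: "J (0, y) / coeff \<kappa> y > 0"
      using Jac[OF y] Jac_pos S(4)[OF y] by simp
    ultimately have "((\<lambda>t. \<Gamma> (t, y)) has_real_derivative inverse (sqrt (J (0, y) / coeff \<kappa> y)) / 2 *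
        (divergence A vol v (\<eta> q) * (J (0, y) / coeff \<kappa> y))) (at 0)"
      unfolding \<Gamma>_def snd_conv by (intro DERIV_chain2[OF DERIV_real_sqrt])
    moreover have "inverse (sqrt (J (0, y) / coeff \<kappa> y)) / 2 *
        (divergence A vol v (\<eta> q) * (J (0, y) / coeff \<kappa> y)) = Psi_differential \<eta> V q"
    proof -
      \<comment> \<open>Here \<open>a\<close> is the Jacobian and \<open>d\<close> the divergence:
        the left side is the derivative of the square root times the rate of the Jacobian.\<close>
      have "inverse (sqrt a) / 2 * (d * a) = 1 / 2 * d * sqrt a" if "a > 0" for a d :: real
      proof -
        have "inverse (sqrt a) / 2 * (d * a) = 1 / 2 * d * (a / sqrt a)"
          by (simp only: divide_inverse mult_1_left ac_simps)
        then show ?thesis using that by (simp only: real_div_sqrt less_imp_le)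
      qed
      from this[OF pos] show ?thesis
        using Jac[OF y] c0 by (simp add: Psi_differential_def v_def q_def Psi_def)
    qed
    ultimately have "((\<lambda>t. \<Gamma> (t, y)) has_vector_derivative Psi_differential \<eta> V q) (at 0)"
      by (simp add: has_real_derivative_iff_has_vector_derivative)
    then show ?thesis
      using vector_derivative_unique_at[OF time[OF \<Gamma> y]] by (simp add: q_def)
  qed
  obtain \<delta> where \<delta>: "\<delta> > 0" "\<And>h y. h \<noteq> 0 \<Longrightarrow> \<bar>h\<bar> < \<delta> \<Longrightarrow> dist y (chart_fun \<kappa> p) < \<delta> \<Longrightarrow>
      (h, y) \<in> S \<and> (0, y) \<in> S \<and> \<bar>(\<Gamma> (h, y) - \<Gamma> (0, y)) / h - ?D \<Gamma> (0, y) (1, 0)\<bar> < e"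
    using locally_uniform_difference_quotient[OF S(1,2) \<Gamma> \<open>e > 0\<close>] by blast
  define U where "U = chart_dom \<kappa> \<inter> chart_fun \<kappa> -` ball (chart_fun \<kappa> p) \<delta>"
  have "open U"
    unfolding U_def
    using continuous_open_preimage[OF continuous_on_chart_fun[OF \<kappa>(1)] open_chart_dom[OF \<kappa>(1)]] by blast
  moreover have "p \<in> U" using \<kappa> \<delta> by (simp add: U_def)
  moreover have "\<bar>(Psi A vol (c h) x - Psi A vol \<eta> x) / h - Psi_differential \<eta> V x\<bar> < e"
    if "h \<noteq> 0" "\<bar>h\<bar> < \<delta>" "x \<in> U" for h x
    using \<delta>(2)[of h "chart_fun \<kappa> x"] that \<kappa>(1) c0 Psi[of h "chart_fun \<kappa> x"] Psi[of 0 "chart_fun \<kappa> x"]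
      rate[of "chart_fun \<kappa> x"]
    by (simp add: U_def dist_commute)
  ultimately show ?thesis using \<delta>(1) by blast
qed

text \<open>Finitely many of the neighbourhoods cover the manifold, so their time bounds hold
  simultaneously near 0.\<close>

lemma Psi_difference_quotient_uniform:
  assumes \<eta>: "\<eta> \<in> Diff A" and V: "V \<in> tangent_Diff A \<eta>"
    and c: "smooth_curve A c" "c 0 = \<eta>" "has_velocity A c V" and "e > 0"
  shows "\<forall>\<^sub>F h in at 0. \<forall>x. \<bar>(Psi A vol (c h) x - Psi A vol \<eta> x) / h - Psi_differential \<eta> V x\<bar> < e"
proof -
  let ?close = "\<lambda>h x. \<bar>(Psi A vol (c h) x - Psi A vol \<eta> x) / h - Psi_differential \<eta> V x\<bar> < e"
  let ?\<U> = "{U. open U \<and> (\<forall>\<^sub>F h in at 0. \<forall>x\<in>U. ?close h x)}"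
  have "p \<in> \<Union>?\<U>" for p
  proof -
    obtain U \<delta> where U: "open U" "p \<in> U" "\<delta> > 0"
      "\<forall>h x. h \<noteq> 0 \<longrightarrow> \<bar>h\<bar> < \<delta> \<longrightarrow> x \<in> U \<longrightarrow> ?close h x"
      using Psi_difference_quotient_local[OF assms, of p] by (elim exE conjE)
    then have "\<forall>\<^sub>F h in at 0. \<forall>x\<in>U. ?close h x"
      by (auto simp: eventually_at dist_real_def)
    with U show ?thesis by blast
  qed
  then have "UNIV \<subseteq> \<Union>?\<U>" by blast
  then obtain \<V> where \<V>: "\<V> \<subseteq> ?\<U>" "finite \<V>" "UNIV \<subseteq> \<Union>\<V>"
    by (rule compactE[OF compact]) auto
  then have "\<forall>\<^sub>F h in at 0. \<forall>U\<in>\<V>. \<forall>x\<in>U. ?close h x"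
    by (intro eventually_ball_finite) auto
  then show ?thesis
    by (rule eventually_mono) (use \<V>(3) in blast)
qed

text \<open>The total mass is 1. If the square is not integrable, its integral is 0 by convention
  and the bound is trivial.\<close>

lemma integral_square_le:
  fixes f :: "'m \<Rightarrow> real"
  assumes "\<And>x. \<bar>f x\<bar> \<le> e"
  shows "(\<integral>x. (f x)\<^sup>2 \<partial>M) \<le> e\<^sup>2"
proof (cases "integrable M (\<lambda>x. (f x)\<^sup>2)")
  case True
  have "(f x)\<^sup>2 \<le> e\<^sup>2" for x
    using power_mono[of "\<bar>f x\<bar>" e 2] assms[of x] by simp
  then have "(\<integral>x. (f x)\<^sup>2 \<partial>M) \<le> (\<integral>x. e\<^sup>2 \<partial>M)"
    by (intro integral_mono True) auto
  then show ?thesis by (simp add: measure_M)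
next
  case False
  then show ?thesis by (simp add: not_integrable_integral_eq)
qed

lemma Psi_L2_derivative:
  assumes "\<eta> \<in> Diff A" "V \<in> tangent_Diff A \<eta>" "smooth_curve A c" "c 0 = \<eta>" "has_velocity A c V"
  shows "((\<lambda>h. \<integral>x. ((Psi A vol (c h) x - Psi A vol \<eta> x) / h - Psi_differential \<eta> V x)\<^sup>2 \<partial>M) \<longlongrightarrow> 0) (at 0)"
proof (rule tendstoI)
  fix e :: real assume "e > 0"
  \<comment> \<open>This uniform bound is squared under the integral, and the resulting
    \<open>e / 2\<close> is strictly below \<open>e\<close>.\<close>
  then have "sqrt (e / 2) > 0" by simp
  from Psi_difference_quotient_uniform[OF assms this]
  show "\<forall>\<^sub>F h in at 0. dist (\<integral>x. ((Psi A vol (c h) x - Psi A vol \<eta> x) / h - Psi_differential \<eta> V x)\<^sup>2 \<partial>M) 0 < e"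
  proof eventually_elim
    case (elim h)
    let ?f = "\<lambda>x. (Psi A vol (c h) x - Psi A vol \<eta> x) / h - Psi_differential \<eta> V x"
    have "(\<integral>x. (?f x)\<^sup>2 \<partial>M) \<le> (sqrt (e / 2))\<^sup>2"
      using elim by (intro integral_square_le less_imp_le) auto
    moreover have "(\<integral>x. (?f x)\<^sup>2 \<partial>M) \<ge> 0" by simp
    ultimately show ?case
      using \<open>e > 0\<close> by (simp add: dist_real_def)
  qed
qed

lemma Psi_differential_linear:
  assumes \<eta>: "\<eta> \<in> Diff A" and V: "V \<in> tangent_Diff A \<eta>" and W: "W \<in> tangent_Diff A \<eta>"
  shows "Psi_differential \<eta> (\<lambda>p \<kappa>. a *\<^sub>R V p \<kappa> + b *\<^sub>R W p \<kappa>) =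
    (\<lambda>x. a * Psi_differential \<eta> V x + b * Psi_differential \<eta> W x)"
proof
  fix x
  have "(\<lambda>p \<kappa>. a *\<^sub>R V p \<kappa> + b *\<^sub>R W p \<kappa>) \<circ> inv \<eta> =
      (\<lambda>p \<kappa>. a *\<^sub>R (V \<circ> inv \<eta>) p \<kappa> + b *\<^sub>R (W \<circ> inv \<eta>) p \<kappa>)"
    by (simp add: fun_eq_iff)
  then show "Psi_differential \<eta> (\<lambda>p \<kappa>. a *\<^sub>R V p \<kappa> + b *\<^sub>R W p \<kappa>) x =
      a * Psi_differential \<eta> V x + b * Psi_differential \<eta> W x"
    using divergence_lincomb[OF tangent_Diff_vector_field(1)[OF \<eta> V] tangent_Diff_vector_field(1)[OF \<eta> W]]
    by (simp only: Psi_differential_def) (simp add: algebra_simps)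
qed

text \<open>Stated for every \<open>F\<close> that agrees with \<open>Psi\<close> on
  diffeomorphisms, since the map induced from the cosets is known to agree only there. A smooth
  curve is in \<open>Diff A\<close> for small times, so the difference quotients agree
  eventually.\<close>

lemma L2_differential_Psi:
  assumes \<eta>: "\<eta> \<in> Diff A" and F: "\<And>\<xi>. \<xi> \<in> Diff A \<Longrightarrow> F \<xi> = Psi A vol \<xi>"
  shows "L2_differential A M F \<eta> (Psi_differential \<eta>)"
  unfolding L2_differential_def
proof (intro ballI conjI allI impI)
  fix V c assume V: "V \<in> tangent_Diff A \<eta>" and c: "smooth_curve A c \<and> c 0 = \<eta> \<and> has_velocity A c V"
  have "\<forall>\<^sub>F h in at 0. F (c h) = Psi A vol (c h)"
    using c F unfolding smooth_curve_def eventually_at by (force simp: dist_real_def)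
  then have ev: "\<forall>\<^sub>F h in at 0. (\<integral>x. ((Psi A vol (c h) x - Psi A vol \<eta> x) / h - Psi_differential \<eta> V x)\<^sup>2 \<partial>M) =
      (\<integral>x. ((F (c h) x - F \<eta> x) / h - Psi_differential \<eta> V x)\<^sup>2 \<partial>M)"
    by eventually_elim (simp add: F[OF \<eta>])
  show "((\<lambda>h. \<integral>x. ((F (c h) x - F \<eta> x) / h - Psi_differential \<eta> V x)\<^sup>2 \<partial>M) \<longlongrightarrow> 0) (at 0)"
    using Psi_L2_derivative[OF \<eta> V] c by (intro Lim_transform_eventually[OF _ ev]) auto
qed (use Psi_differential_smooth Psi_differential_linear \<eta> in auto)

text \<open>The map induced on the quotient, through an arbitrary representative;
  \<open>Psi_eq_iff\<close> shows that the choice is immaterial.\<close>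

definition density_map :: "('m \<Rightarrow> 'm) set \<Rightarrow> 'm \<Rightarrow> real" where
  "density_map K = Psi A vol (SOME \<xi>. \<xi> \<in> Diff A \<and> right_coset A vol \<xi> = K)"

text \<open>The real square root is injective, so \<open>Psi\<close> retains the whole Jacobian, and
  the Jacobian determines the coset. One direction makes the induced map well defined, the other
  makes it injective.\<close>

lemma Psi_eq_iff:
  assumes "\<xi> \<in> Diff A" "\<eta> \<in> Diff A"
  shows "Psi A vol \<xi> = Psi A vol \<eta> \<longleftrightarrow> right_coset A vol \<xi> = right_coset A vol \<eta>"
  unfolding right_coset_eq_iff[OF assms] by (simp add: Psi_def fun_eq_iff)

lemma density_map_right_coset:
  assumes "\<xi> \<in> Diff A"
  shows "density_map (right_coset A vol \<xi>) = Psi A vol \<xi>"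
proof -
  let ?\<eta> = "SOME \<eta>. \<eta> \<in> Diff A \<and> right_coset A vol \<eta> = right_coset A vol \<xi>"
  have "?\<eta> \<in> Diff A \<and> right_coset A vol ?\<eta> = right_coset A vol \<xi>"
    by (rule someI[of _ \<xi>]) (simp add: assms)
  then show ?thesis
    unfolding density_map_def using Psi_eq_iff assms by blast
qed

lemma inj_on_density_map: "inj_on density_map (Dens A vol)"
  by (auto simp: inj_on_def Dens_def density_map_right_coset Psi_eq_iff)

end

theorem theorem5p5:
  fixes A :: "('m::t2_space, 'n::finite) chart set"
    and g :: "'m \<Rightarrow> ('m, 'n) tvec \<Rightarrow> ('m, 'n) tvec \<Rightarrow> real"
    and \<omega> :: "('m, 'n) nform"
    and M :: "'m measure"
  assumes "compact (UNIV :: 'm set)"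
    and "connected (UNIV :: 'm set)"
    and "oriented_atlas A"
    and "riemannian_metric A g"
    and "\<omega> = volume_form A g"
    and "measure_of_form A \<omega> M"
    and "emeasure M UNIV = 1"
  shows "\<exists>F.
    (\<forall>\<xi>\<in>Diff A. F (right_coset A \<omega> \<xi>) = Psi A \<omega> \<xi>) \<and>
    inj_on F (Dens A \<omega>) \<and>
    F ` Dens A \<omega> \<subseteq> L2_sphere A M \<and>
    (\<forall>\<eta>\<in>Diff A. \<exists>D.
      L2_differential A M (\<lambda>\<xi>. F (right_coset A \<omega> \<xi>)) \<eta> D \<and>
      (\<forall>V\<in>tangent_Diff A \<eta>. \<forall>W\<in>tangent_Diff A \<eta>.
        (\<integral>x. D V x * D W x \<partial>M) = H1_metric A \<omega> M \<eta> V W))"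
proof -
  interpret riemannian_volume A g M
    using assms by unfold_locales simp_all
  show ?thesis
    unfolding assms(5)
  proof (intro exI[of _ density_map] conjI ballI)
    show "density_map ` Dens A vol \<subseteq> L2_sphere A M"
      by (auto simp: Dens_def density_map_right_coset Psi_in_sphere)
    fix \<eta> assume "\<eta> \<in> Diff A"
    then show "\<exists>D. L2_differential A M (\<lambda>\<xi>. density_map (right_coset A vol \<xi>)) \<eta> D \<and>
      (\<forall>V\<in>tangent_Diff A \<eta>. \<forall>W\<in>tangent_Diff A \<eta>.
        (\<integral>x. D V x * D W x \<partial>M) = H1_metric A vol M \<eta> V W)"
      by (intro exI[of _ "Psi_differential \<eta>"] conjI ballI L2_differential_Psi
          density_map_right_coset Psi_differential_isometric)
  qed (simp_all add: density_map_right_coset inj_on_density_map)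
qed

end
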